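(* Let $K\subset\mathcal D$ be a compact set such that $$\Big\{\Big(\lambda\big(\tfrac{\alpha}{\theta}\big),\mu\big(\tfrac{\alpha}{\theta}\big)\Big):\ (\theta,\alpha)\in K\Big\}\subset\operatorname{int}\mathcal A_1 .$$ Then for $(t,x)\in\mathbb Z^2$ and positive integers $n$ such that $(\theta,\alpha):=\frac1n(t,x)\in K$, $$H(\{t\}\times\{x\})=\frac{1}{\sqrt n}\,\psi_1\Big(\lambda\big(\tfrac{\alpha}{\theta}\big),\mu\big(\tfrac{\alpha}{\theta}\big)\Big)\,C_H(\theta,\alpha)\,e^{-nD(\theta,\alpha)}\,(1+\varepsilon_n(t,x)),$$ where the remainder satisfies $$\lim_{n\to\infty}\ \sup_{(t,x)\in\mathbb Z^2,\ \frac1n(t,x)\in K}|\varepsilon_n(t,x)|=0 .$$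
   Context: **The random walk and renewal measure.** Let $\xi=(\tau,\zeta)$ and $\xi_1=(\tau_1,\zeta_1)$ be random vectors in $\mathbb R^2$ with $\tau>0$, $\tau_1\ge 0$. Let $\xi_k=(\tau_k,\zeta_k)$, $k\ge1$, be independent, where $\xi_1$ is the given vector and each $\xi_k$, $k\ge2$, has the law of $\xi$; put $\tau_0=\zeta_0=0$, $T_n=\sum_{k=0}^n\tau_k$, $Z_n=\sum_{k=0}^n\zeta_k$, $S_n=(T_n,Z_n)$. The renewal function (measure) is $H(B)=\sum_{k=0}^\infty\mathbf P(S_k\in B)$, $B\subset\mathbb R^2$. **Standing assumptions.** Cramér: $\mathbf E e^{\delta|\xi_1|}<\infty$ and $\mathbf E e^{\delta|\xi|}<\infty$ for some $\delta>0$. Arithmetic: $\mathbf P(\xi_1\in\mathbb Z^2)=1$, and the characteristic function $f(u)=\mathbf E e^{i\langle u,\xi\rangle}$ satisfies $f(2\pi u)=1$ for all $u\in\mathbb Z^2$ and $|f(2\pi u)|<1$ for all $u\in\mathbb R^2\setminus\mathbb Z^2$. **Transforms.** $\psi(\lambda,\mu)=\mathbf E e^{\lambda\tau+\mu\zeta}$, $\psi_1(\lambda,\mu)=\mathbf E e^{\lambda\tau_1+\mu\zeta_1}$, $A(\lambda,\mu)=\ln\psi(\lambda,\mu)$, $\mathcal A=\{(\lambda,\mu):\psi(\lambda,\mu)<\infty\}$, $\mathcal A_1=\{(\lambda,\mu):\psi_1(\lambda,\mu)<\infty\}$; $\operatorname{int}$ denotes interior. $A'$ is the gradient of $A(\lambda,\mu)$.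 $$\Lambda(\theta,\alpha)=\sup_{(\lambda,\mu)}\{\lambda\theta+\mu\alpha-A(\lambda,\mu)\},$$ which is analytic on $\mathcal L=\{A'(\lambda,\mu):(\lambda,\mu)\in\operatorname{int}\mathcal A\}$; $\Lambda''$ is its Hessian matrix, $|\Lambda''|$ its determinant. **One-variable functions.** Let $\mathcal A_\mu=\{\lambda:(\lambda,\mu)\in\mathcal A\}$, $\mu^+=\sup\{\mu:\mathcal A_\mu\ne\emptyset\}$, $\mu^-=\inf\{\mu:\mathcal A_\mu\neq\emptyset\}$. For $\mu\in(\mu^-,\mu^+)$ define (the one-variable function $A(\mu)$ is distinguished from $A(\lambda,\mu)$ by its number of arguments) $$A(\mu)=-\sup\{\lambda: A(\lambda,\mu)\le0\},\qquad A^\infty(\mu)=-\sup\{\lambda:A(\lambda,\mu)<\infty\},$$ and set $A(\mu)=\infty$ for $\mu\notin[\mu^-,\mu^+]$ and $A(\mu^\pm)=\lim A(\mu)$ as $\mu\to\mu^\pm$ from inside. Let $\mu_-=\max\{\mu<0:A(\mu)=A^\infty(\mu)\}$, $\mu_+=\min\{\mu>0:A(\mu)=A^\infty(\mu)\}$, with the convention that $(\mu_-,\mu_+)$ is the largest open interval containing $0$, contained in $(\mu^-,\mu^+)$, on which $A^\infty(\mu)<A(\mu)$ (so $\mu_\pm=\pm\infty$ is possible). On $(\mu_-,\mu_+)$ the function $A(\mu)$ is analytic and $A'(\mu)$ is strictly increasing. Let $\alpha_\pm=\lim A'(\mu)$ as $\mu\to\mu_\pm$ from inside $(\mu_-,\mu_+)$.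 For $\alpha\in(\alpha_-,\alpha_+)$ let $\mu(\alpha)$ be the unique solution in $(\mu_-,\mu_+)$ of $A'(\mu(\alpha))=\alpha$ and $\lambda(\alpha)=-A(\mu(\alpha))$. **Second deviation function.** $D(\theta,\alpha)=\sup\{\lambda\theta+\mu\alpha:\ A(\lambda,\mu)\le0\}$. On the cone $\mathcal D=\{(\theta,\alpha):\theta>0,\ \alpha/\theta\in(\alpha_-,\alpha_+)\}$ it is analytic and $D(\theta,\alpha)=\theta\lambda(\alpha/\theta)+\alpha\mu(\alpha/\theta)$. **Constant.** For $(\theta,\alpha)\in\mathcal D$ put $(\widehat\lambda,\widehat\mu)=(\lambda(\alpha/\theta),\mu(\alpha/\theta))$, $(\widehat\theta,\widehat\alpha)=A'(\widehat\lambda,\widehat\mu)$ (gradient of the two-variable $A$), $r_{\theta,\alpha}=\theta/\widehat\theta$, $\widehat\Lambda''=\Lambda''(\widehat\theta,\widehat\alpha)$, and $$C_H(\theta,\alpha)=\sqrt{\frac{r_{\theta,\alpha}}{2\pi}\,\frac{|\widehat\Lambda''|}{(\theta,\alpha)\widehat\Lambda''(\theta,\alpha)^\top}} .$$ *)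

theory Defs
  imports "HOL-Probability.Probability"
begin

text \<open>
  The increments are \<open>X 1, X 2, \<dots>\<close>; the value \<open>X 0\<close> is irrelevant, so that
  \<open>walk X 0 = (0, 0)\<close>.  Vectors of the plane are pairs; \<open>norm\<close> and \<open>\<bullet>\<close> on
  \<^typ>\<open>real \<times> real\<close> are Euclidean.
\<close>

definition walk :: "(nat \<Rightarrow> 'a \<Rightarrow> real \<times> real) \<Rightarrow> nat \<Rightarrow> 'a \<Rightarrow> real \<times> real" where
  "walk X n \<omega> = (\<Sum>k=1..n. X k \<omega>)"

definition renewal_measure ::
    "'a measure \<Rightarrow> (nat \<Rightarrow> 'a \<Rightarrow> real \<times> real) \<Rightarrow> (real \<times> real) set \<Rightarrow> ennreal" where
  "renewal_measure M X B = (\<Sum>k. emeasure M {\<omega> \<in> space M. walk X k \<omega> \<in> B})"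

definition char_fun :: "'a measure \<Rightarrow> ('a \<Rightarrow> real \<times> real) \<Rightarrow> real \<times> real \<Rightarrow> complex" where
  "char_fun M Y u = (CLINT \<omega>|M. iexp (u \<bullet> Y \<omega>))"

definition psi :: "'a measure \<Rightarrow> ('a \<Rightarrow> real \<times> real) \<Rightarrow> real \<times> real \<Rightarrow> ennreal" where
  "psi M Y p = (\<integral>\<^sup>+\<omega>. ennreal (exp (p \<bullet> Y \<omega>)) \<partial>M)"

definition psi_dom :: "'a measure \<Rightarrow> ('a \<Rightarrow> real \<times> real) \<Rightarrow> (real \<times> real) set" where
  "psi_dom M Y = {p. psi M Y p < \<infinity>}"

text \<open>The two-variable function \<open>A = ln \<psi>\<close>, with \<open>ln \<infinity> = \<infinity>\<close>; \<open>\<psi>\<close> never vanishes.\<close>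

definition A2 :: "'a measure \<Rightarrow> ('a \<Rightarrow> real \<times> real) \<Rightarrow> real \<times> real \<Rightarrow> ereal" where
  "A2 M Y p = (if psi M Y p < \<infinity> then ereal (ln (enn2real (psi M Y p))) else \<infinity>)"

definition Lambda :: "'a measure \<Rightarrow> ('a \<Rightarrow> real \<times> real) \<Rightarrow> real \<times> real \<Rightarrow> ereal" where
  "Lambda M Y v = (SUP p. ereal (p \<bullet> v) - A2 M Y p)"

definition partial1 :: "(real \<times> real \<Rightarrow> real) \<Rightarrow> real \<times> real \<Rightarrow> real" where
  "partial1 f p = deriv (\<lambda>s. f (s, snd p)) (fst p)"

definition partial2 :: "(real \<times> real \<Rightarrow> real) \<Rightarrow> real \<times> real \<Rightarrow> real" where
  "partial2 f p = deriv (\<lambda>s. f (fst p, s)) (snd p)"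

definition gradient :: "(real \<times> real \<Rightarrow> real) \<Rightarrow> real \<times> real \<Rightarrow> real \<times> real" where
  "gradient f p = (partial1 f p, partial2 f p)"

definition hessian :: "(real \<times> real \<Rightarrow> real) \<Rightarrow> real \<times> real \<Rightarrow> real^2^2" where
  "hessian f p = vector [vector [partial1 (partial1 f) p, partial1 (partial2 f) p],
                         vector [partial2 (partial1 f) p, partial2 (partial2 f) p]]"

definition A_section :: "'a measure \<Rightarrow> ('a \<Rightarrow> real \<times> real) \<Rightarrow> real \<Rightarrow> real set" where
  "A_section M Y \<mu> = {l. (l, \<mu>) \<in> psi_dom M Y}"

text \<open>
  The outer bounds \<open>\<mu>\<^sup>-\<close>, \<open>\<mu>\<^sup>+\<close> of the range of \<open>\<mu>\<close>; these are different from
  the bounds \<open>\<mu>\<^sub>-\<close>, \<open>\<mu>\<^sub>+\<close>, called \<open>mu_minus\<close> and \<open>mu_plus\<close> below.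
\<close>

definition mu_lower :: "'a measure \<Rightarrow> ('a \<Rightarrow> real \<times> real) \<Rightarrow> ereal" where
  "mu_lower M Y = Inf (ereal ` {\<mu>. A_section M Y \<mu> \<noteq> {}})"

definition mu_upper :: "'a measure \<Rightarrow> ('a \<Rightarrow> real \<times> real) \<Rightarrow> ereal" where
  "mu_upper M Y = Sup (ereal ` {\<mu>. A_section M Y \<mu> \<noteq> {}})"

text \<open>
  The one-variable function \<open>A(\<mu>)\<close>: \<open>A1_inner\<close> is its formula on
  \<open>(\<mu>\<^sup>-, \<mu>\<^sup>+)\<close>, and \<open>A1\<close> extends it to the real line.
\<close>

definition A1_inner :: "'a measure \<Rightarrow> ('a \<Rightarrow> real \<times> real) \<Rightarrow> real \<Rightarrow> ereal" where
  "A1_inner M Y \<mu> = - Sup (ereal ` {l. A2 M Y (l, \<mu>) \<le> 0})"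

definition A1 :: "'a measure \<Rightarrow> ('a \<Rightarrow> real \<times> real) \<Rightarrow> real \<Rightarrow> ereal" where
  "A1 M Y \<mu> =
     (if mu_lower M Y < ereal \<mu> \<and> ereal \<mu> < mu_upper M Y then A1_inner M Y \<mu>
      else if ereal \<mu> = mu_upper M Y then Lim (at_left \<mu>) (A1_inner M Y)
      else if ereal \<mu> = mu_lower M Y then Lim (at_right \<mu>) (A1_inner M Y)
      else \<infinity>)"

definition A1_infty :: "'a measure \<Rightarrow> ('a \<Rightarrow> real \<times> real) \<Rightarrow> real \<Rightarrow> ereal" where
  "A1_infty M Y \<mu> = - Sup (ereal ` {l. A2 M Y (l, \<mu>) < \<infinity>})"

text \<open>
  The largest open interval around 0 inside \<open>(\<mu>\<^sup>-, \<mu>\<^sup>+)\<close> on which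
  \<open>A\<^sup>\<infinity>(\<mu>) < A(\<mu>)\<close>: a union of open intervals containing 0 is again one.
\<close>

definition mu_interval :: "'a measure \<Rightarrow> ('a \<Rightarrow> real \<times> real) \<Rightarrow> real set" where
  "mu_interval M Y = \<Union>{I. open I \<and> is_interval I \<and> 0 \<in> I \<and>
     (\<forall>\<mu>\<in>I. mu_lower M Y < ereal \<mu> \<and> ereal \<mu> < mu_upper M Y \<and> A1_infty M Y \<mu> < A1 M Y \<mu>)}"

definition mu_minus :: "'a measure \<Rightarrow> ('a \<Rightarrow> real \<times> real) \<Rightarrow> ereal" where
  "mu_minus M Y = Inf (ereal ` mu_interval M Y)"

definition mu_plus :: "'a measure \<Rightarrow> ('a \<Rightarrow> real \<times> real) \<Rightarrow> ereal" where
  "mu_plus M Y = Sup (ereal ` mu_interval M Y)"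

definition A1_deriv :: "'a measure \<Rightarrow> ('a \<Rightarrow> real \<times> real) \<Rightarrow> real \<Rightarrow> real" where
  "A1_deriv M Y \<mu> = deriv (\<lambda>s. real_of_ereal (A1 M Y s)) \<mu>"

text \<open>
  One-sided limits are taken in \<^typ>\<open>ereal\<close>, so that infinite \<open>\<mu>\<^sub>-\<close>, \<open>\<mu>\<^sub>+\<close>
  (limits at \<open>-\<infinity>\<close>, \<open>\<infinity>\<close>) and infinite values of the limits are covered.
\<close>

definition alpha_minus :: "'a measure \<Rightarrow> ('a \<Rightarrow> real \<times> real) \<Rightarrow> ereal" where
  "alpha_minus M Y = Lim (at_right (mu_minus M Y)) (\<lambda>m. ereal (A1_deriv M Y (real_of_ereal m)))"

definition alpha_plus :: "'a measure \<Rightarrow> ('a \<Rightarrow> real \<times> real) \<Rightarrow> ereal" where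
  "alpha_plus M Y = Lim (at_left (mu_plus M Y)) (\<lambda>m. ereal (A1_deriv M Y (real_of_ereal m)))"

definition mu_of :: "'a measure \<Rightarrow> ('a \<Rightarrow> real \<times> real) \<Rightarrow> real \<Rightarrow> real" where
  "mu_of M Y \<alpha> =
     (THE \<mu>. mu_minus M Y < ereal \<mu> \<and> ereal \<mu> < mu_plus M Y \<and> A1_deriv M Y \<mu> = \<alpha>)"

definition lambda_of :: "'a measure \<Rightarrow> ('a \<Rightarrow> real \<times> real) \<Rightarrow> real \<Rightarrow> real" where
  "lambda_of M Y \<alpha> = - real_of_ereal (A1 M Y (mu_of M Y \<alpha>))"

definition second_deviation :: "'a measure \<Rightarrow> ('a \<Rightarrow> real \<times> real) \<Rightarrow> real \<times> real \<Rightarrow> ereal" where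
  "second_deviation M Y v = (SUP p\<in>{p. A2 M Y p \<le> 0}. ereal (p \<bullet> v))"

definition deviation_cone :: "'a measure \<Rightarrow> ('a \<Rightarrow> real \<times> real) \<Rightarrow> (real \<times> real) set" where
  "deviation_cone M Y =
     {(\<theta>, \<alpha>). \<theta> > 0 \<and> alpha_minus M Y < ereal (\<alpha> / \<theta>) \<and> ereal (\<alpha> / \<theta>) < alpha_plus M Y}"

definition saddle :: "'a measure \<Rightarrow> ('a \<Rightarrow> real \<times> real) \<Rightarrow> real \<times> real \<Rightarrow> real \<times> real" where
  "saddle M Y = (\<lambda>(\<theta>, \<alpha>). (lambda_of M Y (\<alpha> / \<theta>), mu_of M Y (\<alpha> / \<theta>)))"

definition C_H :: "'a measure \<Rightarrow> ('a \<Rightarrow> real \<times> real) \<Rightarrow> real \<times> real \<Rightarrow> real" where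
  "C_H M Y = (\<lambda>(\<theta>, \<alpha>).
     let hat = gradient (\<lambda>p. real_of_ereal (A2 M Y p)) (saddle M Y (\<theta>, \<alpha>));
         r = \<theta> / fst hat;
         L = hessian (\<lambda>v. real_of_ereal (Lambda M Y v)) hat;
         v = (vector [\<theta>, \<alpha>] :: real^2)
     in sqrt (r / (2 * pi) * (det L / (v \<bullet> (L *v v)))))"

end

theory Submission
  imports Defs
begin

text \<open>
  Write \<open>m\<close> for the gradient of \<open>\<psi>\<close> at the saddle point \<open>p\<close> of \<open>v = (\<theta>, \<alpha>)\<close> and \<open>\<Sigma>\<close> for the Hessian of \<open>A\<close>
  there. The saddle point lies on the curve \<open>\<psi> = 1\<close>, and \<open>v = r m\<close>. Exponential tilting by \<open>p\<close> turns
  \<open>P(S\<^sub>j\<^sub>+\<^sub>1 = n v)\<close> into \<open>exp (- n D(v))\<close> times a Fourier integral of \<open>\<psi>\<^sub>1 \<psi>^j\<close> over a unit square, so that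
  what remains is a local limit theorem for walks with drift \<open>m\<close> and covariance \<open>\<Sigma>\<close>, summed over \<open>j\<close>.

  On the scale \<open>j = n r + y sqrt n\<close> the tilted probabilities times \<open>n\<close> converge to a Gaussian function of \<open>y\<close> and
  are dominated by a multiple of \<open>exp (- c \<bar>y\<bar>)\<close>; the sum over \<open>j\<close> is the integral over \<open>y\<close> of a step function, and
  dominated convergence gives the constant \<open>C\<^sub>H\<close>, because \<open>\<Lambda>'' = \<Sigma>\<^sup>-\<^sup>1\<close> at \<open>m\<close>. All limits are taken along sequences
  \<open>n\<^sub>k \<rightarrow> \<infinity>\<close>, \<open>v\<^sub>k \<rightarrow> v\<close> in \<open>K\<close>, so that uniformity on the compact set \<open>K\<close> comes for free from continuity of the
  saddle point.
\<close>

section \<open>Exponential moments\<close>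

definition subexp :: "(real \<times> real \<Rightarrow> real) \<Rightarrow> bool" where
  "subexp g \<longleftrightarrow> g \<in> borel_measurable borel \<and> (\<forall>\<eta>>0. \<exists>C. \<forall>y. \<bar>g y\<bar> \<le> C * exp (\<eta> * norm y))"

lemma subexp_const [simp]: "subexp (\<lambda>_. c)"
  unfolding subexp_def
proof (intro conjI allI impI)
  fix \<eta> :: real assume "\<eta> > 0"
  then have "\<bar>c\<bar> \<le> \<bar>c\<bar> * exp (\<eta> * norm y)" for y :: "real \<times> real"
    by (simp add: mult_le_cancel_left1)
  then show "\<exists>C. \<forall>y::real \<times> real. \<bar>c\<bar> \<le> C * exp (\<eta> * norm y)" by blast
qed simp

lemma subexp_le_norm:
  assumes "g \<in> borel_measurable borel" "\<And>y. \<bar>g y\<bar> \<le> norm y"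
  shows "subexp g"
  unfolding subexp_def
proof (intro conjI allI impI)
  fix \<eta> :: real assume \<eta>: "\<eta> > 0"
  have "\<bar>g y\<bar> \<le> (1 / \<eta>) * exp (\<eta> * norm y)" for y
  proof -
    have "\<eta> * norm y \<le> exp (\<eta> * norm y)"
      using exp_ge_add_one_self[of "\<eta> * norm y"] by linarith
    then show ?thesis using assms(2)[of y] \<eta> by (simp add: field_simps) (metis mult.commute mult_left_mono less_eq_real_def order_trans)
  qed
  then show "\<exists>C. \<forall>y. \<bar>g y\<bar> \<le> C * exp (\<eta> * norm y)" by blast
qed (use assms in auto)

lemma subexp_norm [simp]: "subexp norm"
  by (rule subexp_le_norm) auto

lemma subexp_fst [simp]: "subexp fst"
  by (rule subexp_le_norm) (auto simp: norm_fst_le borel_measurable_continuous_onI continuous_on_fst simp flip: real_norm_def)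

lemma subexp_snd [simp]: "subexp snd"
  by (rule subexp_le_norm) (auto simp: norm_snd_le borel_measurable_continuous_onI continuous_on_snd simp flip: real_norm_def)

lemma subexp_mult [simp]:
  assumes "subexp f" "subexp g"
  shows "subexp (\<lambda>y. f y * g y)"
  unfolding subexp_def
proof (intro conjI allI impI)
  fix \<eta> :: real assume \<eta>: "\<eta> > 0"
  obtain C1 where C1: "\<And>y. \<bar>f y\<bar> \<le> C1 * exp (\<eta> / 2 * norm y)"
    using assms(1) \<eta> unfolding subexp_def by (meson half_gt_zero)
  obtain C2 where C2: "\<And>y. \<bar>g y\<bar> \<le> C2 * exp (\<eta> / 2 * norm y)"
    using assms(2) \<eta> unfolding subexp_def by (meson half_gt_zero)
  have "\<bar>f y * g y\<bar> \<le> (C1 * C2) * exp (\<eta> * norm y)" for y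
  proof -
    have "\<bar>f y * g y\<bar> \<le> (C1 * exp (\<eta> / 2 * norm y)) * (C2 * exp (\<eta> / 2 * norm y))"
      unfolding abs_mult using C1[of y] C2[of y]
      by (intro mult_mono) (auto intro: order_trans[OF abs_ge_zero])
    also have "\<dots> = (C1 * C2) * exp (\<eta> * norm y)"
      by (simp add: mult_exp_exp algebra_simps)
    finally show ?thesis .
  qed
  then show "\<exists>C. \<forall>y. \<bar>f y * g y\<bar> \<le> C * exp (\<eta> * norm y)" by blast
qed (use assms in \<open>auto simp: subexp_def\<close>)

lemma subexp_power [simp]: "subexp g \<Longrightarrow> subexp (\<lambda>y. g y ^ k)"
  by (induction k) auto

lemma subexp_add [simp]:
  assumes "subexp f" "subexp g"
  shows "subexp (\<lambda>y. f y + g y)"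
  unfolding subexp_def
proof (intro conjI allI impI)
  fix \<eta> :: real assume \<eta>: "\<eta> > 0"
  obtain C1 where C1: "\<And>y. \<bar>f y\<bar> \<le> C1 * exp (\<eta> * norm y)"
    using assms(1) \<eta> unfolding subexp_def by meson
  obtain C2 where C2: "\<And>y. \<bar>g y\<bar> \<le> C2 * exp (\<eta> * norm y)"
    using assms(2) \<eta> unfolding subexp_def by meson
  have "\<bar>f y + g y\<bar> \<le> (C1 + C2) * exp (\<eta> * norm y)" for y
    using C1[of y] C2[of y] by (simp add: algebra_simps)
  then show "\<exists>C. \<forall>y. \<bar>f y + g y\<bar> \<le> C * exp (\<eta> * norm y)" by blast
qed (use assms in \<open>auto simp: subexp_def\<close>)

lemma exp_second_order:
  fixes x :: real
  shows "\<bar>exp x - 1 - x\<bar> \<le> x\<^sup>2 * exp \<bar>x\<bar>"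
proof -
  obtain t where t: "\<bar>t\<bar> \<le> \<bar>x\<bar>" "exp x = (\<Sum>m<2. x ^ m / fact m) + exp t / fact 2 * x ^ 2"
    using Maclaurin_exp_le by blast
  then have "exp x - 1 - x = exp t / 2 * x\<^sup>2" by (simp add: numeral_2_eq_2)
  moreover have "exp t \<le> exp \<bar>x\<bar>" using t(1) by simp
  then have "exp t / 2 * x\<^sup>2 \<le> x\<^sup>2 * exp \<bar>x\<bar>"
    using exp_gt_zero[of "\<bar>x\<bar>"] by (subst mult.commute, intro mult_left_mono; linarith?) auto
  moreover have "exp t / 2 * x\<^sup>2 \<ge> 0" by simp
  ultimately show ?thesis by linarith
qed

lemma inner_real_pair: "(p::real \<times> real) \<bullet> y = fst p * fst y + snd p * snd y"
  by (simp add: inner_prod_def)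

locale random_vector = prob_space M for M :: "'a measure" +
  fixes Y :: "'a \<Rightarrow> real \<times> real"
  assumes Y_measurable [measurable]: "Y \<in> borel_measurable M"
begin

lemma subexp_measurable: "subexp g \<Longrightarrow> (\<lambda>\<omega>. g (Y \<omega>)) \<in> borel_measurable M"
  unfolding subexp_def using measurable_compose[OF Y_measurable] by blast

definition mom :: "(real \<times> real \<Rightarrow> real) \<Rightarrow> real \<times> real \<Rightarrow> real" where
  "mom g p = (\<integral>\<omega>. g (Y \<omega>) * exp (p \<bullet> Y \<omega>) \<partial>M)"

abbreviation mgf :: "real \<times> real \<Rightarrow> real" where
  "mgf \<equiv> mom (\<lambda>_. 1)"

abbreviation dom :: "(real \<times> real) set" where
  "dom \<equiv> psi_dom M Y"

lemma dom_iff: "p \<in> dom \<longleftrightarrow> integrable M (\<lambda>\<omega>. exp (p \<bullet> Y \<omega>))"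
  by (simp add: psi_dom_def psi_def integrable_iff_bounded)

lemma psi_eq_mgf: "p \<in> dom \<Longrightarrow> psi M Y p = ennreal (mgf p)"
  unfolding dom_iff psi_def mom_def by (subst nn_integral_eq_integral) auto

lemma mgf_pos: "p \<in> dom \<Longrightarrow> mgf p > 0"
  unfolding dom_iff mom_def
  by (simp add: integral_less_AE_space[of "\<lambda>_. 0", simplified] emeasure_space_1)

lemma enn2real_psi: "p \<in> dom \<Longrightarrow> enn2real (psi M Y p) = mgf p"
  using mgf_pos[of p] by (simp add: psi_eq_mgf)

lemma A2_eq_ln: "p \<in> dom \<Longrightarrow> A2 M Y p = ereal (ln (mgf p))"
  by (simp add: A2_def enn2real_psi) (simp add: psi_dom_def)

lemma A2_infinite: "p \<notin> dom \<Longrightarrow> A2 M Y p = \<infinity>"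
  by (simp add: A2_def psi_dom_def)

lemma A2_less_infinity_iff: "A2 M Y p < \<infinity> \<longleftrightarrow> p \<in> dom"
  using A2_eq_ln[of p] A2_infinite[of p] by (cases "p \<in> dom") auto

lemma A2_le_0_iff: "A2 M Y p \<le> 0 \<longleftrightarrow> p \<in> dom \<and> mgf p \<le> 1"
  using mgf_pos[of p] by (cases "p \<in> dom") (auto simp: A2_eq_ln A2_infinite zero_ereal_def)

lemma interior_exp_norm:
  assumes "p \<in> interior dom"
  obtains e where "e > 0" "integrable M (\<lambda>\<omega>. exp (p \<bullet> Y \<omega> + e * norm (Y \<omega>)))"
proof -
  obtain d where d: "d > 0" "ball p d \<subseteq> dom"
    using assms by (meson mem_interior)
  define e where "e = d / 4"
  have e: "e > 0" using d by (simp add: e_def)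
  define q where "q a b = p + (a * e, b * e)" for a b :: real
  have q: "q a b \<in> dom" if "\<bar>a\<bar> = 1" "\<bar>b\<bar> = 1" for a b
  proof -
    have "norm (a * e, b * e) \<le> \<bar>a * e\<bar> + \<bar>b * e\<bar>"
      using norm_Pair_le[of "a * e" "b * e"] by simp
    also have "\<dots> < d" using that e d(1) by (simp add: abs_mult e_def)
    also have "norm (a * e, b * e) = dist p (q a b)" by (simp add: q_def dist_norm norm_Pair)
    finally have "q a b \<in> ball p d" by simp
    then show ?thesis using d by blast
  qed
  have int: "integrable M (\<lambda>\<omega>. exp (q 1 1 \<bullet> Y \<omega>) + exp (q 1 (-1) \<bullet> Y \<omega>) + exp (q (-1) 1 \<bullet> Y \<omega>) + exp (q (-1) (-1) \<bullet> Y \<omega>))"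
    using q by (intro Bochner_Integration.integrable_add) (auto simp: dom_iff)
  have "integrable M (\<lambda>\<omega>. exp (p \<bullet> Y \<omega> + e * norm (Y \<omega>)))"
  proof (rule Bochner_Integration.integrable_bound[OF int])
    have "exp (p \<bullet> y + e * norm y) \<le> exp (q 1 1 \<bullet> y) + exp (q 1 (-1) \<bullet> y) + exp (q (-1) 1 \<bullet> y) + exp (q (-1) (-1) \<bullet> y)" for y
    proof -
      define a b where "a = (if fst y \<ge> 0 then 1 else -1 :: real)" and "b = (if snd y \<ge> 0 then 1 else -1 :: real)"
      have "norm y \<le> \<bar>fst y\<bar> + \<bar>snd y\<bar>"
        using norm_Pair_le[of "fst y" "snd y"] by simp
      then have "e * norm y \<le> e * (a * fst y + b * snd y)"
        using e by (intro mult_left_mono) (auto simp: a_def b_def)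
      then have "exp (p \<bullet> y + e * norm y) \<le> exp (q a b \<bullet> y)"
        by (simp add: q_def inner_real_pair algebra_simps)
      also have "\<dots> \<le> exp (q 1 1 \<bullet> y) + exp (q 1 (-1) \<bullet> y) + exp (q (-1) 1 \<bullet> y) + exp (q (-1) (-1) \<bullet> y)"
        by (auto simp: a_def b_def intro: add_increasing add_increasing2)
      finally show ?thesis .
    qed
    then show "AE \<omega> in M. norm (exp (p \<bullet> Y \<omega> + e * norm (Y \<omega>))) \<le> norm (exp (q 1 1 \<bullet> Y \<omega>) + exp (q 1 (-1) \<bullet> Y \<omega>) + exp (q (-1) 1 \<bullet> Y \<omega>) + exp (q (-1) (-1) \<bullet> Y \<omega>))"
      by (auto intro: order_trans[OF _ abs_ge_self])
  qed auto
  then show ?thesis using that e by blast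
qed

lemma subexp_tilt_bound:
  assumes g: "subexp g" and "norm (q - p) + d < e"
  obtains C where "\<And>y. \<bar>g y\<bar> * exp (q \<bullet> y + d * norm y) \<le> C * exp (p \<bullet> y + e * norm y)"
proof -
  define \<eta> where "\<eta> = e - d - norm (q - p)"
  have "\<eta> > 0" using assms by (simp add: \<eta>_def)
  then obtain C where C: "\<And>y. \<bar>g y\<bar> \<le> C * exp (\<eta> * norm y)"
    using g unfolding subexp_def by blast
  have C0: "C \<ge> 0" using C[of 0] by simp
  have "\<bar>g y\<bar> * exp (q \<bullet> y + d * norm y) \<le> C * exp (p \<bullet> y + e * norm y)" for y
  proof -
    have "(q - p) \<bullet> y \<le> norm (q - p) * norm y" by (rule norm_cauchy_schwarz)
    then have *: "\<eta> * norm y + (q \<bullet> y + d * norm y) \<le> p \<bullet> y + e * norm y"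
      by (simp add: \<eta>_def algebra_simps inner_diff_left)
    have "\<bar>g y\<bar> * exp (q \<bullet> y + d * norm y) \<le> C * exp (\<eta> * norm y) * exp (q \<bullet> y + d * norm y)"
      using C by (intro mult_right_mono) auto
    also have "\<dots> = C * exp (\<eta> * norm y + (q \<bullet> y + d * norm y))" by (simp add: exp_add)
    also have "\<dots> \<le> C * exp (p \<bullet> y + e * norm y)" using * C0 by (intro mult_left_mono) auto
    finally show ?thesis .
  qed
  then show ?thesis using that by blast
qed

lemma tilt_integrable:
  assumes "integrable M (\<lambda>\<omega>. exp (p \<bullet> Y \<omega> + e * norm (Y \<omega>)))" "norm (q - p) + d < e" "subexp g"
  shows "integrable M (\<lambda>\<omega>. g (Y \<omega>) * exp (q \<bullet> Y \<omega> + d * norm (Y \<omega>)))"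
proof -
  obtain C where C: "\<And>y. \<bar>g y\<bar> * exp (q \<bullet> y + d * norm y) \<le> C * exp (p \<bullet> y + e * norm y)"
    using subexp_tilt_bound[OF assms(3,2)] by blast
  have m [measurable]: "(\<lambda>\<omega>. g (Y \<omega>)) \<in> borel_measurable M" using assms(3) by (rule subexp_measurable)
  show ?thesis
  proof (rule Bochner_Integration.integrable_bound[OF integrable_mult_right[OF assms(1), of C]])
    show "AE \<omega> in M. norm (g (Y \<omega>) * exp (q \<bullet> Y \<omega> + d * norm (Y \<omega>))) \<le> norm (C * exp (p \<bullet> Y \<omega> + e * norm (Y \<omega>)))"
    proof (rule AE_I2)
      show "norm (g (Y \<omega>) * exp (q \<bullet> Y \<omega> + d * norm (Y \<omega>))) \<le> norm (C * exp (p \<bullet> Y \<omega> + e * norm (Y \<omega>)))" for \<omega>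
        using order_trans[OF C[of "Y \<omega>"] abs_ge_self] by (simp only: real_norm_def abs_mult abs_exp_cancel)
    qed
  qed measurable
qed

lemma interior_dom_if_exp_norm:
  assumes "integrable M (\<lambda>\<omega>. exp (p \<bullet> Y \<omega> + e * norm (Y \<omega>)))" "e > 0"
  shows "p \<in> interior dom"
proof -
  have "q \<in> dom" if "dist p q < e" for q
    using tilt_integrable[OF assms(1), of q 0 "\<lambda>_. 1"] that by (simp add: dom_iff dist_norm norm_minus_commute)
  then show ?thesis using assms(2) unfolding mem_interior by (intro exI[of _ e]) auto
qed

lemma mom_integrable:
  assumes "p \<in> interior dom" "subexp g"
  shows "integrable M (\<lambda>\<omega>. g (Y \<omega>) * exp (p \<bullet> Y \<omega>))"
proof -
  obtain e where "e > 0" "integrable M (\<lambda>\<omega>. exp (p \<bullet> Y \<omega> + e * norm (Y \<omega>)))"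
    using interior_exp_norm[OF assms(1)] by blast
  then show ?thesis using tilt_integrable[of p e p 0 g] assms(2) by simp
qed

lemma mom_second_order:
  assumes p: "p \<in> interior dom" and g: "subexp g"
  obtains e C where "e > 0" "C \<ge> 0" "\<And>q h. norm (q - p) \<le> e \<Longrightarrow> norm h \<le> e \<Longrightarrow>
     \<bar>mom g (q + h) - mom g q - (fst h * mom (\<lambda>y. g y * fst y) q + snd h * mom (\<lambda>y. g y * snd y) q)\<bar> \<le> C * (norm h)\<^sup>2"
    "\<And>q. norm (q - p) \<le> e \<Longrightarrow> q \<in> interior dom"
proof -
  obtain e where e: "e > 0" "integrable M (\<lambda>\<omega>. exp (p \<bullet> Y \<omega> + e * norm (Y \<omega>)))"
    using interior_exp_norm[OF p] by blast
  define G where "G y = \<bar>g y\<bar> * (norm y)\<^sup>2" for y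
  have ag: "subexp (\<lambda>y. \<bar>g y\<bar>)" using g unfolding subexp_def by auto
  have G: "subexp G" unfolding G_def using ag by (intro subexp_mult subexp_power) auto
  define C where "C = (\<integral>\<omega>. G (Y \<omega>) * exp (p \<bullet> Y \<omega> + (3 / 4 * e) * norm (Y \<omega>)) \<partial>M)"
  have intG: "integrable M (\<lambda>\<omega>. G (Y \<omega>) * exp (p \<bullet> Y \<omega> + (3 / 4 * e) * norm (Y \<omega>)))"
    using e by (intro tilt_integrable[OF e(2)] G) auto
  have C0: "C \<ge> 0" unfolding C_def G_def by (intro Bochner_Integration.integral_nonneg) auto
  have inti: "q \<in> interior dom" if "norm (q - p) \<le> e / 2" for q
    using tilt_integrable[OF e(2), of q "e/4" "\<lambda>_. 1"] that e by (intro interior_dom_if_exp_norm[of q "e/4"]) auto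
  have bd: "\<bar>mom g (q + h) - mom g q - (fst h * mom (\<lambda>y. g y * fst y) q + snd h * mom (\<lambda>y. g y * snd y) q)\<bar> \<le> C * (norm h)\<^sup>2"
    if qh: "norm (q - p) \<le> e / 4" "norm h \<le> e / 4" for q h
  proof -
    have q: "q \<in> interior dom" using qh e by (intro inti) auto
    have "norm (q + h - p) \<le> norm (q - p) + norm h"
      using norm_triangle_ineq[of "q - p" h] by (simp add: algebra_simps)
    then have q': "q + h \<in> interior dom" using qh e by (intro inti) auto
    note I = mom_integrable[OF q g] mom_integrable[OF q' g]
      mom_integrable[OF q subexp_mult[OF g subexp_fst]] mom_integrable[OF q subexp_mult[OF g subexp_snd]]
    have J: "integrable M (\<lambda>\<omega>. fst h * (g (Y \<omega>) * fst (Y \<omega>) * exp (q \<bullet> Y \<omega>)))"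
        "integrable M (\<lambda>\<omega>. snd h * (g (Y \<omega>) * snd (Y \<omega>) * exp (q \<bullet> Y \<omega>)))"
      by (intro integrable_mult_right I)+
    have int4: "integrable M (\<lambda>\<omega>. g (Y \<omega>) * exp ((q + h) \<bullet> Y \<omega>) - g (Y \<omega>) * exp (q \<bullet> Y \<omega>)
           - (fst h * (g (Y \<omega>) * fst (Y \<omega>) * exp (q \<bullet> Y \<omega>)) + snd h * (g (Y \<omega>) * snd (Y \<omega>) * exp (q \<bullet> Y \<omega>))))"
      by (rule Bochner_Integration.integrable_diff[OF Bochner_Integration.integrable_diff[OF I(2) I(1)]
            Bochner_Integration.integrable_add[OF J(1) J(2)]])
    have eq: "mom g (q + h) - mom g q - (fst h * mom (\<lambda>y. g y * fst y) q + snd h * mom (\<lambda>y. g y * snd y) q)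
       = (\<integral>\<omega>. g (Y \<omega>) * exp ((q + h) \<bullet> Y \<omega>) - g (Y \<omega>) * exp (q \<bullet> Y \<omega>)
           - (fst h * (g (Y \<omega>) * fst (Y \<omega>) * exp (q \<bullet> Y \<omega>)) + snd h * (g (Y \<omega>) * snd (Y \<omega>) * exp (q \<bullet> Y \<omega>))) \<partial>M)"
      unfolding mom_def
      by (simp only: Bochner_Integration.integral_diff[OF Bochner_Integration.integrable_diff[OF I(2) I(1)]
            Bochner_Integration.integrable_add[OF J(1) J(2)]]
          Bochner_Integration.integral_diff[OF I(2) I(1)] Bochner_Integration.integral_add[OF J(1) J(2)]
          integral_mult_right_zero)
    have "\<bar>mom g (q + h) - mom g q - (fst h * mom (\<lambda>y. g y * fst y) q + snd h * mom (\<lambda>y. g y * snd y) q)\<bar>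
        \<le> (\<integral>\<omega>. (norm h)\<^sup>2 * (G (Y \<omega>) * exp (p \<bullet> Y \<omega> + (3 / 4 * e) * norm (Y \<omega>))) \<partial>M)"
      unfolding eq
    proof (rule order_trans[OF integral_abs_bound], rule integral_mono)
      show "integrable M (\<lambda>\<omega>. (norm h)\<^sup>2 * (G (Y \<omega>) * exp (p \<bullet> Y \<omega> + (3 / 4 * e) * norm (Y \<omega>))))"
        using intG by (rule integrable_mult_right)
      show "integrable M (\<lambda>\<omega>. \<bar>g (Y \<omega>) * exp ((q + h) \<bullet> Y \<omega>) - g (Y \<omega>) * exp (q \<bullet> Y \<omega>)
           - (fst h * (g (Y \<omega>) * fst (Y \<omega>) * exp (q \<bullet> Y \<omega>)) + snd h * (g (Y \<omega>) * snd (Y \<omega>) * exp (q \<bullet> Y \<omega>)))\<bar>)"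
        by (intro integrable_abs int4)
      fix \<omega> 
      define y where "y = Y \<omega>"
      have le: "\<bar>h \<bullet> y\<bar> \<le> norm h * norm y" using Cauchy_Schwarz_ineq2 by blast
      have "\<bar>exp (h \<bullet> y) - 1 - h \<bullet> y\<bar> \<le> (h \<bullet> y)\<^sup>2 * exp \<bar>h \<bullet> y\<bar>" by (rule exp_second_order)
      also have "\<dots> \<le> (norm h * norm y)\<^sup>2 * exp (e / 4 * norm y)"
      proof (intro mult_mono)
        show "(h \<bullet> y)\<^sup>2 \<le> (norm h * norm y)\<^sup>2" using le by (metis abs_ge_zero power2_abs power_mono)
        have "norm h * norm y \<le> e / 4 * norm y" using qh by (intro mult_right_mono) auto
        then show "exp \<bar>h \<bullet> y\<bar> \<le> exp (e / 4 * norm y)" using le by simp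
      qed auto
      finally have 1: "\<bar>exp (h \<bullet> y) - 1 - h \<bullet> y\<bar> \<le> (norm h * norm y)\<^sup>2 * exp (e / 4 * norm y)" .
      have "(q - p) \<bullet> y \<le> norm (q - p) * norm y" by (rule norm_cauchy_schwarz)
      also have "\<dots> \<le> e / 4 * norm y" using qh by (intro mult_right_mono) auto
      finally have 2: "q \<bullet> y \<le> p \<bullet> y + e / 4 * norm y" by (simp add: inner_diff_left)
      have "g y * exp ((q + h) \<bullet> y) - g y * exp (q \<bullet> y) - (fst h * (g y * fst y * exp (q \<bullet> y)) + snd h * (g y * snd y * exp (q \<bullet> y)))
        = g y * exp (q \<bullet> y) * (exp (h \<bullet> y) - 1 - h \<bullet> y)"
        by (simp add: inner_add_left exp_add right_diff_distrib inner_real_pair[of h]) (simp add: algebra_simps)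
      also have "\<bar>\<dots>\<bar> \<le> \<bar>g y\<bar> * exp (p \<bullet> y + e / 4 * norm y) * ((norm h * norm y)\<^sup>2 * exp (e / 4 * norm y))"
        unfolding abs_mult using 1 2 by (intro mult_mono) auto
      also have "\<dots> = (norm h)\<^sup>2 * (G y * (exp (p \<bullet> y + e / 4 * norm y) * exp (e / 4 * norm y)))"
        by (simp only: G_def power_mult_distrib mult_ac)
      also have "\<dots> \<le> (norm h)\<^sup>2 * (G y * exp (p \<bullet> y + (3 / 4 * e) * norm y))"
      proof (intro mult_left_mono)
        show "exp (p \<bullet> y + e / 4 * norm y) * exp (e / 4 * norm y) \<le> exp (p \<bullet> y + (3 / 4 * e) * norm y)"
          using e by (simp add: mult_exp_exp)
      qed (auto simp: G_def)
      finally show "\<bar>g (Y \<omega>) * exp ((q + h) \<bullet> Y \<omega>) - g (Y \<omega>) * exp (q \<bullet> Y \<omega>)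
           - (fst h * (g (Y \<omega>) * fst (Y \<omega>) * exp (q \<bullet> Y \<omega>)) + snd h * (g (Y \<omega>) * snd (Y \<omega>) * exp (q \<bullet> Y \<omega>)))\<bar>
         \<le> (norm h)\<^sup>2 * (G (Y \<omega>) * exp (p \<bullet> Y \<omega> + (3 / 4 * e) * norm (Y \<omega>)))"
        unfolding y_def .
    qed
    also have "\<dots> = C * (norm h)\<^sup>2" by (simp add: C_def)
    finally show ?thesis .
  qed
  show ?thesis
  proof (rule that[of "e / 4" C])
    show "q \<in> interior dom" if "norm (q - p) \<le> e / 4" for q
      using that e(1) by (intro inti) simp
  qed (use e(1) C0 in simp, use e(1) C0 in simp, rule bd)
qed

lemma mom_has_derivative:
  assumes "p \<in> interior dom" "subexp g"
  shows "(mom g has_derivative (\<lambda>h. fst h * mom (\<lambda>y. g y * fst y) p + snd h * mom (\<lambda>y. g y * snd y) p)) (at p)"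
proof -
  define D where "D = (\<lambda>h::real \<times> real. fst h * mom (\<lambda>y. g y * fst y) p + snd h * mom (\<lambda>y. g y * snd y) p)"
  obtain e C where e: "e > 0" "C \<ge> 0" and *: "\<And>q h. norm (q - p) \<le> e \<Longrightarrow> norm h \<le> e \<Longrightarrow>
     \<bar>mom g (q + h) - mom g q - (fst h * mom (\<lambda>y. g y * fst y) q + snd h * mom (\<lambda>y. g y * snd y) q)\<bar> \<le> C * (norm h)\<^sup>2"
    and "\<And>q. norm (q - p) \<le> e \<Longrightarrow> q \<in> interior dom"
    by (rule mom_second_order[OF assms]) (rule that)
  have bl: "bounded_linear D"
    using bounded_linear_inner_left[of "(mom (\<lambda>y. g y * fst y) p, mom (\<lambda>y. g y * snd y) p)"]
    by (simp add: D_def inner_real_pair)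
  have "(\<lambda>h. norm (mom g (p + h) - mom g p - D h) / norm h) \<midarrow>0\<rightarrow> 0"
  proof (rule Lim_null_comparison)
    have "\<forall>\<^sub>F h in at 0. norm h < e \<and> h \<noteq> (0::real\<times>real)"
      using e unfolding eventually_at by (intro exI[of _ e]) auto
    then show "\<forall>\<^sub>F h in at 0. norm (norm (mom g (p + h) - mom g p - D h) / norm h) \<le> C * norm h"
    proof (eventually_elim)
      case (elim h)
      then show ?case using *[of p h] e by (simp add: D_def field_simps power2_eq_square)
    qed
    have "((\<lambda>h::real\<times>real. C * norm h) \<longlongrightarrow> C * norm (0::real\<times>real)) (at 0)"
      by (intro tendsto_intros)
    then show "((\<lambda>h::real\<times>real. C * norm h) \<longlongrightarrow> 0) (at 0)" by simp
  qed
  then show ?thesis using bl unfolding D_def[symmetric] has_derivative_at by blast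
qed

lemma mom_isCont: "p \<in> interior dom \<Longrightarrow> subexp g \<Longrightarrow> isCont (mom g) p"
  using mom_has_derivative has_derivative_continuous by blast

end

section \<open>Tilted laws of a lattice step\<close>

lemma (in prob_space) integral_pos_if_not_AE_zero:
  fixes f :: "'a \<Rightarrow> real"
  assumes "integrable M f" "\<And>\<omega>. f \<omega> \<ge> 0" "\<not> (AE \<omega> in M. f \<omega> = 0)"
  shows "integral\<^sup>L M f > 0"
  using assms integral_nonneg_eq_0_iff_AE[of M f] Bochner_Integration.integral_nonneg[of M f]
  by (auto simp: less_le)

lemma exp_gt_add_one:
  fixes x :: real
  assumes "x \<noteq> 0"
  shows "1 + x < exp x"
proof (cases "x \<ge> -2")
  case True
  have "1 + x < (1 + x / 2)\<^sup>2" using assms by (simp add: power2_eq_square algebra_simps) (metis not_real_square_gt_zero)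
  also have "\<dots> \<le> (exp (x / 2))\<^sup>2"
    using True by (intro power_mono) auto
  also have "\<dots> = exp x" by (simp add: exp_double[symmetric])
  finally show ?thesis .
next
  case False
  then have "1 + x < 0" by simp
  also have "0 < exp x" by simp
  finally show ?thesis .
qed

lemma (in prob_space) AE_cos_eq_1:
  assumes [measurable]: "f \<in> borel_measurable M" and "(\<integral>\<omega>. cos (f \<omega>) \<partial>M) = (1::real)"
  shows "AE \<omega> in M. cos (f \<omega>) = 1"
proof -
  have i: "integrable M (\<lambda>\<omega>. cos (f \<omega>))"
    by (rule integrable_const_bound[of _ 1]) auto
  have "(\<integral>\<omega>. 1 - cos (f \<omega>) \<partial>M) = 0"
    using assms i by (simp add: prob_space)
  then have "AE \<omega> in M. 1 - cos (f \<omega>) = 0"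
    using i by (subst (asm) integral_nonneg_eq_0_iff_AE) auto
  then show ?thesis by eventually_elim simp
qed

locale lattice_step = random_vector M Y for M :: "'a measure" and Y +
  fixes \<delta> :: real
  assumes fst_pos: "AE \<omega> in M. fst (Y \<omega>) > 0"
    and delta_pos: "\<delta> > 0"
    and cramer: "integrable M (\<lambda>\<omega>. exp (\<delta> * norm (Y \<omega>)))"
    and char_fun_lattice: "\<And>u. u \<in> \<int> \<times> \<int> \<Longrightarrow> char_fun M Y ((2 * pi) *\<^sub>R u) = 1"
    and char_fun_off_lattice: "\<And>u. u \<notin> \<int> \<times> \<int> \<Longrightarrow> norm (char_fun M Y ((2 * pi) *\<^sub>R u)) < 1"
begin

lemma AE_inner_integer:
  assumes "u \<in> \<int> \<times> \<int>"
  shows "AE \<omega> in M. u \<bullet> Y \<omega> \<in> \<int>"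
proof -
  have i: "integrable M (\<lambda>\<omega>. iexp (((2 * pi) *\<^sub>R u) \<bullet> Y \<omega>))"
    by (rule integrable_const_bound[of _ 1]) auto
  have "Re (char_fun M Y ((2 * pi) *\<^sub>R u)) = (\<integral>\<omega>. Re (iexp (((2 * pi) *\<^sub>R u) \<bullet> Y \<omega>)) \<partial>M)"
    unfolding char_fun_def using i by (rule integral_Re[symmetric])
  then have "(\<integral>\<omega>. cos (((2 * pi) *\<^sub>R u) \<bullet> Y \<omega>) \<partial>M) = 1"
    using char_fun_lattice[OF assms] by (simp add: Re_exp)
  then have "AE \<omega> in M. cos (((2 * pi) *\<^sub>R u) \<bullet> Y \<omega>) = 1"
    by (rule AE_cos_eq_1[rotated]) measurable
  then show ?thesis
  proof eventually_elim
    case (elim \<omega>)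
    then obtain n :: int where "((2 * pi) *\<^sub>R u) \<bullet> Y \<omega> = of_int n * 2 * pi"
      unfolding cos_one_2pi_int by blast
    then have "u \<bullet> Y \<omega> = n" by simp
    then show ?case by simp
  qed
qed

lemma AE_lattice: "AE \<omega> in M. Y \<omega> \<in> \<int> \<times> \<int>"
  using AE_inner_integer[of "(1, 0)"] AE_inner_integer[of "(0, 1)"]
  by (auto simp: inner_real_pair mem_Times_iff)

lemma AE_fst_ge_1: "AE \<omega> in M. fst (Y \<omega>) \<ge> 1"
  using AE_lattice fst_pos
proof eventually_elim
  case (elim \<omega>)
  then obtain k :: int where "fst (Y \<omega>) = k" by (auto simp: mem_Times_iff elim: Ints_cases)
  then show ?case using elim by simp
qed

lemma lattice_if_phase_const:
  assumes "AE \<omega> in M. cos (2 * pi * (u \<bullet> Y \<omega>) - \<theta>) = 1"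
  shows "u \<in> \<int> \<times> \<int>"
proof (rule ccontr)
  assume "u \<notin> \<int> \<times> \<int>"
  have "AE \<omega> in M. iexp (((2 * pi) *\<^sub>R u) \<bullet> Y \<omega>) = iexp \<theta>"
    using assms
  proof eventually_elim
    case (elim \<omega>)
    then obtain n :: int where n: "2 * pi * (u \<bullet> Y \<omega>) - \<theta> = of_int n * 2 * pi"
      unfolding cos_one_2pi_int by blast
    then have "((2 * pi) *\<^sub>R u) \<bullet> Y \<omega> = \<theta> + 2 * pi * of_int n" by (simp add: algebra_simps)
    then have "iexp (((2 * pi) *\<^sub>R u) \<bullet> Y \<omega>) = iexp \<theta> * exp (2 * of_real pi * of_int n * \<i>)"
      by (simp add: exp_add[symmetric] algebra_simps)
    also have "exp (2 * of_real pi * of_int n * \<i>) = (1::complex)"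
      using exp_two_pi_i exp_integer_2pi[of "of_int n"] by (simp add: mult_ac)
    finally show ?case by simp
  qed
  then have "char_fun M Y ((2 * pi) *\<^sub>R u) = (CLINT \<omega>|M. iexp \<theta>)"
    unfolding char_fun_def by (intro integral_cong_AE) auto
  then have "norm (char_fun M Y ((2 * pi) *\<^sub>R u)) = 1" by (simp add: prob_space)
  with char_fun_off_lattice[OF \<open>u \<notin> \<int> \<times> \<int>\<close>] show False by simp
qed

lemma (in -) half_not_Ints: "(1 / 2 :: real) \<notin> \<int>"
proof
  assume "(1 / 2 :: real) \<in> \<int>"
  then obtain k :: int where "1 / 2 = real_of_int k" by (auto elim: Ints_cases)
  then have "1 = real_of_int (2 * k)" by simp
  then have "1 = 2 * k" by (metis of_int_eq_1_iff)
  then show False by presburger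
qed

lemma not_AE_inner_const:
  assumes "u \<noteq> 0"
  shows "\<not> (AE \<omega> in M. u \<bullet> Y \<omega> = b)"
proof
  assume *: "AE \<omega> in M. u \<bullet> Y \<omega> = b"
  obtain s where s: "s *\<^sub>R u \<notin> \<int> \<times> \<int>"
  proof (cases "fst u = 0")
    case True
    then have "(1 / (2 * snd u)) *\<^sub>R u \<notin> \<int> \<times> \<int>"
      using assms half_not_Ints by (auto simp: mem_Times_iff prod_eq_iff)
    then show ?thesis by (rule that)
  next
    case False
    then have "(1 / (2 * fst u)) *\<^sub>R u \<notin> \<int> \<times> \<int>"
      using assms half_not_Ints by (auto simp: mem_Times_iff)
    then show ?thesis by (rule that)
  qed
  have "AE \<omega> in M. cos (2 * pi * ((s *\<^sub>R u) \<bullet> Y \<omega>) - 2 * pi * (s * b)) = 1"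
    using * by eventually_elim simp
  then show False using lattice_if_phase_const s by blast
qed

lemma zero_interior: "0 \<in> interior dom"
  using interior_dom_if_exp_norm[of 0 \<delta>] cramer delta_pos by simp

definition grad :: "real \<times> real \<Rightarrow> real \<times> real" where
  "grad p = (mom fst p, mom snd p)"

lemma tilted_exp_gap:
  assumes p: "p \<in> interior dom" and q: "q \<in> dom" and "q \<noteq> p"
  shows "mgf p + (q - p) \<bullet> grad p - ((q - p) \<bullet> c) * mgf p < exp (- ((q - p) \<bullet> c)) * mgf q"
proof -
  define f where "f \<omega> = exp (p \<bullet> Y \<omega>) * (exp ((q - p) \<bullet> (Y \<omega> - c)) - 1 - (q - p) \<bullet> (Y \<omega> - c))" for \<omega>
  have I: "integrable M (\<lambda>\<omega>. exp (p \<bullet> Y \<omega>))" "integrable M (\<lambda>\<omega>. exp (q \<bullet> Y \<omega>))"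
    "integrable M (\<lambda>\<omega>. fst (Y \<omega>) * exp (p \<bullet> Y \<omega>))" "integrable M (\<lambda>\<omega>. snd (Y \<omega>) * exp (p \<bullet> Y \<omega>))"
    using mom_integrable[OF p, of "\<lambda>_. 1"] mom_integrable[OF p, of fst] mom_integrable[OF p, of snd] q
    by (auto simp: dom_iff)
  have f_eq: "f = (\<lambda>\<omega>. exp (- ((q - p) \<bullet> c)) * exp (q \<bullet> Y \<omega>) + (((q - p) \<bullet> c - 1) * exp (p \<bullet> Y \<omega>)
       - (fst (q - p) * (fst (Y \<omega>) * exp (p \<bullet> Y \<omega>)) + snd (q - p) * (snd (Y \<omega>) * exp (p \<bullet> Y \<omega>)))))"
  proof (rule ext)
    fix \<omega>
    have "exp (p \<bullet> Y \<omega>) * exp ((q - p) \<bullet> (Y \<omega> - c)) = exp (- ((q - p) \<bullet> c)) * exp (q \<bullet> Y \<omega>)"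
      unfolding mult_exp_exp by (simp add: inner_diff_left inner_diff_right)
    moreover have "(q - p) \<bullet> (Y \<omega> - c) = fst (q - p) * fst (Y \<omega>) + snd (q - p) * snd (Y \<omega>) - (q - p) \<bullet> c"
      by (simp add: inner_diff_right inner_real_pair[of "q - p" "Y \<omega>"])
    ultimately show "f \<omega> = exp (- ((q - p) \<bullet> c)) * exp (q \<bullet> Y \<omega>) + (((q - p) \<bullet> c - 1) * exp (p \<bullet> Y \<omega>)
       - (fst (q - p) * (fst (Y \<omega>) * exp (p \<bullet> Y \<omega>)) + snd (q - p) * (snd (Y \<omega>) * exp (p \<bullet> Y \<omega>))))"
      unfolding f_def right_diff_distrib by (simp only:) (simp only: algebra_simps)
  qed
  note J = integrable_mult_right[OF I(2), of "exp (- ((q - p) \<bullet> c))"] integrable_mult_right[OF I(1), of "(q - p) \<bullet> c - 1"]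
    integrable_mult_right[OF I(3), of "fst (q - p)"] integrable_mult_right[OF I(4), of "snd (q - p)"]
  note J' = Bochner_Integration.integrable_add[OF J(3,4)]
  note J'' = Bochner_Integration.integrable_diff[OF J(2) J']
  have "integrable M f" unfolding f_eq by (rule Bochner_Integration.integrable_add[OF J(1) J''])
  moreover have "f \<omega> \<ge> 0" for \<omega>
    unfolding f_def by (intro mult_nonneg_nonneg exp_ge_zero) (use exp_ge_add_one_self[of "(q - p) \<bullet> (Y \<omega> - c)"] in linarith)
  moreover have "\<not> (AE \<omega> in M. f \<omega> = 0)"
  proof
    assume "AE \<omega> in M. f \<omega> = 0"
    then have "AE \<omega> in M. (q - p) \<bullet> Y \<omega> = (q - p) \<bullet> c"
    proof eventually_elim
      case (elim \<omega>)
      then have "exp ((q - p) \<bullet> (Y \<omega> - c)) = 1 + (q - p) \<bullet> (Y \<omega> - c)" by (simp add: f_def)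
      then have "(q - p) \<bullet> (Y \<omega> - c) = 0"
        using exp_gt_add_one by fastforce
      then show ?case by (simp add: inner_diff_right)
    qed
    then show False using not_AE_inner_const[of "q - p"] assms(3) by auto
  qed
  ultimately have "integral\<^sup>L M f > 0" by (rule integral_pos_if_not_AE_zero)
  also have "integral\<^sup>L M f = exp (- ((q - p) \<bullet> c)) * mgf q + (((q - p) \<bullet> c - 1) * mgf p - (fst (q - p) * mom fst p + snd (q - p) * mom snd p))"
    unfolding f_eq mom_def
    by (simp only: Bochner_Integration.integral_add[OF J(1) J''] Bochner_Integration.integral_diff[OF J(2) J']
        Bochner_Integration.integral_add[OF J(3,4)] integral_mult_right_zero mult_1)
  finally show ?thesis
    by (simp add: grad_def inner_real_pair[of _ "(mom fst p, mom snd p)"] algebra_simps)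
qed

lemma mgf_gradient_gap:
  assumes "p \<in> interior dom" "q \<in> dom" "q \<noteq> p"
  shows "mgf p + (q - p) \<bullet> grad p < mgf q"
  using tilted_exp_gap[OF assms, of 0] by simp

definition mean :: "real \<times> real \<Rightarrow> real \<times> real" where
  "mean p = (mom fst p / mgf p, mom snd p / mgf p)"

lemma grad_eq_mean: "p \<in> dom \<Longrightarrow> grad p = mgf p *\<^sub>R mean p"
  using mgf_pos[of p] by (simp add: grad_def mean_def)

lemma ln_mgf_gradient_gap:
  assumes "p \<in> interior dom" "q \<in> dom" "q \<noteq> p"
  shows "ln (mgf p) + (q - p) \<bullet> mean p < ln (mgf q)"
proof -
  have p: "p \<in> dom" using assms(1) interior_subset by blast
  have "mgf p < exp (- ((q - p) \<bullet> mean p)) * mgf q"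
    using tilted_exp_gap[OF assms, of "mean p"] by (simp add: grad_eq_mean[OF p] algebra_simps)
  then have "ln (mgf p) < ln (exp (- ((q - p) \<bullet> mean p)) * mgf q)"
    using mgf_pos[OF p] mgf_pos[OF assms(2)] by (subst ln_less_cancel_iff) auto
  then show ?thesis using mgf_pos[OF assms(2)] by (simp add: ln_mult)
qed

definition cv :: "(real \<times> real \<Rightarrow> real) \<Rightarrow> (real \<times> real \<Rightarrow> real) \<Rightarrow> real \<times> real \<Rightarrow> real" where
  "cv f g p = mom (\<lambda>y. f y * g y) p / mgf p - (mom f p / mgf p) * (mom g p / mgf p)"

lemma ratio_has_derivative:
  assumes p: "p \<in> interior dom" and g: "subexp g"
  shows "((\<lambda>q. mom g q / mgf q) has_derivative (\<lambda>h. fst h * cv g fst p + snd h * cv g snd p)) (at p)"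
proof -
  have pos: "mgf p > 0" using p interior_subset mgf_pos by blast
  have d1: "(mgf has_derivative (\<lambda>h. fst h * mom fst p + snd h * mom snd p)) (at p)"
    using mom_has_derivative[OF p, of "\<lambda>_. 1"] by (simp cong: if_cong)
  show ?thesis
    by (rule has_derivative_eq_rhs, rule has_derivative_divide'[OF mom_has_derivative[OF p g] d1])
      (use pos in \<open>auto simp: cv_def field_simps fun_eq_iff\<close>)
qed

lemma cv_commute: "cv f g p = cv g f p"
  by (simp add: cv_def mult.commute)

definition dmean :: "real \<times> real \<Rightarrow> real \<times> real \<Rightarrow> real \<times> real" where
  "dmean p h = (fst h * cv fst fst p + snd h * cv fst snd p, fst h * cv fst snd p + snd h * cv snd snd p)"

lemma mean_has_derivative:
  assumes "p \<in> interior dom"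
  shows "(mean has_derivative dmean p) (at p)"
proof -
  have "((\<lambda>q. (mom fst q / mgf q, mom snd q / mgf q)) has_derivative
    (\<lambda>h. (fst h * cv fst fst p + snd h * cv fst snd p, fst h * cv snd fst p + snd h * cv snd snd p))) (at p)"
    using assms by (intro has_derivative_Pair ratio_has_derivative) auto
  then show ?thesis
    unfolding mean_def[abs_def] dmean_def[abs_def] cv_commute[of snd fst] .
qed

lemma ln_mgf_has_derivative:
  assumes p: "p \<in> interior dom"
  shows "((\<lambda>q. ln (mgf q)) has_derivative (\<lambda>h. h \<bullet> mean p)) (at p)"
proof -
  have pos: "mgf p > 0" using p interior_subset mgf_pos by blast
  have d1: "(mgf has_derivative (\<lambda>h. fst h * mom fst p + snd h * mom snd p)) (at p)"
    using mom_has_derivative[OF p, of "\<lambda>_. 1"] by simp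
  show ?thesis
    by (rule has_derivative_eq_rhs, rule has_derivative_ln[OF pos d1])
       (use pos in \<open>auto simp: mean_def inner_real_pair field_simps fun_eq_iff\<close>)
qed

lemma tilted_variance:
  assumes p: "p \<in> interior dom" and b: "b = u1 * (mom fst p / mgf p) + u2 * (mom snd p / mgf p)"
  shows "integrable M (\<lambda>\<omega>. (u1 * fst (Y \<omega>) + u2 * snd (Y \<omega>) - b)\<^sup>2 * exp (p \<bullet> Y \<omega>))" (is "integrable M ?f")
    and "(\<integral>\<omega>. (u1 * fst (Y \<omega>) + u2 * snd (Y \<omega>) - b)\<^sup>2 * exp (p \<bullet> Y \<omega>) \<partial>M) =
      mgf p * (u1\<^sup>2 * cv fst fst p + 2 * u1 * u2 * cv fst snd p + u2\<^sup>2 * cv snd snd p)"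
proof -
  have pos: "mgf p > 0" using p interior_subset mgf_pos by blast
  have I: "integrable M (\<lambda>\<omega>. exp (p \<bullet> Y \<omega>))"
    "integrable M (\<lambda>\<omega>. fst (Y \<omega>) * exp (p \<bullet> Y \<omega>))" "integrable M (\<lambda>\<omega>. snd (Y \<omega>) * exp (p \<bullet> Y \<omega>))"
    "integrable M (\<lambda>\<omega>. fst (Y \<omega>) * fst (Y \<omega>) * exp (p \<bullet> Y \<omega>))"
    "integrable M (\<lambda>\<omega>. fst (Y \<omega>) * snd (Y \<omega>) * exp (p \<bullet> Y \<omega>))"
    "integrable M (\<lambda>\<omega>. snd (Y \<omega>) * snd (Y \<omega>) * exp (p \<bullet> Y \<omega>))"
    using mom_integrable[OF p, of "\<lambda>_. 1"] mom_integrable[OF p, of fst] mom_integrable[OF p, of snd]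
      mom_integrable[OF p, of "\<lambda>y. fst y * fst y"] mom_integrable[OF p, of "\<lambda>y. fst y * snd y"]
      mom_integrable[OF p, of "\<lambda>y. snd y * snd y"] by auto
  note J = integrable_mult_right[OF I(4), of "u1\<^sup>2"] integrable_mult_right[OF I(5), of "2 * u1 * u2"]
    integrable_mult_right[OF I(6), of "u2\<^sup>2"] integrable_mult_right[OF I(2), of "2 * b * u1"]
    integrable_mult_right[OF I(3), of "2 * b * u2"] integrable_mult_right[OF I(1), of "b\<^sup>2"]
  note J1 = Bochner_Integration.integrable_add[OF J(1,2)]
  note J2 = Bochner_Integration.integrable_add[OF J1 J(3)]
  note J3 = Bochner_Integration.integrable_diff[OF J2 J(4)]
  note J4 = Bochner_Integration.integrable_diff[OF J3 J(5)]
  have f_eq: "?f = (\<lambda>\<omega>. u1\<^sup>2 * (fst (Y \<omega>) * fst (Y \<omega>) * exp (p \<bullet> Y \<omega>)) + 2 * u1 * u2 * (fst (Y \<omega>) * snd (Y \<omega>) * exp (p \<bullet> Y \<omega>))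
      + u2\<^sup>2 * (snd (Y \<omega>) * snd (Y \<omega>) * exp (p \<bullet> Y \<omega>)) - 2 * b * u1 * (fst (Y \<omega>) * exp (p \<bullet> Y \<omega>))
      - 2 * b * u2 * (snd (Y \<omega>) * exp (p \<bullet> Y \<omega>)) + b\<^sup>2 * exp (p \<bullet> Y \<omega>))"
    by (rule ext) (simp add: power2_eq_square algebra_simps)
  show "integrable M ?f" unfolding f_eq by (rule Bochner_Integration.integrable_add[OF J4 J(6)])
  have "integral\<^sup>L M ?f = u1\<^sup>2 * mom (\<lambda>y. fst y * fst y) p + 2 * u1 * u2 * mom (\<lambda>y. fst y * snd y) p
     + u2\<^sup>2 * mom (\<lambda>y. snd y * snd y) p - 2 * b * u1 * mom fst p - 2 * b * u2 * mom snd p + b\<^sup>2 * mgf p"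
    unfolding f_eq mom_def
    by (simp only: Bochner_Integration.integral_add[OF J4 J(6)] Bochner_Integration.integral_diff[OF J3 J(5)]
        Bochner_Integration.integral_diff[OF J2 J(4)] Bochner_Integration.integral_add[OF J1 J(3)]
        Bochner_Integration.integral_add[OF J(1,2)] integral_mult_right_zero mult_1)
  also have "\<dots> = mgf p * (u1\<^sup>2 * cv fst fst p + 2 * u1 * u2 * cv fst snd p + u2\<^sup>2 * cv snd snd p)"
    using pos by (simp add: cv_def b field_simps power2_eq_square)
  finally show "integral\<^sup>L M ?f = mgf p * (u1\<^sup>2 * cv fst fst p + 2 * u1 * u2 * cv fst snd p + u2\<^sup>2 * cv snd snd p)" .
qed

lemma tilted_variance_pos:
  assumes p: "p \<in> interior dom" and u: "(u1, u2) \<noteq> (0, 0)"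
  shows "u1\<^sup>2 * cv fst fst p + 2 * u1 * u2 * cv fst snd p + u2\<^sup>2 * cv snd snd p > 0"
proof -
  have pos: "mgf p > 0" using p interior_subset mgf_pos by blast
  define b where "b = u1 * (mom fst p / mgf p) + u2 * (mom snd p / mgf p)"
  define f where "f \<omega> = (u1 * fst (Y \<omega>) + u2 * snd (Y \<omega>) - b)\<^sup>2 * exp (p \<bullet> Y \<omega>)" for \<omega>
  note var = tilted_variance[OF p b_def, folded f_def]
  have "f \<omega> \<ge> 0" for \<omega> by (simp add: f_def)
  moreover have "\<not> (AE \<omega> in M. f \<omega> = 0)"
  proof
    assume "AE \<omega> in M. f \<omega> = 0"
    then have "AE \<omega> in M. (u1, u2) \<bullet> Y \<omega> = b"
      by eventually_elim (simp add: f_def inner_real_pair)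
    then show False using not_AE_inner_const[of "(u1, u2)"] u by (auto simp: zero_prod_def)
  qed
  ultimately have "integral\<^sup>L M f > 0" using integral_pos_if_not_AE_zero[of f] var(1) by blast
  then show ?thesis unfolding var(2) using pos by (simp add: zero_less_mult_iff)
qed

definition cvdet :: "real \<times> real \<Rightarrow> real" where
  "cvdet p = cv fst fst p * cv snd snd p - (cv fst snd p)\<^sup>2"

lemma cv_fst_fst_pos: "p \<in> interior dom \<Longrightarrow> cv fst fst p > 0"
  using tilted_variance_pos[of p 1 0] by simp

lemma cvdet_pos:
  assumes "p \<in> interior dom"
  shows "cvdet p > 0"
proof -
  have "0 < (- cv fst snd p)\<^sup>2 * cv fst fst p + 2 * (- cv fst snd p) * cv fst fst p * cv fst snd p + (cv fst fst p)\<^sup>2 * cv snd snd p"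
    using cv_fst_fst_pos[OF assms] by (intro tilted_variance_pos[OF assms]) auto
  also have "\<dots> = cv fst fst p * cvdet p" by (simp add: cvdet_def power2_eq_square algebra_simps)
  finally show ?thesis using cv_fst_fst_pos[OF assms] by (simp add: zero_less_mult_iff)
qed

end

section \<open>The deviation function and the constant \<open>C\<^sub>H\<close>\<close>

lemma partial1_eq:
  assumes "(f has_derivative D) (at p)"
  shows "partial1 f p = D (1, 0)"
proof -
  have "((\<lambda>s. (s, snd p)) has_derivative (\<lambda>s. (s, 0))) (at (fst p))"
    by (auto intro!: derivative_eq_intros)
  then have "((\<lambda>s. f (s, snd p)) has_derivative (\<lambda>s. D (s, 0))) (at (fst p))"
    using has_derivative_compose[of "\<lambda>s. (s, snd p)" "\<lambda>s. (s, 0)" "fst p" UNIV f D] assms by simp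
  moreover have "(\<lambda>s. D (s, 0)) = (*) (D (1, 0))"
  proof
    fix s show "D (s, 0) = D (1, 0) * s"
      using linear_scale[OF has_derivative_linear[OF assms], of s "(1, 0)"] by simp
  qed
  ultimately have "((\<lambda>s. f (s, snd p)) has_field_derivative D (1, 0)) (at (fst p))"
    unfolding has_field_derivative_def by simp
  then show ?thesis unfolding partial1_def by (rule DERIV_imp_deriv)
qed

lemma partial2_eq:
  assumes "(f has_derivative D) (at p)"
  shows "partial2 f p = D (0, 1)"
proof -
  have "((\<lambda>s. (fst p, s)) has_derivative (\<lambda>s. (0, s))) (at (snd p))"
    by (auto intro!: derivative_eq_intros)
  then have "((\<lambda>s. f (fst p, s)) has_derivative (\<lambda>s. D (0, s))) (at (snd p))"
    using has_derivative_compose[of "\<lambda>s. (fst p, s)" "\<lambda>s. (0, s)" "snd p" UNIV f D] assms by simp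
  moreover have "(\<lambda>s. D (0, s)) = (*) (D (0, 1))"
  proof
    fix s show "D (0, s) = D (0, 1) * s"
      using linear_scale[OF has_derivative_linear[OF assms], of s "(0, 1)"] by simp
  qed
  ultimately have "((\<lambda>s. f (fst p, s)) has_field_derivative D (0, 1)) (at (snd p))"
    unfolding has_field_derivative_def by simp
  then show ?thesis unfolding partial2_def by (rule DERIV_imp_deriv)
qed

context lattice_step
begin

lemma A2_gradient:
  assumes p: "p \<in> interior dom"
  shows "gradient (\<lambda>p. real_of_ereal (A2 M Y p)) p = mean p"
proof -
  have "((\<lambda>q. real_of_ereal (A2 M Y q)) has_derivative (\<lambda>h. h \<bullet> mean p)) (at p)"
    using interior_subset[of dom]
    by (intro has_derivative_transform_within_open[OF ln_mgf_has_derivative[OF p] open_interior p]) (auto simp: A2_eq_ln)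
  then show ?thesis
    unfolding gradient_def by (simp add: partial1_eq partial2_eq inner_real_pair)
qed

lemma Lambda_mean:
  assumes p: "p \<in> interior dom"
  shows "Lambda M Y (mean p) = ereal (p \<bullet> mean p - ln (mgf p))"
  unfolding Lambda_def
proof (rule antisym)
  have pd: "p \<in> dom" using p interior_subset by blast
  show "(SUP q. ereal (q \<bullet> mean p) - A2 M Y q) \<le> ereal (p \<bullet> mean p - ln (mgf p))"
  proof (rule SUP_least)
    fix q
    show "ereal (q \<bullet> mean p) - A2 M Y q \<le> ereal (p \<bullet> mean p - ln (mgf p))"
    proof (cases "q \<in> dom")
      case True
      then show ?thesis
        using ln_mgf_gradient_gap[OF p True] by (cases "q = p") (auto simp: A2_eq_ln inner_diff_left)
    qed (simp add: A2_infinite)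
  qed
  have "ereal (p \<bullet> mean p - ln (mgf p)) = ereal (p \<bullet> mean p) - A2 M Y p"
    by (simp add: A2_eq_ln[OF pd])
  also have "\<dots> \<le> (SUP q. ereal (q \<bullet> mean p) - A2 M Y q)" by (rule SUP_upper) simp
  finally show "ereal (p \<bullet> mean p - ln (mgf p)) \<le> (SUP q. ereal (q \<bullet> mean p) - A2 M Y q)" .
qed

lemma mean_inj: "inj_on mean (interior dom)"
proof (rule inj_onI, rule ccontr)
  fix p q assume p: "p \<in> interior dom" and q: "q \<in> interior dom" and eq: "mean p = mean q" and ne: "p \<noteq> q"
  have "p \<in> dom" "q \<in> dom" using p q interior_subset by blast+
  then show False
    using ln_mgf_gradient_gap[OF p \<open>q \<in> dom\<close>] ln_mgf_gradient_gap[OF q \<open>p \<in> dom\<close>] ne eq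
    by (simp add: inner_diff_left)
qed

definition mean_inv :: "real \<times> real \<Rightarrow> real \<times> real" where
  "mean_inv = inv_into (interior dom) mean"

lemma mean_inv_mean: "p \<in> interior dom \<Longrightarrow> mean_inv (mean p) = p"
  unfolding mean_inv_def using mean_inj by (rule inv_into_f_f)

definition dmean_inv :: "real \<times> real \<Rightarrow> real \<times> real \<Rightarrow> real \<times> real" where
  "dmean_inv p h = ((fst h * cv snd snd p - snd h * cv fst snd p) / cvdet p,
                    (snd h * cv fst fst p - fst h * cv fst snd p) / cvdet p)"

lemma mean_continuous: "continuous_on (interior dom) mean"
  using mean_has_derivative by (intro continuous_at_imp_continuous_on) (blast intro: has_derivative_continuous)

lemma mean_inv_has_derivative:
  assumes p: "p \<in> interior dom"
  shows "(mean_inv has_derivative dmean_inv p) (at (mean p))"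
proof (rule has_derivative_inverse_strong[OF open_interior p mean_continuous mean_inv_mean mean_has_derivative[OF p]])
  have "cvdet p \<noteq> 0" using cvdet_pos[OF p] by simp
  have "dmean p (dmean_inv p h) = h" for h
  proof -
    have "fst (dmean p (dmean_inv p h)) = fst h * cvdet p / cvdet p"
      by (simp add: dmean_def dmean_inv_def cvdet_def divide_simps power2_eq_square) (simp add: algebra_simps)
    moreover have "snd (dmean p (dmean_inv p h)) = snd h * cvdet p / cvdet p"
      by (simp add: dmean_def dmean_inv_def cvdet_def divide_simps power2_eq_square) (simp add: algebra_simps)
    ultimately show ?thesis using \<open>cvdet p \<noteq> 0\<close> by (simp add: prod_eq_iff)
  qed
  then show "dmean p \<circ> dmean_inv p = id" by auto
qed

lemma open_mean_image: "open (mean ` interior dom)"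
  using mean_continuous open_interior mean_inj by (rule invariance_of_domain)

lemma Lambda_has_derivative:
  assumes p: "p \<in> interior dom"
  shows "((\<lambda>v. real_of_ereal (Lambda M Y v)) has_derivative (\<lambda>h. p \<bullet> h)) (at (mean p))"
proof (rule has_derivative_transform_within_open[OF _ open_mean_image])
  note d = mean_inv_has_derivative[OF p]
  have "((\<lambda>v. ln (mgf (mean_inv v))) has_derivative (\<lambda>h. dmean_inv p h \<bullet> mean p)) (at (mean p))"
    using has_derivative_compose[OF d, of "\<lambda>q. ln (mgf q)"] ln_mgf_has_derivative[OF p]
    by (simp add: mean_inv_mean[OF p])
  then have "((\<lambda>v. mean_inv v \<bullet> v - ln (mgf (mean_inv v))) has_derivative
      (\<lambda>h. mean_inv (mean p) \<bullet> h + dmean_inv p h \<bullet> mean p - dmean_inv p h \<bullet> mean p)) (at (mean p))"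
    by (intro has_derivative_diff has_derivative_inner[OF d has_derivative_ident])
  then show "((\<lambda>v. mean_inv v \<bullet> v - ln (mgf (mean_inv v))) has_derivative (\<lambda>h. p \<bullet> h)) (at (mean p))"
    by (simp add: mean_inv_mean[OF p])
qed (use p in \<open>auto simp: Lambda_mean mean_inv_mean\<close>)

lemma Lambda_hessian:
  assumes p: "p \<in> interior dom"
  shows "hessian (\<lambda>v. real_of_ereal (Lambda M Y v)) (mean p) =
    vector [vector [cv snd snd p / cvdet p, - cv fst snd p / cvdet p],
            vector [- cv fst snd p / cvdet p, cv fst fst p / cvdet p]]"
proof -
  define L where "L = (\<lambda>v. real_of_ereal (Lambda M Y v))"
  note d = mean_inv_has_derivative[OF p]
  have mp: "mean p \<in> mean ` interior dom" using p by blast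
  have 1: "partial1 L v = fst (mean_inv v)" if "v \<in> mean ` interior dom" for v
    using that partial1_eq[OF Lambda_has_derivative] by (auto simp: L_def inner_real_pair mean_inv_mean)
  have 2: "partial2 L v = snd (mean_inv v)" if "v \<in> mean ` interior dom" for v
    using that partial2_eq[OF Lambda_has_derivative] by (auto simp: L_def inner_real_pair mean_inv_mean)
  have d1: "(partial1 L has_derivative (\<lambda>h. fst (dmean_inv p h))) (at (mean p))"
    using has_derivative_transform_within_open[OF has_derivative_fst[OF d] open_mean_image mp] 1 by simp
  have d2: "(partial2 L has_derivative (\<lambda>h. snd (dmean_inv p h))) (at (mean p))"
    using has_derivative_transform_within_open[OF has_derivative_snd[OF d] open_mean_image mp] 2 by simp
  show ?thesis
    unfolding hessian_def L_def[symmetric] partial1_eq[OF d1] partial2_eq[OF d1] partial1_eq[OF d2] partial2_eq[OF d2]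
    by (simp add: dmean_inv_def)
qed

text \<open>The tilted variance of \<open>m\<^sub>\<bottom> \<bullet> Y\<close> with \<open>m\<^sub>\<bottom> = (- m\<^sub>2, m\<^sub>1)\<close>, which is \<open>det \<Sigma>\<close> times \<open>m \<Sigma>\<^sup>-\<^sup>1 m\<^sup>T\<close>.\<close>

definition orth_var :: "real \<times> real \<Rightarrow> real" where
  "orth_var p = (fst (mean p))\<^sup>2 * cv snd snd p - 2 * fst (mean p) * snd (mean p) * cv fst snd p + (snd (mean p))\<^sup>2 * cv fst fst p"

lemma C_H_eq:
  assumes p: "p \<in> interior dom" and s: "saddle M Y v = p" and v: "v = r *\<^sub>R mean p" and r: "r > 0" and f: "fst (mean p) > 0"
  shows "C_H M Y v = 1 / sqrt (2 * pi * r * orth_var p)"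
proof -
  define L where "L = (vector [vector [cv snd snd p / cvdet p, - cv fst snd p / cvdet p],
            vector [- cv fst snd p / cvdet p, cv fst fst p / cvdet p]] :: real^2^2)"
  define w where "w = (vector [fst v, snd v] :: real^2)"
  have dp: "cvdet p > 0" by (rule cvdet_pos[OF p])
  have "det L = (cv snd snd p * cv fst fst p - (cv fst snd p)\<^sup>2) / (cvdet p)\<^sup>2"
    by (simp add: L_def det_2 power2_eq_square diff_divide_distrib)
  also have "\<dots> = 1 / cvdet p" using dp by (simp add: cvdet_def power2_eq_square mult.commute)
  finally have detL: "det L = 1 / cvdet p" .
  have "w \<bullet> (L *v w) = r\<^sup>2 * orth_var p / cvdet p"
    unfolding w_def L_def orth_var_def
    by (simp add: inner_vec_def sum_2 matrix_vector_mult_def v power2_eq_square add_divide_distrib diff_divide_distrib)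
       (simp add: algebra_simps add_divide_distrib diff_divide_distrib)
  moreover have "r = fst v / fst (mean p)" using v f by simp
  moreover have "C_H M Y v = sqrt (fst v / fst (mean p) / (2 * pi) * (det L / (w \<bullet> (L *v w))))"
    using s unfolding C_H_def by (cases v) (simp add: A2_gradient[OF p] Lambda_hessian[OF p] L_def w_def Let_def)
  ultimately have "C_H M Y v = sqrt (r / (2 * pi) * ((1 / cvdet p) / (r\<^sup>2 * orth_var p / cvdet p)))"
    by (simp add: detL)
  also have "r / (2 * pi) * ((1 / cvdet p) / (r\<^sup>2 * orth_var p / cvdet p)) = 1 / (2 * pi * r * orth_var p)"
    using dp r by (simp add: power2_eq_square)
  finally show ?thesis by (simp add: real_sqrt_divide)
qed

lemma orth_var_pos:
  assumes "p \<in> interior dom" "fst (mean p) > 0"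
  shows "orth_var p > 0"
  using tilted_variance_pos[OF assms(1), of "- snd (mean p)" "fst (mean p)"] assms(2)
  by (simp add: orth_var_def power2_eq_square algebra_simps)

end

section \<open>The level curve \<open>\<psi> = 1\<close> and the saddle point\<close>

context lattice_step
begin

lemma (in random_vector) A2_eq_infinity_iff: "A2 M Y p = \<infinity> \<longleftrightarrow> p \<notin> dom"
  using A2_less_infinity_iff[of p] by auto

lemma mgf_shift:
  assumes "(l, m) \<in> dom" "l' \<le> l"
  shows "(l', m) \<in> dom" "mgf (l', m) \<le> exp (l' - l) * mgf (l, m)"
proof -
  have i: "integrable M (\<lambda>\<omega>. exp ((l, m) \<bullet> Y \<omega>))" using assms(1) by (simp add: dom_iff)
  have i2: "integrable M (\<lambda>\<omega>. exp (l' - l) * exp ((l, m) \<bullet> Y \<omega>))" using i by (rule integrable_mult_right)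
  have ae: "AE \<omega> in M. exp ((l', m) \<bullet> Y \<omega>) \<le> exp (l' - l) * exp ((l, m) \<bullet> Y \<omega>)"
    using AE_fst_ge_1
  proof eventually_elim
    case (elim \<omega>)
    have "(l' - l) * fst (Y \<omega>) \<le> (l' - l) * 1" using elim assms(2) by (intro mult_left_mono_neg) auto
    then show ?case by (simp add: mult_exp_exp inner_real_pair algebra_simps)
  qed
  show "(l', m) \<in> dom"
    unfolding dom_iff by (rule Bochner_Integration.integrable_bound[OF i2]) (use ae in auto)
  then have "mgf (l', m) \<le> (\<integral>\<omega>. exp (l' - l) * exp ((l, m) \<bullet> Y \<omega>) \<partial>M)"
    unfolding mom_def dom_iff using ae i2 by (intro integral_mono_AE) auto
  then show "mgf (l', m) \<le> exp (l' - l) * mgf (l, m)" by (simp add: mom_def)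
qed

lemma mgf_gt_1_beyond:
  assumes "(l, m) \<in> dom" "l' < l" "mgf (l', m) \<ge> 1"
  shows "mgf (l, m) > 1"
proof -
  have "1 \<le> exp (l' - l) * mgf (l, m)" using mgf_shift(2)[OF assms(1), of l'] assms by simp
  also have "\<dots> < 1 * mgf (l, m)" using assms(2) mgf_pos[OF assms(1)] by (intro mult_strict_right_mono) auto
  finally show ?thesis by simp
qed

lemma (in random_vector) dom_convex: "convex dom"
proof (rule convexI)
  fix p q :: "real \<times> real" and u v :: real
  assume p: "p \<in> dom" and q: "q \<in> dom" and uv: "0 \<le> u" "0 \<le> v" "u + v = 1"
  have i: "integrable M (\<lambda>\<omega>. exp (p \<bullet> Y \<omega>) + exp (q \<bullet> Y \<omega>))"
    using p q by (auto simp: dom_iff)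
  have "exp ((u *\<^sub>R p + v *\<^sub>R q) \<bullet> y) \<le> exp (p \<bullet> y) + exp (q \<bullet> y)" for y
  proof -
    have "(u *\<^sub>R p + v *\<^sub>R q) \<bullet> y = u * (p \<bullet> y) + v * (q \<bullet> y)" by (simp add: inner_add_left)
    also have "\<dots> \<le> max (p \<bullet> y) (q \<bullet> y)" using uv by (intro convex_bound_le) auto
    finally have "exp ((u *\<^sub>R p + v *\<^sub>R q) \<bullet> y) \<le> exp (max (p \<bullet> y) (q \<bullet> y))" by simp
    also have "\<dots> \<le> exp (p \<bullet> y) + exp (q \<bullet> y)" by (auto simp: max_def)
    finally show ?thesis .
  qed
  then show "u *\<^sub>R p + v *\<^sub>R q \<in> dom"
    unfolding dom_iff by (intro Bochner_Integration.integrable_bound[OF i]) (auto intro: order_trans[OF _ abs_ge_self])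
qed

lemma mu_between:
  assumes "mu_lower M Y < ereal m" "ereal m < mu_upper M Y"
  obtains m1 l1 m2 l2 where "m1 < m" "m < m2" "(l1, m1) \<in> dom" "(l2, m2) \<in> dom"
  using assms unfolding mu_lower_def mu_upper_def Inf_less_iff less_Sup_iff A_section_def by auto

lemma dom_interpolate:
  assumes "(l1, m1) \<in> dom" "(l2, m2) \<in> dom" "m1 < m2" "m1 \<le> m" "m \<le> m2"
  shows "(l1 + (m - m1) / (m2 - m1) * (l2 - l1), m) \<in> dom"
proof -
  define t where "t = (m - m1) / (m2 - m1)"
  have t: "0 \<le> t" "t \<le> 1" using assms by (auto simp: t_def divide_simps)
  have "(1 - t) *\<^sub>R (l1, m1) + t *\<^sub>R (l2, m2) \<in> dom"
    using convexD_alt[OF dom_convex assms(1,2) t] .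
  moreover have "(1 - t) * m1 + t * m2 = m"
  proof -
    have "t * (m2 - m1) = m - m1" using assms by (simp add: t_def)
    then show ?thesis by (simp add: algebra_simps)
  qed
  moreover have "(1 - t) * l1 + t * l2 = l1 + (m - m1) / (m2 - m1) * (l2 - l1)"
    unfolding t_def[symmetric] by (simp add: algebra_simps)
  ultimately show ?thesis by simp
qed

lemma below_dom_interior:
  assumes "mu_lower M Y < ereal m" "ereal m < mu_upper M Y" "(l0, m) \<in> dom" "l < l0"
  shows "(l, m) \<in> interior dom"
proof -
  obtain m1 l1 m2 l2 where b: "m1 < m" "m < m2" "(l1, m1) \<in> dom" "(l2, m2) \<in> dom"
    using mu_between[OF assms(1,2)] .
  define h1 where "h1 k = l1 + (k - m1) / (m - m1) * (l0 - l1)" for k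
  define h2 where "h2 k = l0 + (k - m) / (m2 - m) * (l2 - l0)" for k
  define U where "U = {p. fst p < h1 (snd p)} \<inter> {p. fst p < h2 (snd p)} \<inter> {p. m1 < snd p} \<inter> {p::real\<times>real. snd p < m2}"
  show ?thesis
  proof (rule interiorI)
    show "open U" unfolding U_def h1_def h2_def
      using b by (intro open_Int open_Collect_less continuous_intros) auto
    show "(l, m) \<in> U" using assms b by (simp add: U_def h1_def h2_def)
    show "U \<subseteq> dom"
    proof
      fix p assume p: "p \<in> U"
      show "p \<in> dom"
      proof (cases "snd p \<le> m")
        case True
        then have "(h1 (snd p), snd p) \<in> dom"
          unfolding h1_def using p b by (intro dom_interpolate assms) (auto simp: U_def)
        then show ?thesis using mgf_shift(1)[of _ "snd p" "fst p"] p by (auto simp: U_def)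
      next
        case False
        then have "(h2 (snd p), snd p) \<in> dom"
          unfolding h2_def using p b by (intro dom_interpolate assms) (auto simp: U_def)
        then show ?thesis using mgf_shift(1)[of _ "snd p" "fst p"] p by (auto simp: U_def)
      qed
    qed
  qed
qed

lemma A1_inner_eq:
  assumes "(l, m) \<in> dom" "mgf (l, m) = 1"
  shows "A1_inner M Y m = ereal (- l)"
proof -
  have "Sup (ereal ` {l. A2 M Y (l, m) \<le> 0}) = ereal l"
  proof (rule antisym)
    show "Sup (ereal ` {l. A2 M Y (l, m) \<le> 0}) \<le> ereal l"
      using mgf_gt_1_beyond[of _ m l] assms
      by (intro Sup_least) (force simp: A2_le_0_iff not_le[symmetric])
    show "ereal l \<le> Sup (ereal ` {l. A2 M Y (l, m) \<le> 0})"
      using assms by (intro Sup_upper) (auto simp: A2_le_0_iff)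
  qed
  then show ?thesis by (simp add: A1_inner_def)
qed

lemma A1_root:
  assumes m: "mu_lower M Y < ereal m" "ereal m < mu_upper M Y" and less: "A1_infty M Y m < A1 M Y m"
  obtains l where "(l, m) \<in> interior dom" "mgf (l, m) = 1" "A1 M Y m = ereal (- l)"
proof -
  define S where "S = Sup (ereal ` {l. A2 M Y (l, m) \<le> 0})"
  have "S < Sup (ereal ` {l. A2 M Y (l, m) < \<infinity>})"
    using less m by (simp add: A1_def A1_inner_def A1_infty_def S_def)
  then obtain l0 where l0: "(l0, m) \<in> dom" "S < ereal l0"
    unfolding less_Sup_iff by (auto simp: A2_eq_infinity_iff)
  obtain l0' where l0': "S < ereal l0'" "l0' < l0"
    using ereal_dense2[OF l0(2)] by auto
  have S_upper: "ereal l \<le> S" if "(l, m) \<in> dom" "mgf (l, m) \<le> 1" for l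
    unfolding S_def using that by (intro Sup_upper) (auto simp: A2_le_0_iff)
  define l1 where "l1 = l0 - \<bar>ln (mgf (l0, m))\<bar>"
  have l1: "(l1, m) \<in> dom" "mgf (l1, m) \<le> 1"
  proof -
    show "(l1, m) \<in> dom" using mgf_shift(1)[OF l0(1), of l1] by (simp add: l1_def)
    have "mgf (l1, m) \<le> exp (l1 - l0) * mgf (l0, m)" using mgf_shift(2)[OF l0(1), of l1] by (simp add: l1_def)
    also have "\<dots> = exp (l1 - l0 + ln (mgf (l0, m)))" using mgf_pos[OF l0(1)] by (simp add: exp_add)
    also have "\<dots> \<le> 1" by (simp add: l1_def)
    finally show "mgf (l1, m) \<le> 1" .
  qed
  have "ereal l1 < ereal l0'" using S_upper[OF l1] l0'(1) by (rule order_le_less_trans)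
  then have "l1 < l0'" by simp
  have int: "(l, m) \<in> interior dom" if "l \<le> l0'" for l
    using below_dom_interior[OF m l0(1), of l] that l0'(2) by simp
  have "(l0', m) \<in> dom" using int interior_subset by blast
  then have "mgf (l0', m) > 1" using S_upper[of l0'] l0'(1) by force
  have cont: "isCont (\<lambda>l. mgf (l, m)) l" if "l \<le> l0'" for l
    by (rule isCont_o2[of l "\<lambda>l. (l, m)" mgf]) (auto intro!: continuous_intros mom_isCont int that)
  obtain l where l: "l1 \<le> l" "l \<le> l0'" "mgf (l, m) = 1"
    using IVT[of "\<lambda>l. mgf (l, m)" l1 1 l0'] cont \<open>l1 < l0'\<close> l1(2) \<open>mgf (l0', m) > 1\<close> by auto
  have "A1 M Y m = ereal (- l)"
    using m A1_inner_eq[of l m] int[OF l(2)] l(3) interior_subset by (auto simp: A1_def)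
  then show ?thesis using that int l by blast
qed

definition J :: "real set" where "J = mu_interval M Y"

lemma J_open: "open J"
  unfolding J_def mu_interval_def by auto

lemma J_interval: "is_interval J"
  unfolding J_def mu_interval_def is_interval_connected_1
  by (rule connected_Union) (auto simp: is_interval_connected_1)

lemma J_mu: "m \<in> J \<Longrightarrow> mu_lower M Y < ereal m \<and> ereal m < mu_upper M Y \<and> A1_infty M Y m < A1 M Y m"
  unfolding J_def mu_interval_def by auto

lemma zero_in_J: "0 \<in> J"
proof -
  obtain d where d: "d > 0" "ball 0 d \<subseteq> dom" using zero_interior by (meson mem_interior)
  define e where "e = d / 4"
  have e: "e > 0" using d by (simp add: e_def)
  have dom4: "(a, b) \<in> dom" if "\<bar>a\<bar> \<le> 2 * e" "\<bar>b\<bar> \<le> e" for a b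
  proof -
    have "norm (a, b) \<le> \<bar>a\<bar> + \<bar>b\<bar>" using norm_Pair_le[of a b] by simp
    also have "\<dots> < d" using that e by (simp add: e_def)
    finally show ?thesis using d by (auto simp: subset_iff)
  qed
  have "(0, 0) \<in> dom" using dom4[of 0 0] e by simp
  have "(e, 0) \<in> interior dom"
  proof (rule interiorI)
    show "(e, 0) \<in> ball 0 d" using d by (simp add: dist_Pair_Pair zero_prod_def dist_norm e_def)
  qed (use d in auto)
  then have "isCont (\<lambda>m. mgf (e, m)) 0"
    by (intro isCont_o2[of 0 "\<lambda>m. (e, m)" mgf]) (auto intro!: continuous_intros mom_isCont)
  moreover have "mgf (e, 0) > 1"
    using mgf_gt_1_beyond[of e 0 0] dom4[of e 0] e by (simp add: mom_def prob_space flip: zero_prod_def)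
  ultimately have "\<forall>\<^sub>F m in at 0. mgf (e, m) > 1"
    unfolding isCont_def by (rule order_tendstoD)
  then obtain \<eta> where \<eta>: "\<eta> > 0" "\<And>m. m \<noteq> 0 \<Longrightarrow> \<bar>m\<bar> < \<eta> \<Longrightarrow> mgf (e, m) > 1"
    unfolding eventually_at by (auto simp: dist_real_def)
  then have gt: "mgf (e, m) > 1" if "\<bar>m\<bar> < \<eta>" for m
    using that \<open>mgf (e, 0) > 1\<close> by (cases "m = 0") auto
  define \<kappa> where "\<kappa> = min \<eta> e"
  have \<kappa>: "\<kappa> > 0" using \<eta> e by (simp add: \<kappa>_def)
  have lo: "mu_lower M Y \<le> ereal (- \<kappa>)"
    unfolding mu_lower_def A_section_def using dom4[of 0 "- \<kappa>"] e \<kappa>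
    by (intro Inf_lower imageI) (auto simp: \<kappa>_def)
  have up: "ereal \<kappa> \<le> mu_upper M Y"
    unfolding mu_upper_def A_section_def using dom4[of 0 "\<kappa>"] e \<kappa>
    by (intro Sup_upper imageI) (auto simp: \<kappa>_def)
  have "{- \<kappa><..<\<kappa>} \<subseteq> J"
  proof -
    have "mu_lower M Y < ereal m \<and> ereal m < mu_upper M Y \<and> A1_infty M Y m < A1 M Y m"
      if m: "m \<in> {- \<kappa><..<\<kappa>}" for m
    proof -
      have mm: "mu_lower M Y < ereal m" "ereal m < mu_upper M Y"
        using m order_le_less_trans[OF lo, of "ereal m"] order_less_le_trans[OF _ up, of "ereal m"] by auto
      have "\<bar>m\<bar> < \<eta>" "\<bar>m\<bar> \<le> e" using m by (auto simp: \<kappa>_def)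
      have "Sup (ereal ` {l. A2 M Y (l, m) \<le> 0}) \<le> ereal e"
        using mgf_gt_1_beyond[of _ m e] gt[OF \<open>\<bar>m\<bar> < \<eta>\<close>]
        by (intro Sup_least) (force simp: A2_le_0_iff not_le[symmetric])
      also have "\<dots> < ereal (2 * e)" using e by simp
      also have "\<dots> \<le> Sup (ereal ` {l. A2 M Y (l, m) < \<infinity>})"
        using dom4[of "2 * e" m] e \<open>\<bar>m\<bar> \<le> e\<close> by (intro Sup_upper) (auto simp: A2_eq_infinity_iff)
      finally show ?thesis using mm by (simp add: A1_def A1_inner_def A1_infty_def)
    qed
    then show ?thesis
      unfolding J_def mu_interval_def using \<kappa>
      by (intro Union_upper) (auto simp: is_interval_1)
  qed
  then show ?thesis using \<kappa> by auto
qed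

definition lam :: "real \<Rightarrow> real" where
  "lam m = - real_of_ereal (A1 M Y m)"

lemma lam_root:
  assumes "m \<in> J"
  shows "(lam m, m) \<in> interior dom" "mgf (lam m, m) = 1"
proof -
  have J: "mu_lower M Y < ereal m" "ereal m < mu_upper M Y" "A1_infty M Y m < A1 M Y m"
    using J_mu[OF assms] by auto
  obtain l where l: "(l, m) \<in> interior dom" "mgf (l, m) = 1" "A1 M Y m = ereal (- l)"
    using A1_root[OF J] .
  then have "lam m = l" by (simp add: lam_def)
  then show "(lam m, m) \<in> interior dom" "mgf (lam m, m) = 1" using l by auto
qed

definition slope :: "real \<Rightarrow> real" where
  "slope m = mom snd (lam m, m) / mom fst (lam m, m)"

lemma mom_fst_ge_mgf:
  assumes "p \<in> interior dom"
  shows "mom fst p \<ge> mgf p"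
  unfolding mom_def
proof (rule integral_mono_AE)
  show "integrable M (\<lambda>\<omega>. 1 * exp (p \<bullet> Y \<omega>))" "integrable M (\<lambda>\<omega>. fst (Y \<omega>) * exp (p \<bullet> Y \<omega>))"
    using mom_integrable[OF assms, of "\<lambda>_. 1"] mom_integrable[OF assms, of fst] by auto
  show "AE \<omega> in M. 1 * exp (p \<bullet> Y \<omega>) \<le> fst (Y \<omega>) * exp (p \<bullet> Y \<omega>)"
    using AE_fst_ge_1 by eventually_elim (simp add: mult_right_mono)
qed

lemma mean_fst_ge_1:
  assumes "p \<in> interior dom"
  shows "fst (mean p) \<ge> 1"
proof -
  have "mgf p > 0" using assms interior_subset mgf_pos by blast
  then show ?thesis using mom_fst_ge_mgf[OF assms] by (simp add: mean_def)
qed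

lemma mom_fst_lam_pos: "m \<in> J \<Longrightarrow> mom fst (lam m, m) > 0"
  using mom_fst_ge_mgf[OF lam_root(1)] lam_root(2) by force

text \<open>The gradient inequality for \<open>\<psi>\<close> between two points of the curve \<open>\<psi> = 1\<close>: it makes \<open>slope\<close> a strict
  subgradient of \<open>A(\<mu>)\<close>, which yields convexity, continuity and the derivative without implicit functions.\<close>

lemma lam_gap:
  assumes m: "m \<in> J" and k: "k \<in> J" and "k \<noteq> m"
  shows "lam k < lam m - slope m * (k - m)"
proof -
  have "(lam k, k) \<in> dom" using lam_root(1)[OF k] interior_subset by blast
  then have "mgf (lam m, m) + ((lam k, k) - (lam m, m)) \<bullet> grad (lam m, m) < mgf (lam k, k)"
    using assms(3) by (intro mgf_gradient_gap lam_root(1)[OF m]) auto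
  then have "(lam k - lam m) * mom fst (lam m, m) + (k - m) * mom snd (lam m, m) < 0"
    by (simp add: lam_root m k grad_def inner_real_pair)
  then show ?thesis
    using mom_fst_lam_pos[OF m] by (simp add: slope_def field_simps)
qed

lemma slope_strict_mono:
  assumes m: "m \<in> J" and k: "k \<in> J" and "m < k"
  shows "slope m < slope k"
proof -
  have "slope m * (k - m) < slope k * (k - m)"
    using lam_gap[OF m k] lam_gap[OF k m] assms(3) by (simp add: algebra_simps)
  then show ?thesis using assms(3) by simp
qed

lemma lam_continuous: "continuous_on J lam"
proof -
  have "convex_on J (\<lambda>m. - lam m)"
  proof (rule convex_onI)
    fix t x y :: real assume t: "0 < t" "t < 1" and xy: "x \<in> J" "y \<in> J"
    define z where "z = (1 - t) *\<^sub>R x + t *\<^sub>R y"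
    have "convex J" using J_interval by (simp add: is_interval_convex_1)
    then have z: "z \<in> J" unfolding z_def using convexD_alt[of J x y t] xy t by auto
    have 1: "lam x \<le> lam z - slope z * (x - z)" using lam_gap[OF z xy(1)] by (cases "x = z") auto
    have 2: "lam y \<le> lam z - slope z * (y - z)" using lam_gap[OF z xy(2)] by (cases "y = z") auto
    have "(1 - t) * lam x + t * lam y \<le> (1 - t) * (lam z - slope z * (x - z)) + t * (lam z - slope z * (y - z))"
      using 1 2 t by (intro add_mono mult_left_mono) auto
    also have "\<dots> = lam z - slope z * ((1 - t) * x + t * y - z)" by (simp add: algebra_simps)
    also have "\<dots> = lam z" by (simp add: z_def)
    finally show "- lam ((1 - t) *\<^sub>R x + t *\<^sub>R y) \<le> (1 - t) * - lam x + t * - lam y"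
      unfolding z_def[symmetric] by simp
  qed (use J_interval in \<open>simp add: is_interval_convex_1\<close>)
  then have "continuous_on J (\<lambda>m. - lam m)" using J_open by (intro convex_on_continuous)
  then have "continuous_on J (\<lambda>m. - (- lam m))" by (rule continuous_on_minus)
  then show ?thesis by simp
qed

lemma lam_pair_continuous: "m \<in> J \<Longrightarrow> isCont (\<lambda>m. (lam m, m)) m"
  using lam_continuous J_open by (intro continuous_Pair continuous_ident) (simp add: continuous_on_eq_continuous_at)

lemma slope_continuous:
  assumes "m \<in> J"
  shows "isCont slope m"
  unfolding slope_def[abs_def] using mom_fst_lam_pos[OF assms]
  by (intro continuous_divide isCont_o2[OF lam_pair_continuous[OF assms]] mom_isCont lam_root(1) assms) auto

lemma A1_deriv_eq_slope:
  assumes m: "m \<in> J"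
  shows "A1_deriv M Y m = slope m"
proof -
  have "((\<lambda>k. (lam k - lam m) / (k - m) + slope m) \<longlongrightarrow> 0) (at m)"
  proof (rule Lim_null_comparison)
    have "\<forall>\<^sub>F k in at m. k \<in> J \<and> k \<noteq> m"
      using J_open m by (intro eventually_conj eventually_at_in_open') (auto simp: eventually_at_filter)
    then show "\<forall>\<^sub>F k in at m. norm ((lam k - lam m) / (k - m) + slope m) \<le> \<bar>slope k - slope m\<bar>"
    proof eventually_elim
      case (elim k)
      have "lam k < lam m - slope m * (k - m)" "lam m < lam k - slope k * (m - k)"
        using lam_gap[of m k] lam_gap[of k m] elim m by auto
      then show ?case
        using elim slope_strict_mono[of m k] slope_strict_mono[of k m] m
        by (cases "k > m") (auto simp: abs_if field_simps)
    qed
    have "((\<lambda>k. \<bar>slope k - slope m\<bar>) \<longlongrightarrow> \<bar>slope m - slope m\<bar>) (at m)"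
      using slope_continuous[OF m] unfolding isCont_def by (intro tendsto_intros)
    then show "((\<lambda>k. \<bar>slope k - slope m\<bar>) \<longlongrightarrow> 0) (at m)" by simp
  qed
  then have "((\<lambda>k. slope m - ((lam k - lam m) / (k - m) + slope m)) \<longlongrightarrow> slope m - 0) (at m)"
    by (intro tendsto_intros)
  moreover have "slope m - ((lam k - lam m) / (k - m) + slope m)
      = (real_of_ereal (A1 M Y k) - real_of_ereal (A1 M Y m)) / (k - m)" for k
    by (simp add: lam_def minus_divide_left[symmetric] diff_divide_distrib)
  ultimately have "((\<lambda>s. real_of_ereal (A1 M Y s)) has_field_derivative slope m) (at m)"
    unfolding has_field_derivative_iff by simp
  then show ?thesis unfolding A1_deriv_def by (rule DERIV_imp_deriv)
qed

lemma J_iff: "m \<in> J \<longleftrightarrow> mu_minus M Y < ereal m \<and> ereal m < mu_plus M Y"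
proof
  assume m: "m \<in> J"
  obtain e where e: "e > 0" "ball m e \<subseteq> J" using J_open m by (meson open_contains_ball)
  have "m - e / 2 \<in> J" "m + e / 2 \<in> J" using e by (auto simp: subset_iff dist_real_def)
  then have "mu_minus M Y \<le> ereal (m - e / 2)" "ereal (m + e / 2) \<le> mu_plus M Y"
    unfolding mu_minus_def mu_plus_def J_def[symmetric] by (auto intro: Inf_lower Sup_upper)
  then show "mu_minus M Y < ereal m \<and> ereal m < mu_plus M Y"
    using e order_le_less_trans[of "mu_minus M Y" "ereal (m - e / 2)" "ereal m"]
      order_less_le_trans[of "ereal m" "ereal (m + e / 2)" "mu_plus M Y"] by auto
next
  assume "mu_minus M Y < ereal m \<and> ereal m < mu_plus M Y"
  then obtain a b where "a \<in> J" "b \<in> J" "a < m" "m < b"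
    unfolding mu_minus_def mu_plus_def J_def[symmetric] Inf_less_iff less_Sup_iff by auto
  then show "m \<in> J" using J_interval unfolding is_interval_1 by (meson less_imp_le)
qed

lemma alpha_minus_eq: "alpha_minus M Y = (INF m\<in>J. ereal (slope m))"
proof -
  have lt: "mu_minus M Y < 0" "0 < mu_plus M Y" using zero_in_J J_iff[of 0] by (auto simp: zero_ereal_def)
  have ev: "\<forall>\<^sub>F m in at_right (mu_minus M Y). mu_minus M Y < m \<and> m < ereal k" if "k \<in> J" for k
    using that eventually_at_right[of "mu_minus M Y" "ereal k"] J_iff[of k] by auto
  have inJ: "real_of_ereal x \<in> J \<and> real_of_ereal x < k" if "k \<in> J" "mu_minus M Y < x \<and> x < ereal k" for x k
    using that J_iff[of k] J_iff[of "real_of_ereal x"] order.strict_trans[of x "ereal k" "mu_plus M Y"] by (cases x) auto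
  have "((\<lambda>m. ereal (A1_deriv M Y (real_of_ereal m))) \<longlongrightarrow> (INF m\<in>J. ereal (slope m))) (at_right (mu_minus M Y))"
  proof (rule order_tendstoI)
    fix a assume a: "a < (INF m\<in>J. ereal (slope m))"
    show "\<forall>\<^sub>F x in at_right (mu_minus M Y). a < ereal (A1_deriv M Y (real_of_ereal x))"
      using ev[OF zero_in_J]
    proof eventually_elim
      case (elim x)
      then have "real_of_ereal x \<in> J" using inJ[OF zero_in_J] by blast
      then show ?case using a less_INF_D[OF a] by (simp add: A1_deriv_eq_slope)
    qed
  next
    fix a assume "a > (INF m\<in>J. ereal (slope m))"
    then obtain k where k: "k \<in> J" "ereal (slope k) < a" unfolding INF_less_iff by blast
    show "\<forall>\<^sub>F x in at_right (mu_minus M Y). ereal (A1_deriv M Y (real_of_ereal x)) < a"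
      using ev[OF k(1)]
    proof eventually_elim
      case (elim x)
      then have x: "real_of_ereal x \<in> J" "real_of_ereal x < k" using inJ[OF k(1)] by blast+
      have "ereal (slope (real_of_ereal x)) < ereal (slope k)" using slope_strict_mono[OF x(1) k(1) x(2)] by simp
      also have "\<dots> < a" by (rule k)
      finally show ?case using x by (simp add: A1_deriv_eq_slope)
    qed
  qed
  moreover have "\<not> trivial_limit (at_right (mu_minus M Y))"
    unfolding trivial_limit_def eventually_at_right[OF lt(1)] using dense by blast
  ultimately show ?thesis unfolding alpha_minus_def by (intro tendsto_Lim)
qed

lemma alpha_plus_eq: "alpha_plus M Y = (SUP m\<in>J. ereal (slope m))"
proof -
  have lt: "mu_minus M Y < 0" "0 < mu_plus M Y" using zero_in_J J_iff[of 0] by (auto simp: zero_ereal_def)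
  have ev: "\<forall>\<^sub>F m in at_left (mu_plus M Y). ereal k < m \<and> m < mu_plus M Y" if "k \<in> J" for k
    using that eventually_at_left[of "ereal k" "mu_plus M Y"] J_iff[of k] by auto
  have inJ: "real_of_ereal x \<in> J \<and> k < real_of_ereal x" if "k \<in> J" "ereal k < x \<and> x < mu_plus M Y" for x k
    using that J_iff[of k] J_iff[of "real_of_ereal x"] order.strict_trans[of "mu_minus M Y" "ereal k" x] by (cases x) auto
  have "((\<lambda>m. ereal (A1_deriv M Y (real_of_ereal m))) \<longlongrightarrow> (SUP m\<in>J. ereal (slope m))) (at_left (mu_plus M Y))"
  proof (rule order_tendstoI)
    fix a assume "a < (SUP m\<in>J. ereal (slope m))"
    then obtain k where k: "k \<in> J" "a < ereal (slope k)" unfolding less_SUP_iff by blast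
    show "\<forall>\<^sub>F x in at_left (mu_plus M Y). a < ereal (A1_deriv M Y (real_of_ereal x))"
      using ev[OF k(1)]
    proof eventually_elim
      case (elim x)
      then have x: "real_of_ereal x \<in> J" "k < real_of_ereal x" using inJ[OF k(1)] by blast+
      have "a < ereal (slope k)" by (rule k)
      also have "ereal (slope k) < ereal (slope (real_of_ereal x))" using slope_strict_mono[OF k(1) x] by simp
      finally show ?case using x by (simp add: A1_deriv_eq_slope)
    qed
  next
    fix a assume a: "a > (SUP m\<in>J. ereal (slope m))"
    show "\<forall>\<^sub>F x in at_left (mu_plus M Y). ereal (A1_deriv M Y (real_of_ereal x)) < a"
      using ev[OF zero_in_J]
    proof eventually_elim
      case (elim x)
      then have "real_of_ereal x \<in> J" using inJ[OF zero_in_J] by blast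
      then show ?case using SUP_lessD[OF a] by (simp add: A1_deriv_eq_slope)
    qed
  qed
  moreover have "\<not> trivial_limit (at_left (mu_plus M Y))"
    unfolding trivial_limit_def eventually_at_left[OF lt(2)] using dense by blast
  ultimately show ?thesis unfolding alpha_plus_def by (intro tendsto_Lim)
qed

abbreviation "mu_at \<equiv> mu_of M Y"

lemma mu_of_slope:
  assumes "m \<in> J"
  shows "mu_at (slope m) = m"
  unfolding mu_of_def
proof (rule the_equality)
  show "mu_minus M Y < ereal m \<and> ereal m < mu_plus M Y \<and> A1_deriv M Y m = slope m"
    using assms A1_deriv_eq_slope J_iff by auto
  fix k assume "mu_minus M Y < ereal k \<and> ereal k < mu_plus M Y \<and> A1_deriv M Y k = slope m"
  then have k: "k \<in> J" "slope k = slope m" using J_iff[of k] A1_deriv_eq_slope[of k] by auto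
  then show "k = m"
    using slope_strict_mono[of k m] slope_strict_mono[of m k] assms by (cases k m rule: linorder_cases) auto
qed

lemma mu_of_props:
  assumes "alpha_minus M Y < ereal \<beta>" "ereal \<beta> < alpha_plus M Y"
  shows "mu_at \<beta> \<in> J" "slope (mu_at \<beta>) = \<beta>"
proof -
  obtain m1 where m1: "m1 \<in> J" "slope m1 < \<beta>"
    using assms(1) unfolding alpha_minus_eq INF_less_iff by auto
  obtain m2 where m2: "m2 \<in> J" "\<beta> < slope m2"
    using assms(2) unfolding alpha_plus_eq less_SUP_iff by auto
  have "m1 < m2"
    using slope_strict_mono[of m2 m1] m1 m2 by (cases m1 m2 rule: linorder_cases) auto
  have sub: "m \<in> J" if "m1 \<le> m" "m \<le> m2" for m
    using J_interval m1 m2 that unfolding is_interval_1 by blast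
  obtain m where m: "m1 \<le> m" "m \<le> m2" "slope m = \<beta>"
    using IVT[of slope m1 \<beta> m2] slope_continuous sub \<open>m1 < m2\<close> m1 m2 by auto
  then show "mu_at \<beta> \<in> J" "slope (mu_at \<beta>) = \<beta>" using mu_of_slope[of m] sub by auto
qed

lemma mu_of_continuous:
  "continuous_on {\<beta>. alpha_minus M Y < ereal \<beta> \<and> ereal \<beta> < alpha_plus M Y} mu_at"
  unfolding continuous_on_def
proof (rule ballI, rule order_tendstoI)
  let ?B = "{\<beta>. alpha_minus M Y < ereal \<beta> \<and> ereal \<beta> < alpha_plus M Y}"
  fix \<beta> a assume \<beta>: "\<beta> \<in> ?B"
  have mb: "mu_at \<beta> \<in> J" "slope (mu_at \<beta>) = \<beta>" using mu_of_props \<beta> by auto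
  obtain e where e: "e > 0" "ball (mu_at \<beta>) e \<subseteq> J" using J_open mb by (meson open_contains_ball)
  have inB: "\<forall>\<^sub>F y in at \<beta> within ?B. y \<in> ?B" by (auto simp: eventually_at_filter)
  show "\<forall>\<^sub>F y in at \<beta> within ?B. a < mu_at y" if a: "a < mu_at \<beta>"
  proof -
    define c where "c = max a (mu_at \<beta> - e / 2)"
    have c: "c \<in> J" "a \<le> c" "c < mu_at \<beta>"
      using e a by (auto simp: c_def max_def subset_iff dist_real_def)
    have "slope c < \<beta>" using slope_strict_mono[OF c(1) mb(1) c(3)] mb by simp
    then have "\<forall>\<^sub>F y in at \<beta> within ?B. slope c < y"
      using order_tendstoD(1)[OF tendsto_ident_at] by blast
    then show ?thesis using inB
    proof eventually_elim
      case (elim y)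
      then have y: "mu_at y \<in> J" "slope (mu_at y) = y" using mu_of_props by auto
      have "\<not> mu_at y \<le> c" using slope_strict_mono[OF y(1) c(1)] elim(1) y by (auto simp: le_less)
      then show ?case using c by simp
    qed
  qed
  show "\<forall>\<^sub>F y in at \<beta> within ?B. mu_at y < a" if a: "mu_at \<beta> < a"
  proof -
    define c where "c = min a (mu_at \<beta> + e / 2)"
    have c: "c \<in> J" "c \<le> a" "mu_at \<beta> < c"
      using e a by (auto simp: c_def min_def subset_iff dist_real_def)
    have "\<beta> < slope c" using slope_strict_mono[OF mb(1) c(1) c(3)] mb by simp
    then have "\<forall>\<^sub>F y in at \<beta> within ?B. y < slope c"
      using order_tendstoD(2)[OF tendsto_ident_at] by blast
    then show ?thesis using inB
    proof eventually_elim
      case (elim y)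
      then have y: "mu_at y \<in> J" "slope (mu_at y) = y" using mu_of_props by auto
      have "\<not> c \<le> mu_at y" using slope_strict_mono[OF c(1) y(1)] elim(1) y by (auto simp: le_less)
      then show ?case using c by simp
    qed
  qed
qed

lemma saddle_eq: "saddle M Y v = (lam (mu_at (snd v / fst v)), mu_at (snd v / fst v))"
  by (simp add: saddle_def lambda_of_def lam_def split: prod.split)

lemma saddle_props:
  assumes "v \<in> deviation_cone M Y"
  shows "saddle M Y v \<in> interior dom" "mgf (saddle M Y v) = 1"
    "fst v / fst (mean (saddle M Y v)) > 0"
    "v = (fst v / fst (mean (saddle M Y v))) *\<^sub>R mean (saddle M Y v)"
proof -
  define m where "m = mu_at (snd v / fst v)"
  have v: "fst v > 0" "alpha_minus M Y < ereal (snd v / fst v)" "ereal (snd v / fst v) < alpha_plus M Y"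
    using assms by (auto simp: deviation_cone_def)
  have m: "m \<in> J" "slope m = snd v / fst v" unfolding m_def using mu_of_props[OF v(2,3)] by auto
  have s: "saddle M Y v = (lam m, m)" by (simp add: saddle_eq m_def)
  show 1: "saddle M Y v \<in> interior dom" "mgf (saddle M Y v) = 1" using lam_root[OF m(1)] s by auto
  have f: "fst (mean (saddle M Y v)) \<ge> 1" using mean_fst_ge_1[OF 1(1)] .
  show "fst v / fst (mean (saddle M Y v)) > 0" using f v(1) by simp
  have "snd (mean (saddle M Y v)) / fst (mean (saddle M Y v)) = snd v / fst v"
    using m(2) 1(2) by (simp add: slope_def s mean_def)
  then show "v = (fst v / fst (mean (saddle M Y v))) *\<^sub>R mean (saddle M Y v)"
    using f v(1) by (simp add: prod_eq_iff field_simps)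
qed

lemma saddle_continuous: "continuous_on (deviation_cone M Y) (saddle M Y)"
proof -
  let ?B = "{\<beta>. alpha_minus M Y < ereal \<beta> \<and> ereal \<beta> < alpha_plus M Y}"
  have "continuous_on (deviation_cone M Y) (\<lambda>v. snd v / fst v)"
    by (intro continuous_intros) (auto simp: deviation_cone_def)
  moreover have "(\<lambda>v. snd v / fst v) ` deviation_cone M Y \<subseteq> ?B"
    by (auto simp: deviation_cone_def)
  ultimately have c: "continuous_on (deviation_cone M Y) (\<lambda>v. mu_at (snd v / fst v))"
    by (rule continuous_on_compose2[OF mu_of_continuous])
  moreover have "continuous_on (deviation_cone M Y) (\<lambda>v. lam (mu_at (snd v / fst v)))"
    by (rule continuous_on_compose2[OF lam_continuous c]) (auto simp: deviation_cone_def mu_of_props)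
  ultimately show ?thesis unfolding saddle_eq[abs_def] by (intro continuous_on_Pair)
qed

lemma second_deviation_eq:
  assumes "v \<in> deviation_cone M Y"
  shows "second_deviation M Y v = ereal (saddle M Y v \<bullet> v)"
proof -
  define p where "p = saddle M Y v"
  note s = saddle_props[OF assms, folded p_def]
  define r where "r = fst v / fst (mean p)"
  have pd: "p \<in> dom" using s(1) interior_subset by blast
  have v: "v = r *\<^sub>R grad p" "r > 0" using s grad_eq_mean[OF pd] by (auto simp: r_def)
  show ?thesis
    unfolding second_deviation_def p_def[symmetric]
  proof (rule antisym)
    show "(SUP q\<in>{q. A2 M Y q \<le> 0}. ereal (q \<bullet> v)) \<le> ereal (p \<bullet> v)"
    proof (rule SUP_least)
      fix q assume "q \<in> {q. A2 M Y q \<le> 0}"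
      then have q: "q \<in> dom" "mgf q \<le> 1" by (auto simp: A2_le_0_iff)
      have "(q - p) \<bullet> grad p \<le> 0"
        using mgf_gradient_gap[OF s(1) q(1)] q(2) s(2) by (cases "q = p") auto
      then have "r * ((q - p) \<bullet> grad p) \<le> 0" using v(2) by (simp add: mult_nonneg_nonpos)
      then show "ereal (q \<bullet> v) \<le> ereal (p \<bullet> v)"
        by (simp add: v(1) inner_diff_left right_diff_distrib)
    qed
    show "ereal (p \<bullet> v) \<le> (SUP q\<in>{q. A2 M Y q \<le> 0}. ereal (q \<bullet> v))"
      by (rule SUP_upper) (simp add: A2_le_0_iff pd s(2))
  qed
qed

end

section \<open>Uniform decay of the tilted characteristic functions\<close>

lemma one_minus_cos_le: "1 - cos x \<le> x\<^sup>2 / 2" for x :: real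
proof -
  have "\<bar>sin (x / 2)\<bar> \<le> \<bar>x / 2\<bar>" by (rule abs_sin_x_le_abs_x)
  then have "(sin (x / 2))\<^sup>2 \<le> (x / 2)\<^sup>2" by (rule abs_le_square_iff[THEN iffD1])
  moreover have "cos x = 1 - 2 * (sin (x / 2))\<^sup>2" using cos_double_sin[of "x / 2"] by simp
  ultimately show ?thesis by (simp add: power_divide)
qed

lemma one_minus_cos_approx: "\<bar>1 - cos x - x\<^sup>2 / 2\<bar> \<le> \<bar>x\<bar> ^ 3 / 6" for x :: real
proof -
  have "cmod (iexp x - (\<Sum>k \<le> 2. (\<i> * x)^k / fact k)) \<le> \<bar>x\<bar>^(Suc 2) / fact (Suc 2)"
    by (rule iexp_approx1)
  then have *: "cmod (iexp x - (1 + \<i> * x - x\<^sup>2 / 2)) \<le> \<bar>x\<bar> ^ 3 / 6"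
    by (simp add: numeral_2_eq_2 numeral_3_eq_3 fact_numeral power2_eq_square algebra_simps)
  have r: "Re (iexp x - (1 + \<i> * x - x\<^sup>2 / 2)) = cos x - 1 + x\<^sup>2 / 2"
    by (simp add: Re_exp)
  have "\<bar>cos x - 1 + x\<^sup>2 / 2\<bar> \<le> \<bar>x\<bar> ^ 3 / 6"
    using order_trans[OF abs_Re_le_cmod *] unfolding r .
  then show ?thesis by (simp add: abs_if split: if_splits)
qed

definition (in random_vector) Phi :: "real \<times> real \<Rightarrow> real \<times> real \<Rightarrow> complex" where
  "Phi p u = (CLINT \<omega>|M. complex_of_real (exp (p \<bullet> Y \<omega>)) * iexp (2 * pi * (u \<bullet> Y \<omega>)))"

lemma (in random_vector) tilted_iexp_integrable:
  assumes "p \<in> dom"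
  shows "integrable M (\<lambda>\<omega>. complex_of_real (exp (p \<bullet> Y \<omega>)) * iexp (2 * pi * (u \<bullet> Y \<omega>)))"
  by (rule Bochner_Integration.integrable_bound[OF assms[unfolded dom_iff]]) (auto simp: norm_mult)

lemma (in random_vector) norm_Phi_le: "norm (Phi p u) \<le> mgf p"
  unfolding Phi_def mom_def
  using integral_norm_bound[of M "\<lambda>\<omega>. complex_of_real (exp (p \<bullet> Y \<omega>)) * iexp (2 * pi * (u \<bullet> Y \<omega>))"]
  by (simp add: norm_mult)

definition phase :: "(real \<times> real) \<times> real \<Rightarrow> real \<times> real \<Rightarrow> real" where
  "phase x y = 2 * pi * (fst x \<bullet> y) - snd x"

lemma phase_bound: "\<bar>phase x y\<bar> \<le> norm x * (2 * pi * norm y + 1)"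
proof -
  have "\<bar>fst x \<bullet> y\<bar> \<le> norm (fst x) * norm y" by (rule Cauchy_Schwarz_ineq2)
  also have "\<dots> \<le> norm x * norm y" by (intro mult_right_mono norm_fst_le[of "fst x" "snd x", simplified]) auto
  finally have "\<bar>fst x \<bullet> y\<bar> \<le> norm x * norm y" .
  then have "2 * pi * \<bar>fst x \<bullet> y\<bar> \<le> 2 * pi * (norm x * norm y)" by (intro mult_left_mono) auto
  moreover have "\<bar>snd x\<bar> \<le> norm x" using norm_snd_le[of "snd x" "fst x"] by simp
  moreover have "\<bar>phase x y\<bar> \<le> 2 * pi * \<bar>fst x \<bullet> y\<bar> + \<bar>snd x\<bar>"
    using abs_triangle_ineq4[of "2 * pi * (fst x \<bullet> y)" "snd x"] by (simp add: phase_def abs_mult)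
  ultimately have "\<bar>phase x y\<bar> \<le> 2 * pi * (norm x * norm y) + norm x" by linarith
  then show ?thesis by (simp add: algebra_simps)
qed

lemma phase_scale: "phase (t *\<^sub>R x) y = t * phase x y"
  by (simp add: phase_def algebra_simps)

lemma phase_tendsto: "(X \<longlongrightarrow> x) F \<Longrightarrow> ((\<lambda>n. phase (X n) y) \<longlongrightarrow> phase x y) F"
  unfolding phase_def by (intro tendsto_intros)

definition phase_box :: "((real \<times> real) \<times> real) set" where
  "phase_box = ({-1/2..1/2} \<times> {-1/2..1/2}) \<times> {-pi..pi}"

context lattice_step
begin

text \<open>If \<open>\<theta>\<close> is the argument of \<open>Phi p u\<close>, then \<open>mgf p - \<bar>Phi p u\<bar>\<close> is the mean of \<open>exp (p \<bullet> Y) (1 - cos (phase (u, \<theta>) Y))\<close>;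
  replacing \<open>exp (p \<bullet> Y)\<close> by \<open>exp (- R \<bar>Y\<bar>)\<close> gives a lower bound that is uniform in \<open>\<bar>p\<bar> \<le> R\<close>.\<close>

definition dispersion :: "real \<Rightarrow> (real \<times> real) \<times> real \<Rightarrow> real" where
  "dispersion R x = (\<integral>\<omega>. exp (- (R * norm (Y \<omega>))) * (1 - cos (phase x (Y \<omega>))) \<partial>M)"

lemma phase_measurable [measurable]: "(\<lambda>\<omega>. phase x (Y \<omega>)) \<in> borel_measurable M"
  unfolding phase_def by measurable

lemma exp_neg_norm_subexp_integrable:
  assumes "R > 0" "subexp g"
  shows "integrable M (\<lambda>\<omega>. exp (- (R * norm (Y \<omega>))) * g (Y \<omega>))"
proof -
  obtain C where C: "\<And>y. \<bar>g y\<bar> \<le> C * exp (R * norm y)"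
    using assms unfolding subexp_def by blast
  have [measurable]: "(\<lambda>\<omega>. g (Y \<omega>)) \<in> borel_measurable M" using assms(2) by (rule subexp_measurable)
  have "norm (exp (- (R * norm y)) * g y) \<le> C" for y
  proof -
    have "norm (exp (- (R * norm y)) * g y) \<le> exp (- (R * norm y)) * (C * exp (R * norm y))"
      using C[of y] by (simp add: abs_mult)
    also have "\<dots> = C" by (simp add: exp_minus)
    finally show ?thesis .
  qed
  then show ?thesis by (intro integrable_const_bound[of _ C]) auto
qed

lemma dispersion_eq_0:
  assumes "R > 0" "x \<in> phase_box" "dispersion R x = 0"
  shows "x = 0"
proof -
  have "integrable M (\<lambda>\<omega>. exp (- (R * norm (Y \<omega>))) * (1 - cos (phase x (Y \<omega>))))"
    using assms(1) by (intro Bochner_Integration.integrable_bound[OF exp_neg_norm_subexp_integrable[OF assms(1), of "\<lambda>_. 2"]])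
      (auto simp: abs_mult intro!: mult_left_mono)
  then have "AE \<omega> in M. exp (- (R * norm (Y \<omega>))) * (1 - cos (phase x (Y \<omega>))) = 0"
    using assms(3) unfolding dispersion_def by (subst (asm) integral_nonneg_eq_0_iff_AE) auto
  then have ae: "AE \<omega> in M. cos (2 * pi * (fst x \<bullet> Y \<omega>) - snd x) = 1"
    by eventually_elim (simp add: phase_def)
  then have "fst x \<in> \<int> \<times> \<int>" by (rule lattice_if_phase_const)
  moreover have "\<bar>fst (fst x)\<bar> \<le> 1 / 2" "\<bar>snd (fst x)\<bar> \<le> 1 / 2" "\<bar>snd x\<bar> \<le> pi"
    using assms(2) by (auto simp: phase_box_def mem_Times_iff abs_le_iff)
  moreover have zero: "a = 0" if "a \<in> \<int>" "\<bar>a\<bar> \<le> 1 / 2" for a :: real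
  proof -
    obtain k :: int where "a = k" using \<open>a \<in> \<int>\<close> by (auto elim: Ints_cases)
    then show ?thesis using that(2) by simp
  qed
  ultimately have f: "fst x = 0" by (simp add: mem_Times_iff prod_eq_iff)
  then have "AE \<omega> in M. cos (snd x) = 1" using ae by simp
  then have "cos (snd x) = 1" by simp
  then obtain n :: int where n: "snd x = of_int n * 2 * pi" unfolding cos_one_2pi_int by blast
  have "\<bar>of_int n * 2\<bar> * pi \<le> 1 * pi" using \<open>\<bar>snd x\<bar> \<le> pi\<close> n by (simp add: abs_mult)
  then have "\<bar>real_of_int n * 2\<bar> \<le> 1" by (simp only: mult_le_cancel_right_pos[OF pi_gt_zero])
  then have "n = 0" by linarith
  then show ?thesis using f n by (simp add: prod_eq_iff)
qed

lemma dispersion_lower_bound: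
  assumes R: "R > 0"
  obtains c where "c > 0" "\<And>x. x \<in> phase_box \<Longrightarrow> c * (norm x)\<^sup>2 \<le> dispersion R x"
proof (rule ccontr)
  assume "\<not> thesis"
  then have no: "\<exists>x\<in>phase_box. dispersion R x < c * (norm x)\<^sup>2" if "c > 0" for c
    using that \<open>\<And>c. c > 0 \<Longrightarrow> (\<And>x. x \<in> phase_box \<Longrightarrow> c * (norm x)\<^sup>2 \<le> dispersion R x) \<Longrightarrow> thesis\<close>[of c]
    by force
  have disp_nonneg: "dispersion R x \<ge> 0" for x
    unfolding dispersion_def by (intro Bochner_Integration.integral_nonneg) auto
  define W where "W \<omega> = exp (- (R * norm (Y \<omega>)))" for \<omega>
  have W: "W \<omega> > 0" for \<omega> by (simp add: W_def)
  have Wm [measurable]: "W \<in> borel_measurable M" unfolding W_def by measurable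
  have "\<exists>X. \<forall>n. X n \<in> phase_box \<and> dispersion R (X n) < inverse (real (Suc n)) * (norm (X n))\<^sup>2"
    using no[of "inverse (real (Suc n))" for n] by (intro choice) force
  then obtain X where X: "\<And>n. X n \<in> phase_box" "\<And>n. dispersion R (X n) < inverse (real (Suc n)) * (norm (X n))\<^sup>2"
    by blast
  have ne: "X n \<noteq> 0" for n using X(2)[of n] disp_nonneg[of "X n"] by auto
  define e where "e n = X n /\<^sub>R norm (X n)" for n
  have e: "e n \<in> sphere 0 1" for n using ne by (simp add: e_def)
  have "compact (phase_box \<times> sphere (0 :: (real \<times> real) \<times> real) 1)"
    unfolding phase_box_def by (intro compact_Times compact_Icc compact_sphere)
  then obtain l \<sigma> where l: "l \<in> phase_box \<times> sphere 0 1" "strict_mono \<sigma>" "((\<lambda>n. (X n, e n)) \<circ> \<sigma>) \<longlonglongrightarrow> l"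
    unfolding compact_def using X(1) e by (metis (no_types, lifting) SigmaI)
  define x where "x = fst l"
  define d where "d = snd l"
  have x: "x \<in> phase_box" "(\<lambda>n. X (\<sigma> n)) \<longlonglongrightarrow> x" and d: "norm d = 1" "(\<lambda>n. e (\<sigma> n)) \<longlonglongrightarrow> d"
    using l tendsto_fst[OF l(3)] tendsto_snd[OF l(3)] by (auto simp: x_def d_def comp_def)
  define q where "q n = dispersion R (X (\<sigma> n)) / (norm (X (\<sigma> n)))\<^sup>2" for n
  have q0: "q \<longlonglongrightarrow> 0"
  proof (rule tendsto_sandwich)
    show "\<forall>\<^sub>F n in sequentially. 0 \<le> q n" using disp_nonneg by (simp add: q_def)
    show "\<forall>\<^sub>F n in sequentially. q n \<le> inverse (real (Suc n))"
    proof (rule always_eventually, rule allI)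
      fix n
      have "q n \<le> inverse (real (Suc (\<sigma> n)))"
        unfolding q_def using X(2)[of "\<sigma> n"] ne[of "\<sigma> n"] by (subst pos_divide_le_eq) (auto intro: less_imp_le)
      also have "\<dots> \<le> inverse (real (Suc n))"
        using strict_mono_imp_increasing[OF l(2), of n] by (intro le_imp_inverse_le) auto
      finally show "q n \<le> inverse (real (Suc n))" .
    qed
    show "(\<lambda>n. inverse (real (Suc n))) \<longlonglongrightarrow> 0" by (rule LIMSEQ_inverse_real_of_nat)
  qed simp
  show False
  proof (cases "x = 0")
    case False
    have "(\<lambda>n. dispersion R (X (\<sigma> n))) \<longlonglongrightarrow> dispersion R x"
      unfolding dispersion_def W_def[symmetric]
    proof (rule integral_dominated_convergence)
      show "integrable M (\<lambda>\<omega>. W \<omega> * 2)"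
        unfolding W_def using exp_neg_norm_subexp_integrable[OF R, of "\<lambda>_. 2"] by simp
      show "AE \<omega> in M. (\<lambda>n. W \<omega> * (1 - cos (phase (X (\<sigma> n)) (Y \<omega>)))) \<longlonglongrightarrow> W \<omega> * (1 - cos (phase x (Y \<omega>)))"
        by (intro AE_I2 tendsto_intros phase_tendsto x)
      show "AE \<omega> in M. norm (W \<omega> * (1 - cos (phase (X (\<sigma> n)) (Y \<omega>)))) \<le> W \<omega> * 2" for n
        using W by (auto simp: abs_mult abs_of_pos intro!: mult_left_mono AE_I2)
    qed auto
    moreover have "dispersion R (X (\<sigma> n)) = q n * (norm (X (\<sigma> n)))\<^sup>2" for n
      using ne by (simp add: q_def)
    then have "(\<lambda>n. dispersion R (X (\<sigma> n))) \<longlonglongrightarrow> 0 * (norm x)\<^sup>2"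
      by (simp only:) (intro tendsto_intros q0 x)
    ultimately have "dispersion R x = 0" using LIMSEQ_unique by force
    then show False using dispersion_eq_0[OF R x(1)] False by blast
  next
    case True
    have t0: "(\<lambda>n. norm (X (\<sigma> n))) \<longlonglongrightarrow> 0" using x(2) True tendsto_norm_zero by blast
    have "q \<longlonglongrightarrow> (\<integral>\<omega>. W \<omega> * ((phase d (Y \<omega>))\<^sup>2 / 2) \<partial>M)"
    proof -
      have q_eq: "q = (\<lambda>n. (\<integral>\<omega>. W \<omega> * ((1 - cos (norm (X (\<sigma> n)) * phase (e (\<sigma> n)) (Y \<omega>))) / (norm (X (\<sigma> n)))\<^sup>2) \<partial>M))"
      proof
        fix n
        have "X (\<sigma> n) = norm (X (\<sigma> n)) *\<^sub>R e (\<sigma> n)" using ne by (simp add: e_def)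
        then have "phase (X (\<sigma> n)) y = norm (X (\<sigma> n)) * phase (e (\<sigma> n)) y" for y
          using phase_scale by metis
        then show "q n = (\<integral>\<omega>. W \<omega> * ((1 - cos (norm (X (\<sigma> n)) * phase (e (\<sigma> n)) (Y \<omega>))) / (norm (X (\<sigma> n)))\<^sup>2) \<partial>M)"
          unfolding q_def dispersion_def W_def[symmetric] by simp
      qed
      show ?thesis unfolding q_eq
      proof (rule integral_dominated_convergence)
        have "subexp (\<lambda>y. (2 * pi * norm y + 1)\<^sup>2 / 2)"
          using subexp_mult[OF subexp_power[OF subexp_add[OF subexp_mult[OF subexp_const subexp_norm] subexp_const]] subexp_const, of "2 * pi" 1 2 "1/2"]
          by simp
        then show "integrable M (\<lambda>\<omega>. W \<omega> * ((2 * pi * norm (Y \<omega>) + 1)\<^sup>2 / 2))"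
          unfolding W_def by (rule exp_neg_norm_subexp_integrable[OF R])
        show "AE \<omega> in M. norm (W \<omega> * ((1 - cos (norm (X (\<sigma> n)) * phase (e (\<sigma> n)) (Y \<omega>))) / (norm (X (\<sigma> n)))\<^sup>2))
            \<le> W \<omega> * ((2 * pi * norm (Y \<omega>) + 1)\<^sup>2 / 2)" for n
        proof (rule AE_I2)
          fix \<omega>
          define t where "t = norm (X (\<sigma> n))"
          define z where "z = phase (e (\<sigma> n)) (Y \<omega>)"
          have t: "t > 0" using ne by (simp add: t_def)
          have "\<bar>z\<bar> \<le> 2 * pi * norm (Y \<omega>) + 1"
            using phase_bound[of "e (\<sigma> n)" "Y \<omega>"] e[of "\<sigma> n"] by (simp add: z_def)
          then have z: "z\<^sup>2 \<le> (2 * pi * norm (Y \<omega>) + 1)\<^sup>2" using power_mono[of "\<bar>z\<bar>" _ 2] by simp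
          have "(1 - cos (t * z)) / t\<^sup>2 \<le> ((t * z)\<^sup>2 / 2) / t\<^sup>2" by (intro divide_right_mono one_minus_cos_le) auto
          also have "\<dots> = z\<^sup>2 / 2" using t by (simp add: power_mult_distrib)
          finally have "(1 - cos (t * z)) / t\<^sup>2 \<le> (2 * pi * norm (Y \<omega>) + 1)\<^sup>2 / 2" using z by linarith
          moreover have "(1 - cos (t * z)) / t\<^sup>2 \<ge> 0" by simp
          ultimately have "norm (W \<omega> * ((1 - cos (t * z)) / t\<^sup>2)) \<le> W \<omega> * ((2 * pi * norm (Y \<omega>) + 1)\<^sup>2 / 2)"
            using W[of \<omega>] unfolding real_norm_def abs_mult by (intro mult_mono) auto
          then show "norm (W \<omega> * ((1 - cos (norm (X (\<sigma> n)) * phase (e (\<sigma> n)) (Y \<omega>))) / (norm (X (\<sigma> n)))\<^sup>2))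
            \<le> W \<omega> * ((2 * pi * norm (Y \<omega>) + 1)\<^sup>2 / 2)" unfolding t_def z_def .
        qed
        show "AE \<omega> in M. (\<lambda>n. W \<omega> * ((1 - cos (norm (X (\<sigma> n)) * phase (e (\<sigma> n)) (Y \<omega>))) / (norm (X (\<sigma> n)))\<^sup>2))
            \<longlonglongrightarrow> W \<omega> * ((phase d (Y \<omega>))\<^sup>2 / 2)"
        proof (rule AE_I2)
          fix \<omega>
          define t where "t n = norm (X (\<sigma> n))" for n
          define z where "z n = phase (e (\<sigma> n)) (Y \<omega>)" for n
          have t: "t n > 0" for n using ne by (simp add: t_def)
          have z: "z \<longlonglongrightarrow> phase d (Y \<omega>)" unfolding z_def by (intro phase_tendsto d)
          have "(\<lambda>n. (1 - cos (t n * z n)) / (t n)\<^sup>2 - (z n)\<^sup>2 / 2) \<longlonglongrightarrow> 0"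
          proof (rule Lim_null_comparison)
            show "\<forall>\<^sub>F n in sequentially. norm ((1 - cos (t n * z n)) / (t n)\<^sup>2 - (z n)\<^sup>2 / 2) \<le> t n * \<bar>z n\<bar> ^ 3 / 6"
            proof (rule always_eventually, rule allI)
              fix n
              have "(1 - cos (t n * z n)) / (t n)\<^sup>2 - (z n)\<^sup>2 / 2 = (1 - cos (t n * z n) - (t n * z n)\<^sup>2 / 2) / (t n)\<^sup>2"
                using t[of n] by (simp add: diff_divide_distrib power_mult_distrib)
              also have "norm \<dots> \<le> (\<bar>t n * z n\<bar> ^ 3 / 6) / (t n)\<^sup>2"
                using divide_right_mono[OF one_minus_cos_approx[of "t n * z n"], of "(t n)\<^sup>2"] by (simp only: real_norm_def abs_divide abs_power2 zero_le_power2)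
              also have "\<dots> = t n * \<bar>z n\<bar> ^ 3 / 6"
                using t[of n] by (simp add: abs_mult power_mult_distrib power2_eq_square power3_eq_cube)
              finally show "norm ((1 - cos (t n * z n)) / (t n)\<^sup>2 - (z n)\<^sup>2 / 2) \<le> t n * \<bar>z n\<bar> ^ 3 / 6" .
            qed
            have "(\<lambda>n. t n * \<bar>z n\<bar> ^ 3 / 6) \<longlonglongrightarrow> 0 * \<bar>phase d (Y \<omega>)\<bar> ^ 3 / 6"
              by (intro tendsto_intros z) (use t0 in \<open>auto simp: t_def\<close>)
            then show "(\<lambda>n. t n * \<bar>z n\<bar> ^ 3 / 6) \<longlonglongrightarrow> 0" by simp
          qed
          then have "(\<lambda>n. ((1 - cos (t n * z n)) / (t n)\<^sup>2 - (z n)\<^sup>2 / 2) + (z n)\<^sup>2 / 2) \<longlonglongrightarrow> 0 + (phase d (Y \<omega>))\<^sup>2 / 2"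
            by (intro tendsto_add tendsto_divide tendsto_power tendsto_const z) auto
          then have "(\<lambda>n. (1 - cos (t n * z n)) / (t n)\<^sup>2) \<longlonglongrightarrow> (phase d (Y \<omega>))\<^sup>2 / 2" by simp
          then show "(\<lambda>n. W \<omega> * ((1 - cos (norm (X (\<sigma> n)) * phase (e (\<sigma> n)) (Y \<omega>))) / (norm (X (\<sigma> n)))\<^sup>2))
            \<longlonglongrightarrow> W \<omega> * ((phase d (Y \<omega>))\<^sup>2 / 2)"
            unfolding t_def z_def by (rule tendsto_mult_left)
        qed
      qed auto
    qed
    then have z: "(\<integral>\<omega>. W \<omega> * ((phase d (Y \<omega>))\<^sup>2 / 2) \<partial>M) = 0" using q0 LIMSEQ_unique by blast
    have "integrable M (\<lambda>\<omega>. W \<omega> * ((phase d (Y \<omega>))\<^sup>2 / 2))"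
    proof -
      have "subexp (\<lambda>y. (phase d y)\<^sup>2 / 2)"
        unfolding phase_def inner_real_pair
        using subexp_mult[OF subexp_power[OF subexp_add[OF subexp_mult[OF subexp_const subexp_add[OF subexp_mult[OF subexp_const subexp_fst] subexp_mult[OF subexp_const subexp_snd]]] subexp_const]] subexp_const,
            of "2 * pi" "fst (fst d)" "snd (fst d)" "- snd d" 2 "1/2"] by simp
      then show ?thesis unfolding W_def by (rule exp_neg_norm_subexp_integrable[OF R])
    qed
    then have "AE \<omega> in M. W \<omega> * ((phase d (Y \<omega>))\<^sup>2 / 2) = 0"
      using z W by (subst (asm) integral_nonneg_eq_0_iff_AE) (auto simp: less_imp_le)
    then have ae: "AE \<omega> in M. fst d \<bullet> Y \<omega> = snd d / (2 * pi)"
    proof eventually_elim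
      case (elim \<omega>)
      then have "phase d (Y \<omega>) = 0" using W[of \<omega>] by simp
      then show ?case by (simp add: phase_def field_simps)
    qed
    then have "fst d = 0" using not_AE_inner_const by blast
    moreover then have "snd d = 0" using ae by simp
    ultimately have "d = 0" by (simp add: prod_eq_iff)
    then show False using d(1) by simp
  qed
qed

lemma Phi_decay:
  assumes R: "R > 0"
  obtains c where "c > 0"
    "\<And>p u. p \<in> dom \<Longrightarrow> norm p \<le> R \<Longrightarrow> u \<in> {-1/2..1/2} \<times> {-1/2..1/2} \<Longrightarrow> norm (Phi p u) \<le> mgf p - c * (norm u)\<^sup>2"
proof -
  obtain c where c: "c > 0" "\<And>x. x \<in> phase_box \<Longrightarrow> c * (norm x)\<^sup>2 \<le> dispersion R x"
    using dispersion_lower_bound[OF R] by blast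
  have "norm (Phi p u) \<le> mgf p - c * (norm u)\<^sup>2"
    if p: "p \<in> dom" "norm p \<le> R" and u: "u \<in> {-1/2..1/2} \<times> {-1/2..1/2}" for p u
  proof -
    define \<theta> where "\<theta> = Arg (Phi p u)"
    have "Phi p u = of_real (norm (Phi p u)) * iexp \<theta>"
      unfolding \<theta>_def by (cases "Phi p u = 0") (auto simp: Arg_eq[symmetric])
    then have "of_real (norm (Phi p u)) = Phi p u * iexp (- \<theta>)"
      by (metis (no_types, opaque_lifting) exp_minus_inverse exp_zero mult.assoc mult.right_neutral mult_minus_right of_real_minus)
    also have "\<dots> = (CLINT \<omega>|M. complex_of_real (exp (p \<bullet> Y \<omega>)) * iexp (2 * pi * (u \<bullet> Y \<omega>)) * iexp (- \<theta>))"
      unfolding Phi_def by (rule integral_mult_left_zero[symmetric])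
    also have "\<dots> = (CLINT \<omega>|M. complex_of_real (exp (p \<bullet> Y \<omega>)) * iexp (phase (u, \<theta>) (Y \<omega>)))"
      by (intro Bochner_Integration.integral_cong refl) (simp add: phase_def exp_add[symmetric] algebra_simps)
    finally have eq: "of_real (norm (Phi p u)) = (CLINT \<omega>|M. complex_of_real (exp (p \<bullet> Y \<omega>)) * iexp (phase (u, \<theta>) (Y \<omega>)))" .
    have int: "integrable M (\<lambda>\<omega>. complex_of_real (exp (p \<bullet> Y \<omega>)) * iexp (phase (u, \<theta>) (Y \<omega>)))"
      by (rule Bochner_Integration.integrable_bound[OF p(1)[unfolded dom_iff]]) (auto simp: norm_mult)
    have "norm (Phi p u) = Re (of_real (norm (Phi p u)))" by simp
    also have "\<dots> = (\<integral>\<omega>. Re (complex_of_real (exp (p \<bullet> Y \<omega>)) * iexp (phase (u, \<theta>) (Y \<omega>))) \<partial>M)"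
      unfolding eq using int by (rule integral_Re[symmetric])
    also have "\<dots> = (\<integral>\<omega>. exp (p \<bullet> Y \<omega>) * cos (phase (u, \<theta>) (Y \<omega>)) \<partial>M)"
      by (simp add: Re_exp)
    finally have n: "norm (Phi p u) = (\<integral>\<omega>. exp (p \<bullet> Y \<omega>) * cos (phase (u, \<theta>) (Y \<omega>)) \<partial>M)" .
    have ic: "integrable M (\<lambda>\<omega>. exp (p \<bullet> Y \<omega>) * cos (phase (u, \<theta>) (Y \<omega>)))"
      by (rule Bochner_Integration.integrable_bound[OF p(1)[unfolded dom_iff]])
        (auto simp: abs_mult mult_le_cancel_left1)
    note ip = p(1)[unfolded dom_iff]
    have "dispersion R (u, \<theta>) \<le> (\<integral>\<omega>. exp (p \<bullet> Y \<omega>) - exp (p \<bullet> Y \<omega>) * cos (phase (u, \<theta>) (Y \<omega>)) \<partial>M)"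
      unfolding dispersion_def
    proof (rule integral_mono)
      show "integrable M (\<lambda>\<omega>. exp (- (R * norm (Y \<omega>))) * (1 - cos (phase (u, \<theta>) (Y \<omega>))))"
        by (intro Bochner_Integration.integrable_bound[OF exp_neg_norm_subexp_integrable[OF R, of "\<lambda>_. 2"]])
          (auto simp: abs_mult intro!: mult_left_mono)
      show "integrable M (\<lambda>\<omega>. exp (p \<bullet> Y \<omega>) - exp (p \<bullet> Y \<omega>) * cos (phase (u, \<theta>) (Y \<omega>)))"
        using ip ic by (rule Bochner_Integration.integrable_diff)
      fix \<omega>
      have "- (p \<bullet> Y \<omega>) \<le> norm p * norm (Y \<omega>)" using Cauchy_Schwarz_ineq2[of p "Y \<omega>"] by linarith
      also have "\<dots> \<le> R * norm (Y \<omega>)" using p(2) by (rule mult_right_mono) simp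
      finally have "exp (- (R * norm (Y \<omega>))) \<le> exp (p \<bullet> Y \<omega>)" by simp
      then have "exp (- (R * norm (Y \<omega>))) * (1 - cos (phase (u, \<theta>) (Y \<omega>))) \<le> exp (p \<bullet> Y \<omega>) * (1 - cos (phase (u, \<theta>) (Y \<omega>)))"
        by (rule mult_right_mono) simp
      then show "exp (- (R * norm (Y \<omega>))) * (1 - cos (phase (u, \<theta>) (Y \<omega>)))
          \<le> exp (p \<bullet> Y \<omega>) - exp (p \<bullet> Y \<omega>) * cos (phase (u, \<theta>) (Y \<omega>))" by (simp add: right_diff_distrib)
    qed
    also have "\<dots> = mgf p - norm (Phi p u)"
      unfolding n using Bochner_Integration.integral_diff[OF ip ic] by (simp add: mom_def)
    finally have 1: "dispersion R (u, \<theta>) \<le> mgf p - norm (Phi p u)" .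
    have "c * (norm u)\<^sup>2 \<le> c * (norm (u, \<theta>))\<^sup>2"
      using c(1) norm_fst_le[of u \<theta>] by (intro mult_left_mono power_mono) auto
    also have "\<dots> \<le> dispersion R (u, \<theta>)"
      using Arg_bounded[of "Phi p u"] u by (intro c(2)) (auto simp: phase_box_def \<theta>_def)
    finally show ?thesis using 1 by linarith
  qed
  then show ?thesis using that c(1) by blast
qed

end

section \<open>Gaussian integrals and Fourier inversion on the lattice\<close>

lemma gaussian_char:
  fixes a b :: real
  assumes a: "a > 0"
  shows "integrable lborel (\<lambda>x. complex_of_real (exp (- (a * x\<^sup>2 / 2))) * iexp (b * x))" (is ?I)
    and "(CLBINT x. complex_of_real (exp (- (a * x\<^sup>2 / 2))) * iexp (b * x)) = of_real (sqrt (2 * pi / a) * exp (- (b\<^sup>2 / (2 * a))))" (is ?E)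
proof -
  define t where "t = b / sqrt a"
  define f where "f x = complex_of_real (exp (- (x\<^sup>2 / 2))) * iexp (t * x)" for x :: real
  have dens: "complex_of_real (std_normal_density x) * iexp (t * x) = f x / sqrt (2 * pi)" for x
    by (simp add: f_def std_normal_density_def)
  have "integrable std_normal_distribution (\<lambda>x. iexp (t * x))"
    by (rule finite_measure.integrable_const_bound[of _ _ 1])
      (auto intro: real_distribution.axioms(1)[OF real_dist_normal_dist] prob_space.finite_measure)
  then have "integrable lborel (\<lambda>x. std_normal_density x *\<^sub>R iexp (t * x))"
    by (subst (asm) integrable_density) auto
  then have i0: "integrable lborel (\<lambda>x. f x / sqrt (2 * pi))"
    by (simp only: scaleR_conv_of_real dens)
  then have i1: "integrable lborel f"
    using integrable_mult_right[OF i0, of "of_real (sqrt (2 * pi))"] by simp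
  have "complex_of_real (exp (- (t\<^sup>2) / 2)) = (CLBINT x. std_normal_density x *\<^sub>R iexp (t * x))"
    using fun_cong[OF char_std_normal_distribution, of t] unfolding char_def
    by (subst (asm) integral_density) auto
  also have "\<dots> = (CLBINT x. f x / sqrt (2 * pi))"
    by (simp only: scaleR_conv_of_real dens)
  also have "\<dots> = (CLBINT x. f x) / sqrt (2 * pi)" by simp
  finally have e1: "(CLBINT x. f x) = sqrt (2 * pi) * exp (- (t\<^sup>2) / 2)"
    by (simp add: field_simps)
  have g: "f (sqrt a * x) = complex_of_real (exp (- (a * x\<^sup>2 / 2))) * iexp (b * x)" for x
    using a by (simp add: f_def t_def power_mult_distrib)
  have "integrable lborel (\<lambda>x. f (0 + sqrt a * x))"
    using i1 a by (intro lborel_integrable_real_affine) auto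
  then show ?I by (simp add: g)
  have "(CLBINT x. f x) = \<bar>sqrt a\<bar> *\<^sub>R (CLBINT x. f (0 + sqrt a * x))"
    using a by (intro lborel_integral_real_affine) auto
  then have "(CLBINT x. complex_of_real (exp (- (a * x\<^sup>2 / 2))) * iexp (b * x)) = (CLBINT x. f x) / sqrt a"
    using a by (simp add: g scaleR_conv_of_real)
  also have "\<dots> = of_real (sqrt (2 * pi / a) * exp (- (b\<^sup>2 / (2 * a))))"
    using a unfolding e1 by (simp add: t_def power_divide real_sqrt_divide)
  finally show ?E .
qed

lemma gaussian_integral:
  fixes a :: real
  assumes a: "a > 0"
  shows "integrable lborel (\<lambda>x. exp (- (a * x\<^sup>2 / 2)))" (is ?I)
    and "(\<integral>x. exp (- (a * x\<^sup>2 / 2)) \<partial>lborel) = sqrt (2 * pi / a)" (is ?E)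
proof -
  have i: "integrable lborel (\<lambda>x. complex_of_real (exp (- (a * x\<^sup>2 / 2))))"
    using gaussian_char(1)[OF a, of 0] by simp
  then show ?I by (simp only: complex_of_real_integrable_eq)
  have "complex_of_real (\<integral>x. exp (- (a * x\<^sup>2 / 2)) \<partial>lborel) = of_real (sqrt (2 * pi / a))"
    using gaussian_char(2)[OF a, of 0] by (simp flip: integral_complex_of_real)
  then show ?E by (simp only: of_real_eq_iff)
qed

definition quad :: "real \<Rightarrow> real \<Rightarrow> real \<Rightarrow> real \<times> real \<Rightarrow> real" where
  "quad A B C w = A * (fst w)\<^sup>2 + 2 * B * fst w * snd w + C * (snd w)\<^sup>2"

lemma quad_complete_square:
  assumes "C \<noteq> 0"
  shows "quad A B C (x, y) = C * (y + B * x / C)\<^sup>2 + (A * C - B\<^sup>2) / C * x\<^sup>2"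
  using assms by (simp add: quad_def field_simps power2_eq_square)

lemma gaussian_char2_inner:
  assumes C: "C > 0"
  shows "integrable lborel (\<lambda>y. complex_of_real (exp (- (quad A B C (x, y) / 2))) * iexp (b1 * x + b2 * y))" (is ?I)
    and "(CLBINT y. complex_of_real (exp (- (quad A B C (x, y) / 2))) * iexp (b1 * x + b2 * y)) =
      of_real (sqrt (2 * pi / C) * exp (- (b2\<^sup>2 / (2 * C)))) *
      (complex_of_real (exp (- ((A * C - B\<^sup>2) / C * x\<^sup>2 / 2))) * iexp ((b1 - b2 * B / C) * x))" (is ?E)
proof -
  define f where "f y = complex_of_real (exp (- (C * y\<^sup>2 / 2))) * iexp (b2 * y)" for y
  define k where "k = complex_of_real (exp (- ((A * C - B\<^sup>2) / C * x\<^sup>2 / 2))) * iexp ((b1 - b2 * B / C) * x)"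
  have eq: "complex_of_real (exp (- (quad A B C (x, y) / 2))) * iexp (b1 * x + b2 * y) = k * f (B * x / C + 1 * y)" for y
  proof -
    have "exp (- (quad A B C (x, y) / 2)) = exp (- ((A * C - B\<^sup>2) / C * x\<^sup>2 / 2)) * exp (- (C * (B * x / C + 1 * y)\<^sup>2 / 2))"
      unfolding mult_exp_exp using C by (subst quad_complete_square) (auto simp: add_divide_distrib add.commute)
    moreover have "iexp (b1 * x + b2 * y) = iexp ((b1 - b2 * B / C) * x) * iexp (b2 * (B * x / C + 1 * y))"
      unfolding exp_add[symmetric] by (simp add: algebra_simps)
    ultimately show ?thesis by (simp add: k_def f_def)
  qed
  have f: "integrable lborel f" "(CLBINT y. f y) = of_real (sqrt (2 * pi / C) * exp (- (b2\<^sup>2 / (2 * C))))"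
    unfolding f_def using gaussian_char[OF C, of b2] by auto
  have "integrable lborel (\<lambda>y. f (B * x / C + 1 * y))" using f(1) by (rule lborel_integrable_real_affine) simp
  then show ?I unfolding eq by (rule integrable_mult_right)
  have "(CLBINT y. f y) = \<bar>1\<bar> *\<^sub>R (CLBINT y. f (B * x / C + 1 * y))" by (rule lborel_integral_real_affine) simp
  then have "(CLBINT y. k * f (B * x / C + 1 * y)) = k * (CLBINT y. f y)" by simp
  then show ?E unfolding eq f(2) k_def[symmetric] by (simp only: mult.commute)
qed

lemma gaussian_char2:
  assumes C: "C > 0" and D: "A * C - B\<^sup>2 > 0"
  shows "integrable lborel (\<lambda>w. complex_of_real (exp (- (quad A B C w / 2))) * iexp (b \<bullet> w))" (is ?I)
    and "(CLINT w|lborel. complex_of_real (exp (- (quad A B C w / 2))) * iexp (b \<bullet> w)) =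
      of_real (2 * pi / sqrt (A * C - B\<^sup>2) * exp (- (quad C (- B) A b / (2 * (A * C - B\<^sup>2)))))" (is ?E)
proof -
  define D where "D = A * C - B\<^sup>2"
  define b1 b2 where "b1 = fst b" and "b2 = snd b"
  define f where "f w = complex_of_real (exp (- (quad A B C w / 2))) * iexp (b \<bullet> w)" for w
  define K where "K = complex_of_real (sqrt (2 * pi / C) * exp (- (b2\<^sup>2 / (2 * C))))"
  have bw: "b \<bullet> (x, y) = b1 * x + b2 * y" for x y by (simp add: b1_def b2_def inner_prod_def)
  have DC: "D / C > 0" using assms by (simp add: D_def)
  note inner = gaussian_char2_inner[OF C, of A B _ b1 b2, folded D_def bw, folded f_def K_def]
  have [measurable]: "f \<in> borel_measurable borel"
    unfolding f_def quad_def by (intro borel_measurable_continuous_onI continuous_intros) auto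
  have nf: "norm (f w) = exp (- (quad A B C w / 2))" for w by (simp add: f_def norm_mult)
  have norm_inner: "(\<integral>y. norm (f (x, y)) \<partial>lborel) = sqrt (2 * pi / C) * exp (- (D / C * x\<^sup>2 / 2))" for x
  proof -
    have "complex_of_real (\<integral>y. norm (f (x, y)) \<partial>lborel) = of_real (sqrt (2 * pi / C) * exp (- (D / C * x\<^sup>2 / 2)))"
      using gaussian_char2_inner(2)[OF C, of A B x 0 0, folded D_def]
      unfolding nf integral_complex_of_real[symmetric] by simp
    then show ?thesis by (simp only: of_real_eq_iff)
  qed
  have i2: "integrable (lborel \<Otimes>\<^sub>M lborel) f"
  proof (rule lborel_pair.Fubini_integrable)
    show "f \<in> borel_measurable (lborel \<Otimes>\<^sub>M lborel)" by (simp add: lborel_prod)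
    show "integrable lborel (\<lambda>x. \<integral>y. norm (f (x, y)) \<partial>lborel)"
      unfolding norm_inner using gaussian_integral(1)[OF DC] by (rule integrable_mult_right)
    show "AE x in lborel. integrable lborel (\<lambda>y. f (x, y))" using inner(1) by simp
  qed
  then show ?I by (simp add: lborel_prod f_def[abs_def])
  have "(CLINT w|lborel. f w) = (CLBINT x. CLBINT y. f (x, y))"
    using lborel_pair.integral_fst'[OF i2] by (simp add: lborel_prod)
  also have "\<dots> = (CLBINT x. K * (complex_of_real (exp (- (D / C * x\<^sup>2 / 2))) * iexp ((b1 - b2 * B / C) * x)))"
    by (simp only: inner(2))
  also have "\<dots> = K * of_real (sqrt (2 * pi / (D / C)) * exp (- ((b1 - b2 * B / C)\<^sup>2 / (2 * (D / C)))))"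
    by (simp only: integral_mult_right_zero gaussian_char(2)[OF DC])
  also have "\<dots> = of_real ((sqrt (2 * pi / C) * sqrt (2 * pi / (D / C))) * (exp (- (b2\<^sup>2 / (2 * C))) * exp (- ((b1 - b2 * B / C)\<^sup>2 / (2 * (D / C))))))"
    by (simp add: K_def)
  also have "sqrt (2 * pi / C) * sqrt (2 * pi / (D / C)) = 2 * pi / sqrt D"
  proof -
    have "sqrt (2 * pi / C) * sqrt (2 * pi / (D / C)) = sqrt ((2 * pi)\<^sup>2 / D)"
      unfolding real_sqrt_mult[symmetric] using C by (simp add: power2_eq_square)
    then show ?thesis by (simp only: real_sqrt_divide real_sqrt_abs) simp
  qed
  also have "exp (- (b2\<^sup>2 / (2 * C))) * exp (- ((b1 - b2 * B / C)\<^sup>2 / (2 * (D / C)))) = exp (- (quad C (- B) A b / (2 * D)))"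
  proof -
    have "b2\<^sup>2 / (2 * C) + (b1 - b2 * B / C)\<^sup>2 / (2 * (D / C)) = (b2\<^sup>2 * D + (b1 * C - b2 * B)\<^sup>2) / (2 * C * D)"
    proof -
      define X where "X = b1 * C - b2 * B"
      have "b1 - b2 * B / C = X / C" using C by (simp add: X_def diff_divide_distrib)
      moreover have "D > 0" using assms(2) by (simp add: D_def)
      ultimately show ?thesis
        unfolding X_def[symmetric] using C by (simp add: field_simps power2_eq_square)
    qed
    also have "b2\<^sup>2 * D + (b1 * C - b2 * B)\<^sup>2 = C * quad C (- B) A b"
      by (simp add: D_def quad_def b1_def b2_def power2_eq_square algebra_simps)
    finally show ?thesis unfolding mult_exp_exp using C by (simp add: algebra_simps)
  qed
  finally show ?E unfolding f_def D_def .
qed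

lemma iexp_integral_unit:
  assumes "k \<in> \<int>"
  shows "(CLBINT x. indicator {-1/2..1/2} x *\<^sub>R iexp (2 * pi * (x * k))) = (if k = 0 then 1 else 0)"
proof (cases "k = 0")
  case False
  obtain j :: int where j: "k = of_int j" using assms by (auto elim: Ints_cases)
  define c where "c = 2 * pi * k * \<i>"
  define F where "F x = exp (c * of_real x) / c" for x :: real
  have c: "c \<noteq> 0" using False by (simp add: c_def)
  have iexp_eq: "iexp (2 * pi * (x * k)) = exp (c * of_real x)" for x :: real
    by (simp add: c_def mult_ac)
  have "(CLBINT x. indicator {-1/2..1/2} x *\<^sub>R iexp (2 * pi * (x * k))) = F (1/2) - F (-1/2)"
  proof (rule integral_FTC_Icc)
    show "(F has_vector_derivative iexp (2 * pi * (x * k))) (at x within {-1/2..1/2})" for x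
      unfolding F_def iexp_eq using c
      by (intro has_vector_derivative_real_field) (auto intro!: derivative_eq_intros)
    show "continuous_on {-1/2..1/2} (\<lambda>x. iexp (2 * pi * (x * k)))"
      by (intro continuous_intros)
  qed simp
  also have "iexp (2 * pi * (1/2 * k)) = iexp (2 * pi * (-1/2 * k))"
  proof -
    have "iexp (2 * pi * (1/2 * k)) = iexp (2 * pi * (-1/2 * k)) * exp (2 * of_real pi * of_int j * \<i>)"
      unfolding exp_add[symmetric] by (simp add: j algebra_simps)
    also have "exp (2 * of_real pi * of_int j * \<i>) = (1::complex)"
      using exp_integer_2pi[of "of_int j"] by (simp add: mult_ac)
    finally show ?thesis by simp
  qed
  then have "F (1/2) - F (-1/2) = 0" unfolding iexp_eq by (simp add: F_def)
  finally show ?thesis using False by simp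
qed simp

definition unit_box :: "(real \<times> real) set" where
  "unit_box = {-1/2..1/2} \<times> {-1/2..1/2}"

lemma unit_box_borel [measurable]: "unit_box \<in> sets borel"
  unfolding unit_box_def by (intro borel_closed closed_Times) auto

lemma emeasure_unit_box: "emeasure lborel unit_box = 1"
  unfolding unit_box_def
  by (simp add: lborel_prod[symmetric] lborel.emeasure_pair_measure_Times)

lemma iexp_integral_unit_box:
  assumes "k \<in> \<int> \<times> \<int>"
  shows "(CLINT u|lborel. indicator unit_box u *\<^sub>R iexp (2 * pi * (u \<bullet> k))) = (if k = 0 then 1 else 0)"
proof -
  define f where "f u = (indicator unit_box u *\<^sub>R iexp (2 * pi * (u \<bullet> k)) :: complex)" for u
  have "integrable lborel f"
    unfolding f_def
    by (rule Bochner_Integration.integrable_bound[of _ "indicator unit_box :: _ \<Rightarrow> real"])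
       (auto simp: emeasure_unit_box indicator_def)
  then have "(CLINT u|lborel. f u) = (CLBINT x. CLBINT y. f (x, y))"
    using lborel_pair.integral_fst'[of f] by (simp add: lborel_prod)
  also have "f (x, y) = (indicator {-1/2..1/2} x *\<^sub>R iexp (2 * pi * (x * fst k))) * (indicator {-1/2..1/2} y *\<^sub>R iexp (2 * pi * (y * snd k)))" for x y
    by (simp add: f_def unit_box_def indicator_times inner_prod_def scaleR_conv_of_real distrib_left exp_add mult_ac)
  then have "(CLBINT x. CLBINT y. f (x, y)) =
     (CLBINT x. indicator {-1/2..1/2} x *\<^sub>R iexp (2 * pi * (x * fst k))) * (CLBINT y. indicator {-1/2..1/2} y *\<^sub>R iexp (2 * pi * (y * snd k)))"
    by (simp only: integral_mult_right_zero integral_mult_left_zero)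
  also have "\<dots> = (if k = 0 then 1 else 0)"
    using assms by (subst (1 2) iexp_integral_unit) (auto simp: mem_Times_iff prod_eq_iff)
  finally show ?thesis unfolding f_def .
qed

lemma (in random_vector) lattice_inversion:
  assumes lat: "AE \<omega> in M. Y \<omega> \<in> \<int> \<times> \<int>" and p: "p \<in> dom" and s: "s \<in> \<int> \<times> \<int>"
  shows "integrable lborel (\<lambda>u. indicator unit_box u *\<^sub>R (Phi p u * iexp (- (2 * pi * (u \<bullet> s)))))"
    and "(CLINT u|lborel. indicator unit_box u *\<^sub>R (Phi p u * iexp (- (2 * pi * (u \<bullet> s))))) =
      of_real (exp (p \<bullet> s) * measure M {\<omega> \<in> space M. Y \<omega> = s})"
proof -
  interpret pair_sigma_finite M "lborel :: (real \<times> real) measure" ..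
  define f where "f = (\<lambda>(\<omega>, u). complex_of_real (exp (p \<bullet> Y \<omega>)) * (indicator unit_box u *\<^sub>R iexp (2 * pi * (u \<bullet> (Y \<omega> - s)))))"
  have [measurable]: "f \<in> borel_measurable (M \<Otimes>\<^sub>M lborel)"
    unfolding f_def by measurable
  have nf: "norm (f (\<omega>, u)) = exp (p \<bullet> Y \<omega>) * indicator unit_box u" for \<omega> u
    by (auto simp: f_def norm_mult indicator_def)
  have ib: "integrable lborel (indicator unit_box :: real \<times> real \<Rightarrow> real)"
    by (simp add: emeasure_unit_box)
  have fint: "integrable lborel (\<lambda>u. f (\<omega>, u))" if "\<omega> \<in> space M" for \<omega>
    by (rule Bochner_Integration.integrable_bound[OF integrable_mult_right[OF ib, of "exp (p \<bullet> Y \<omega>)"]])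
      (use that in \<open>auto simp: nf\<close>)
  have i: "integrable (M \<Otimes>\<^sub>M lborel) f"
  proof (rule Fubini_integrable)
    have "(\<integral>u. norm (f (\<omega>, u)) \<partial>lborel) = exp (p \<bullet> Y \<omega>)" for \<omega>
      unfolding nf by (simp add: measure_def emeasure_unit_box)
    then show "integrable M (\<lambda>\<omega>. \<integral>u. norm (f (\<omega>, u)) \<partial>lborel)"
      using p by (simp add: dom_iff)
    show "AE \<omega> in M. integrable lborel (\<lambda>u. f (\<omega>, u))" using fint by auto
  qed measurable
  have inner: "(CLINT \<omega>|M. f (\<omega>, u)) = indicator unit_box u *\<^sub>R (Phi p u * iexp (- (2 * pi * (u \<bullet> s))))" for u
  proof -
    have "f (\<omega>, u) = indicator unit_box u *\<^sub>R (iexp (- (2 * pi * (u \<bullet> s))) * (complex_of_real (exp (p \<bullet> Y \<omega>)) * iexp (2 * pi * (u \<bullet> Y \<omega>))))" for \<omega>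
    proof -
      have "iexp (2 * pi * (u \<bullet> (Y \<omega> - s))) = iexp (- (2 * pi * (u \<bullet> s))) * iexp (2 * pi * (u \<bullet> Y \<omega>))"
        unfolding exp_add[symmetric] by (simp add: inner_diff_right algebra_simps)
      then show ?thesis by (simp add: f_def)
    qed
    then show ?thesis
      unfolding Phi_def by (simp only: integral_scaleR_right integral_mult_right_zero mult.commute)
  qed
  have "integrable lborel (\<lambda>u. CLINT \<omega>|M. f (\<omega>, u))"
    using integrable_snd[of "\<lambda>\<omega> u. f (\<omega>, u)"] i by simp
  then show "integrable lborel (\<lambda>u. indicator unit_box u *\<^sub>R (Phi p u * iexp (- (2 * pi * (u \<bullet> s)))))"
    unfolding inner .
  have "(CLINT u|lborel. CLINT \<omega>|M. f (\<omega>, u)) = (CLINT \<omega>|M. CLINT u|lborel. f (\<omega>, u))"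
    using Fubini_integral[of "\<lambda>\<omega> u. f (\<omega>, u)"] i by simp
  also have "\<dots> = (CLINT \<omega>|M. indicator {\<omega> \<in> space M. Y \<omega> = s} \<omega> *\<^sub>R complex_of_real (exp (p \<bullet> s)))"
  proof (rule integral_cong_AE)
    show "AE \<omega> in M. (CLINT u|lborel. f (\<omega>, u)) = indicator {\<omega> \<in> space M. Y \<omega> = s} \<omega> *\<^sub>R complex_of_real (exp (p \<bullet> s))"
      using lat AE_space
    proof eventually_elim
      case (elim \<omega>)
      have "Y \<omega> - s \<in> \<int> \<times> \<int>" using elim(1) s by (auto simp: mem_Times_iff)
      then have "(CLINT u|lborel. f (\<omega>, u)) = complex_of_real (exp (p \<bullet> Y \<omega>)) * (if Y \<omega> - s = 0 then 1 else 0)"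
        unfolding f_def prod.case integral_mult_right_zero by (simp only: iexp_integral_unit_box)
      then show ?case using elim(2) by auto
    qed
  qed measurable
  also have "\<dots> = of_real (exp (p \<bullet> s) * measure M {\<omega> \<in> space M. Y \<omega> = s})"
  proof -
    have "{\<omega> \<in> space M. Y \<omega> = s} \<in> sets M" by measurable
    then have "has_bochner_integral M (\<lambda>\<omega>. indicator {\<omega> \<in> space M. Y \<omega> = s} \<omega> *\<^sub>R complex_of_real (exp (p \<bullet> s)))
        (measure M {\<omega> \<in> space M. Y \<omega> = s} *\<^sub>R complex_of_real (exp (p \<bullet> s)))"
      by (rule has_bochner_integral_indicator) (simp add: less_top[symmetric])
    then show ?thesis by (simp add: has_bochner_integral_integral_eq scaleR_conv_of_real mult.commute)
  qed
  finally show "(CLINT u|lborel. indicator unit_box u *\<^sub>R (Phi p u * iexp (- (2 * pi * (u \<bullet> s))))) =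
      of_real (exp (p \<bullet> s) * measure M {\<omega> \<in> space M. Y \<omega> = s})"
    unfolding inner .
qed

locale delayed_walk = lattice_step M xi \<delta> for M :: "'a measure" and xi and \<delta> +
  fixes X :: "nat \<Rightarrow> 'a \<Rightarrow> real \<times> real"
  assumes indep: "indep_vars (\<lambda>_. borel) X {1..}"
    and ident: "\<And>k. k \<ge> 2 \<Longrightarrow> distr M borel (X k) = distr M borel xi"
    and first_lattice: "AE \<omega> in M. X 1 \<omega> \<in> \<int> \<times> \<int>"
    and first_fst_nonneg: "AE \<omega> in M. fst (X 1 \<omega>) \<ge> 0"
begin

lemma X_measurable: "k \<ge> 1 \<Longrightarrow> X k \<in> borel_measurable M"
  using indep unfolding indep_vars_def by auto

sublocale first: random_vector M "X 1"
  by unfold_locales (simp add: X_measurable)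

lemma walk_random_vector: "random_vector M (walk X n)"
  by unfold_locales (auto simp: walk_def[abs_def] intro!: borel_measurable_sum X_measurable)

lemma AE_X_iff:
  assumes "k \<ge> 2" "Measurable.pred borel P"
  shows "(AE \<omega> in M. P (X k \<omega>)) \<longleftrightarrow> (AE \<omega> in M. P (xi \<omega>))"
proof -
  have "(AE \<omega> in M. P (X k \<omega>)) \<longleftrightarrow> (AE y in distr M borel (X k). P y)"
    using assms X_measurable[of k] by (subst AE_distr_iff) (auto simp: pred_def)
  also have "\<dots> \<longleftrightarrow> (AE \<omega> in M. P (xi \<omega>))"
    unfolding ident[OF assms(1)] using assms(2) by (subst AE_distr_iff) (auto simp: pred_def)
  finally show ?thesis .
qed

lemma (in -) lattice_pred: "Measurable.pred borel (\<lambda>y::real \<times> real. y \<in> \<int> \<times> \<int>)"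
proof -
  have "closed (\<int> \<times> \<int> :: (real \<times> real) set)" by (intro closed_Times closed_Ints)
  then show ?thesis by (simp add: pred_def)
qed

lemma walk_lattice: "AE \<omega> in M. walk X n \<omega> \<in> \<int> \<times> \<int>"
proof -
  have "AE \<omega> in M. X k \<omega> \<in> \<int> \<times> \<int>" if "k \<in> {1..n}" for k
    using first_lattice AE_X_iff[OF _ lattice_pred, of k] AE_lattice that by (cases "k = 1") auto
  then have "AE \<omega> in M. \<forall>k\<in>{1..n}. X k \<omega> \<in> \<int> \<times> \<int>"
    by (intro AE_finite_allI) auto
  then show ?thesis
  proof eventually_elim
    case (elim \<omega>)
    then show ?case by (auto simp: walk_def mem_Times_iff fst_sum snd_sum intro!: Ints_sum)
  qed
qed

lemma integral_X:
  fixes g :: "real \<times> real \<Rightarrow> 'b :: {banach, second_countable_topology}"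
  assumes "k \<ge> 2" "g \<in> borel_measurable borel"
  shows "(LINT \<omega>|M. g (X k \<omega>)) = (LINT \<omega>|M. g (xi \<omega>))"
    and "integrable M (\<lambda>\<omega>. g (X k \<omega>)) \<longleftrightarrow> integrable M (\<lambda>\<omega>. g (xi \<omega>))"
proof -
  have X: "X k \<in> borel_measurable M" using X_measurable[of k] assms(1) by simp
  show "(LINT \<omega>|M. g (X k \<omega>)) = (LINT \<omega>|M. g (xi \<omega>))"
    using integral_distr[OF X assms(2)] integral_distr[OF Y_measurable assms(2)] ident[OF assms(1)] by simp
  show "integrable M (\<lambda>\<omega>. g (X k \<omega>)) \<longleftrightarrow> integrable M (\<lambda>\<omega>. g (xi \<omega>))"
    using integrable_distr_eq[OF X assms(2)] integrable_distr_eq[OF Y_measurable assms(2)] ident[OF assms(1)] by simp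
qed

lemma walk_product:
  fixes g :: "real \<times> real \<Rightarrow> 'b :: {real_normed_field, banach, second_countable_topology}"
  assumes g: "g \<in> borel_measurable borel" and mult: "\<And>x y. g (x + y) = g x * g y" "g 0 = 1"
    and i1: "integrable M (\<lambda>\<omega>. g (X 1 \<omega>))" and i: "integrable M (\<lambda>\<omega>. g (xi \<omega>))"
  shows "integrable M (\<lambda>\<omega>. g (walk X (Suc j) \<omega>))"
    and "(LINT \<omega>|M. g (walk X (Suc j) \<omega>)) = (LINT \<omega>|M. g (X 1 \<omega>)) * (LINT \<omega>|M. g (xi \<omega>)) ^ j"
proof -
  have gsum: "g (\<Sum>k\<in>A. x k) = (\<Prod>k\<in>A. g (x k))" if "finite A" for A :: "nat set" and x
    using that by (induction A) (auto simp: mult)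
  have int: "integrable M (\<lambda>\<omega>. g (X k \<omega>))" if "k \<in> {1..Suc j}" for k
    using i1 i integral_X(2)[OF _ g, of k] that by (cases "k = 1") auto
  have "indep_vars (\<lambda>_. borel) X {1..Suc j}" using indep by (rule indep_vars_subset) auto
  then have ind: "indep_vars (\<lambda>_. borel) (\<lambda>k \<omega>. g (X k \<omega>)) {1..Suc j}"
    using g by (rule indep_vars_compose2)
  have eq: "g (walk X (Suc j) \<omega>) = (\<Prod>k\<in>{1..Suc j}. g (X k \<omega>))" for \<omega>
    unfolding walk_def by (rule gsum) simp
  show "integrable M (\<lambda>\<omega>. g (walk X (Suc j) \<omega>))"
    unfolding eq by (rule indep_vars_integrable[OF _ ind int]) auto
  have "(LINT \<omega>|M. g (walk X (Suc j) \<omega>)) = (\<Prod>k\<in>{1..Suc j}. LINT \<omega>|M. g (X k \<omega>))"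
    unfolding eq by (rule indep_vars_lebesgue_integral[OF _ ind int]) auto
  also have "{1..Suc j} = insert 1 {2..Suc j}" by auto
  also have "(\<Prod>k\<in>insert 1 {2..Suc j}. LINT \<omega>|M. g (X k \<omega>)) = (LINT \<omega>|M. g (X 1 \<omega>)) * (\<Prod>k\<in>{2..Suc j}. LINT \<omega>|M. g (X k \<omega>))"
    by (subst prod.insert) auto
  also have "(\<Prod>k\<in>{2..Suc j}. LINT \<omega>|M. g (X k \<omega>)) = (\<Prod>k\<in>{2..Suc j}. LINT \<omega>|M. g (xi \<omega>))"
    by (intro prod.cong refl integral_X(1) g) auto
  finally show "(LINT \<omega>|M. g (walk X (Suc j) \<omega>)) = (LINT \<omega>|M. g (X 1 \<omega>)) * (LINT \<omega>|M. g (xi \<omega>)) ^ j"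
    by simp
qed

lemma walk_dom:
  assumes "p \<in> dom" "p \<in> first.dom"
  shows "p \<in> psi_dom M (walk X (Suc j))"
  unfolding random_vector.dom_iff[OF walk_random_vector]
  using assms unfolding dom_iff first.dom_iff
  by (intro walk_product(1)) (auto simp: inner_add_right exp_add)

lemma walk_Phi:
  assumes "p \<in> dom" "p \<in> first.dom"
  shows "random_vector.Phi M (walk X (Suc j)) p u = first.Phi p u * Phi p u ^ j"
  unfolding random_vector.Phi_def[OF walk_random_vector] first.Phi_def Phi_def
proof (rule walk_product(2)[where g = "\<lambda>y. complex_of_real (exp (p \<bullet> y)) * iexp (2 * pi * (u \<bullet> y))"])
  show "integrable M (\<lambda>\<omega>. complex_of_real (exp (p \<bullet> X 1 \<omega>)) * iexp (2 * pi * (u \<bullet> X 1 \<omega>)))"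
    by (rule first.tilted_iexp_integrable[OF assms(2)])
  show "integrable M (\<lambda>\<omega>. complex_of_real (exp (p \<bullet> xi \<omega>)) * iexp (2 * pi * (u \<bullet> xi \<omega>)))"
    by (rule tilted_iexp_integrable[OF assms(1)])
qed (auto simp: inner_add_right exp_add algebra_simps)

definition local_prob :: "nat \<Rightarrow> real \<times> real \<Rightarrow> real" where
  "local_prob j s = measure M {\<omega> \<in> space M. walk X (Suc j) \<omega> = s}"

lemma local_prob_fourier:
  assumes "p \<in> dom" "p \<in> first.dom" "s \<in> \<int> \<times> \<int>"
  shows "integrable lborel (\<lambda>u. indicator unit_box u *\<^sub>R (first.Phi p u * Phi p u ^ j * iexp (- (2 * pi * (u \<bullet> s)))))"
    and "(CLINT u|lborel. indicator unit_box u *\<^sub>R (first.Phi p u * Phi p u ^ j * iexp (- (2 * pi * (u \<bullet> s))))) =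
      of_real (exp (p \<bullet> s) * local_prob j s)"
  using random_vector.lattice_inversion[OF walk_random_vector walk_lattice walk_dom[OF assms(1,2)] assms(3), of j]
  unfolding walk_Phi[OF assms(1,2)] local_prob_def by blast+

end

section \<open>The local limit theorem\<close>

lemma gaussian_norm_integral:
  fixes a :: real
  assumes a: "a > 0"
  shows "integrable lborel (\<lambda>u::real \<times> real. exp (- (a * (norm u)\<^sup>2)))" (is "integrable _ ?f")
    and "(\<integral>u. exp (- (a * (norm u)\<^sup>2)) \<partial>(lborel :: (real \<times> real) measure)) = pi / a"
proof -
  have q: "quad (2 * a) 0 (2 * a) u / 2 = a * (norm u)\<^sup>2" for u
    by (simp add: quad_def norm_prod_def algebra_simps)
  have q0: "quad (2 * a) (- 0) (2 * a) 0 = 0" "quad (2 * a) 0 (2 * a) 0 = 0" by (simp_all add: quad_def)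
  have i: "integrable lborel (\<lambda>u::real \<times> real. complex_of_real (exp (- (a * (norm u)\<^sup>2))))"
    using gaussian_char2(1)[of "2 * a" "2 * a" 0 0] a by (simp add: q)
  then show "integrable lborel ?f" by (simp only: complex_of_real_integrable_eq)
  have "complex_of_real (integral\<^sup>L lborel ?f) = of_real (pi / a)"
    using gaussian_char2(2)[of "2 * a" "2 * a" 0 0] a
    by (simp add: q q0 real_sqrt_mult flip: integral_complex_of_real)
  then show "integral\<^sup>L lborel ?f = pi / a" by (simp only: of_real_eq_iff)
qed

lemma unit_box_norm_le: "u \<in> unit_box \<Longrightarrow> (norm u)\<^sup>2 \<le> 1 / 2"
proof -
  assume u: "u \<in> unit_box"
  have "(fst u)\<^sup>2 \<le> (1 / 2)\<^sup>2" "(snd u)\<^sup>2 \<le> (1 / 2)\<^sup>2"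
    using u by (auto simp: unit_box_def mem_Times_iff abs_le_iff intro!: abs_le_square_iff[THEN iffD1])
  then show ?thesis by (simp add: norm_prod_def power2_eq_square)
qed

context delayed_walk
begin

lemma local_prob_upper:
  assumes R: "R > 0"
  obtains K where "K > 0"
    "\<And>p s j. p \<in> dom \<Longrightarrow> p \<in> first.dom \<Longrightarrow> norm p \<le> R \<Longrightarrow> mgf p \<le> 2 \<Longrightarrow> s \<in> \<int> \<times> \<int> \<Longrightarrow>
      exp (p \<bullet> s) * local_prob j s \<le> K * first.mgf p * mgf p ^ j / real (Suc j)"
proof -
  obtain c where c: "c > 0"
    "\<And>p u. p \<in> dom \<Longrightarrow> norm p \<le> R \<Longrightarrow> u \<in> {-1/2..1/2} \<times> {-1/2..1/2} \<Longrightarrow> norm (Phi p u) \<le> mgf p - c * (norm u)\<^sup>2"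
    using Phi_decay[OF R] by blast
  define a where "a = c / 2"
  have a: "a > 0" using c by (simp add: a_def)
  define K where "K = exp a * (pi / a)"
  have "exp (p \<bullet> s) * local_prob j s \<le> K * first.mgf p * mgf p ^ j / real (Suc j)"
    if p: "p \<in> dom" "p \<in> first.dom" "norm p \<le> R" "mgf p \<le> 2" and s: "s \<in> \<int> \<times> \<int>" for p s j
  proof -
    have pos: "mgf p > 0" "first.mgf p > 0" using mgf_pos first.mgf_pos p by auto
    define f where "f u = indicator unit_box u *\<^sub>R (first.Phi p u * Phi p u ^ j * iexp (- (2 * pi * (u \<bullet> s))))" for u
    define g where "g u = first.mgf p * mgf p ^ j * exp a * exp (- (a * real (Suc j) * (norm u)\<^sup>2))" for u :: "real \<times> real"
    have aj: "a * real (Suc j) > 0" using a by simp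
    have g: "integrable lborel g" "integral\<^sup>L lborel g = first.mgf p * mgf p ^ j * exp a * (pi / (a * real (Suc j)))"
      unfolding g_def using gaussian_norm_integral[OF aj] by auto
    have fg: "norm (f u) \<le> g u" for u
    proof (cases "u \<in> unit_box")
      case True
      have "norm (Phi p u) \<le> mgf p - c * (norm u)\<^sup>2" using p True by (intro c(2)) (auto simp: unit_box_def)
      also have "\<dots> \<le> mgf p * (1 - a * (norm u)\<^sup>2)"
      proof -
        have "mgf p * (a * (norm u)\<^sup>2) \<le> 2 * (a * (norm u)\<^sup>2)" using p(4) a by (intro mult_right_mono) auto
        then show ?thesis by (simp add: a_def right_diff_distrib)
      qed
      also have "\<dots> \<le> mgf p * exp (- (a * (norm u)\<^sup>2))"
        using pos exp_ge_add_one_self[of "- (a * (norm u)\<^sup>2)"] by (intro mult_left_mono) auto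
      finally have "norm (Phi p u) ^ j \<le> (mgf p * exp (- (a * (norm u)\<^sup>2))) ^ j" by (rule power_mono) simp
      also have "\<dots> = mgf p ^ j * exp (- (a * real j * (norm u)\<^sup>2))"
        by (simp add: power_mult_distrib exp_of_nat_mult[symmetric] mult_ac)
      also have "\<dots> \<le> mgf p ^ j * (exp a * exp (- (a * real (Suc j) * (norm u)\<^sup>2)))"
      proof -
        have "a * (norm u)\<^sup>2 \<le> a * 1" using unit_box_norm_le[OF True] a by (intro mult_left_mono) auto
        then have "exp (- (a * real j * (norm u)\<^sup>2)) \<le> exp a * exp (- (a * real (Suc j) * (norm u)\<^sup>2))"
          unfolding mult_exp_exp by (simp add: algebra_simps)
        then show ?thesis using pos by (intro mult_left_mono) auto
      qed
      finally have "norm (Phi p u) ^ j \<le> mgf p ^ j * (exp a * exp (- (a * real (Suc j) * (norm u)\<^sup>2)))" .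
      then have "norm (first.Phi p u) * norm (Phi p u) ^ j \<le> first.mgf p * (mgf p ^ j * (exp a * exp (- (a * real (Suc j) * (norm u)\<^sup>2))))"
        using first.norm_Phi_le[of p u] pos by (intro mult_mono) auto
      then show ?thesis using True by (simp add: f_def g_def norm_mult norm_power mult_ac)
    next
      case False
      then show ?thesis using pos by (simp add: f_def g_def)
    qed
    have int: "integrable lborel f" unfolding f_def using local_prob_fourier(1)[OF p(1,2) s] .
    have "norm (complex_of_real (exp (p \<bullet> s) * local_prob j s)) = norm (integral\<^sup>L lborel f)"
      unfolding f_def local_prob_fourier(2)[OF p(1,2) s] ..
    also have "\<dots> \<le> integral\<^sup>L lborel g"
      by (rule Bochner_Integration.integral_norm_bound_integral[OF int g(1) fg])
    finally have "exp (p \<bullet> s) * local_prob j s \<le> integral\<^sup>L lborel g"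
      unfolding norm_of_real by (rule abs_le_D1)
    also have "\<dots> = K * first.mgf p * mgf p ^ j / real (Suc j)"
      unfolding g(2) K_def using a by (simp add: divide_simps)
    finally show ?thesis .
  qed
  then show ?thesis using that[of K] a by (auto simp: K_def)
qed

end

context random_vector
begin

lemma tilted_dominated:
  assumes p: "p \<in> interior dom" and P: "P \<longlonglongrightarrow> p"
  obtains e where "e > 0" "integrable M (\<lambda>\<omega>. exp (p \<bullet> Y \<omega> + e * norm (Y \<omega>)))"
    "\<forall>\<^sub>F k in sequentially. \<forall>y. exp (P k \<bullet> y) \<le> exp (p \<bullet> y + e * norm y)"
    "\<And>g. subexp g \<Longrightarrow> integrable M (\<lambda>\<omega>. g (Y \<omega>) * exp (p \<bullet> Y \<omega> + e * norm (Y \<omega>)))"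
proof -
  obtain e where e: "e > 0" "integrable M (\<lambda>\<omega>. exp (p \<bullet> Y \<omega> + e * norm (Y \<omega>)))"
    using interior_exp_norm[OF p] .
  have "\<forall>\<^sub>F k in sequentially. dist (P k) p < e / 2" using P e(1) by (intro tendstoD) auto
  then have ev: "\<forall>\<^sub>F k in sequentially. \<forall>y. exp (P k \<bullet> y) \<le> exp (p \<bullet> y + e / 2 * norm y)"
  proof eventually_elim
    case (elim k)
    show ?case
    proof
      fix y
      have "(P k - p) \<bullet> y \<le> norm (P k - p) * norm y" by (rule norm_cauchy_schwarz)
      also have "\<dots> \<le> e / 2 * norm y" using elim by (intro mult_right_mono) (auto simp: dist_norm)
      finally show "exp (P k \<bullet> y) \<le> exp (p \<bullet> y + e / 2 * norm y)" by (simp add: inner_diff_left)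
    qed
  qed
  have i: "integrable M (\<lambda>\<omega>. g (Y \<omega>) * exp (p \<bullet> Y \<omega> + e / 2 * norm (Y \<omega>)))" if "subexp g" for g
    using tilt_integrable[OF e(2), of p "e / 2" g] that e(1) by simp
  show ?thesis
    by (rule that[of "e / 2"]) (use e(1) ev i i[of "\<lambda>_. 1"] in auto)
qed

lemma Phi_tendsto:
  assumes p: "p \<in> interior dom" and P: "P \<longlonglongrightarrow> p" and u: "u \<longlonglongrightarrow> 0"
  shows "(\<lambda>k. Phi (P k) (u k)) \<longlonglongrightarrow> of_real (mgf p)"
proof -
  obtain e where e: "integrable M (\<lambda>\<omega>. exp (p \<bullet> Y \<omega> + e * norm (Y \<omega>)))"
    "\<forall>\<^sub>F k in sequentially. \<forall>y. exp (P k \<bullet> y) \<le> exp (p \<bullet> y + e * norm y)"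
    using tilted_dominated[OF p P] by blast
  obtain k0 where k0: "\<And>k y. k \<ge> k0 \<Longrightarrow> exp (P k \<bullet> y) \<le> exp (p \<bullet> y + e * norm y)"
    using e(2) unfolding eventually_sequentially by blast
  have "(\<lambda>k. Phi (P (k + k0)) (u (k + k0))) \<longlonglongrightarrow> (CLINT \<omega>|M. complex_of_real (exp (p \<bullet> Y \<omega>)) * iexp (2 * pi * (0 \<bullet> Y \<omega>)))"
    unfolding Phi_def
  proof (rule integral_dominated_convergence[OF _ _ e(1)])
    show "AE \<omega> in M. (\<lambda>k. complex_of_real (exp (P (k + k0) \<bullet> Y \<omega>)) * iexp (2 * pi * (u (k + k0) \<bullet> Y \<omega>)))
        \<longlonglongrightarrow> complex_of_real (exp (p \<bullet> Y \<omega>)) * iexp (2 * pi * (0 \<bullet> Y \<omega>))"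
      by (intro AE_I2 tendsto_intros LIMSEQ_ignore_initial_segment P u)
    show "AE \<omega> in M. norm (complex_of_real (exp (P (k + k0) \<bullet> Y \<omega>)) * iexp (2 * pi * (u (k + k0) \<bullet> Y \<omega>))) \<le> exp (p \<bullet> Y \<omega> + e * norm (Y \<omega>))" for k
      using k0[of "k + k0"] by (auto simp: norm_mult)
  qed measurable
  from LIMSEQ_offset[OF this] show ?thesis
    by (simp add: mom_def flip: integral_complex_of_real)
qed

end

lemma power_tendsto_exp:
  fixes a :: "nat \<Rightarrow> complex"
  assumes J: "filterlim J at_top sequentially" and a: "\<And>k. norm (a k) \<le> 1"
    and lim: "(\<lambda>k. real (J k) *\<^sub>R (a k - 1)) \<longlonglongrightarrow> of_real (- t)" and t: "t \<ge> 0"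
  shows "(\<lambda>k. a k ^ J k) \<longlonglongrightarrow> of_real (exp (- t))"
proof -
  have Jr: "filterlim (\<lambda>k. real (J k)) at_top sequentially"
    using J by (rule filterlim_compose[OF filterlim_real_sequentially])
  have pos: "\<forall>\<^sub>F k in sequentially. J k > 0" using J[unfolded filterlim_at_top, rule_format, of 1] by eventually_elim simp
  define b where "b k = exp (- t / real (J k))" for k
  have diff: "(\<lambda>k. a k ^ J k - of_real (exp (- t))) \<longlonglongrightarrow> 0"
  proof (rule Lim_null_comparison)
    show "\<forall>\<^sub>F k in sequentially. norm (a k ^ J k - of_real (exp (- t)))
      \<le> norm (real (J k) *\<^sub>R (a k - 1) - of_real (- t)) + t\<^sup>2 * exp t / real (J k)"
      using pos
    proof eventually_elim
      case (elim k)
      have "complex_of_real (exp (- t)) = of_real (b k) ^ J k"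
        using elim by (simp add: b_def exp_of_nat_mult[symmetric] flip: of_real_power)
      then have "norm (a k ^ J k - of_real (exp (- t))) = norm (a k ^ J k - of_real (b k) ^ J k)" by simp
      also have "\<dots> \<le> real (J k) * norm (a k - of_real (b k))"
        using a t by (intro norm_power_diff) (auto simp: b_def)
      also have "\<dots> = norm (real (J k) *\<^sub>R (a k - of_real (b k)))" by simp
      also have "real (J k) *\<^sub>R (a k - of_real (b k)) = (real (J k) *\<^sub>R (a k - 1) - of_real (- t)) - of_real (real (J k) * (b k - 1 + t / real (J k)))"
        using elim by (simp add: scaleR_conv_of_real algebra_simps)
      also have "norm \<dots> \<le> norm (real (J k) *\<^sub>R (a k - 1) - of_real (- t)) + norm (of_real (real (J k) * (b k - 1 + t / real (J k))) :: complex)"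
        by (rule norm_triangle_ineq4)
      also have "norm (of_real (real (J k) * (b k - 1 + t / real (J k))) :: complex) \<le> t\<^sup>2 * exp t / real (J k)"
      proof -
        have "\<bar>b k - 1 + t / real (J k)\<bar> \<le> (t / real (J k))\<^sup>2 * exp \<bar>t / real (J k)\<bar>"
          using exp_second_order[of "- t / real (J k)"] by (simp add: b_def)
        also have "\<dots> \<le> (t / real (J k))\<^sup>2 * exp t"
          using t elim by (intro mult_left_mono) (auto simp: divide_le_eq mult_le_cancel_left1)
        finally have "real (J k) * \<bar>b k - 1 + t / real (J k)\<bar> \<le> real (J k) * ((t / real (J k))\<^sup>2 * exp t)"
          by (intro mult_left_mono) auto
        also have "\<dots> = t\<^sup>2 * exp t / real (J k)" using elim by (simp add: power2_eq_square)
        finally show ?thesis unfolding norm_of_real abs_mult by simp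
      qed
      finally show ?case by simp
    qed
    have "(\<lambda>k. norm (real (J k) *\<^sub>R (a k - 1) - of_real (- t)) + t\<^sup>2 * exp t / real (J k)) \<longlonglongrightarrow> norm (of_real (- t) - of_real (- t) :: complex) + 0"
      by (intro tendsto_add tendsto_norm tendsto_diff lim tendsto_const tendsto_divide_0[OF tendsto_const] filterlim_at_top_imp_at_infinity Jr)
    then show "(\<lambda>k. norm (real (J k) *\<^sub>R (a k - 1) - of_real (- t)) + t\<^sup>2 * exp t / real (J k)) \<longlonglongrightarrow> 0" by simp
  qed
  then show ?thesis by (simp add: LIM_zero_iff)
qed

lemma integral_dominated_convergence_eventually:
  fixes f :: "'a \<Rightarrow> 'b :: {banach, second_countable_topology}" and w :: "'a \<Rightarrow> real"
  assumes "f \<in> borel_measurable M" "\<And>i. s i \<in> borel_measurable M" "integrable M w"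
    and lim: "AE x in M. (\<lambda>i. s i x) \<longlonglongrightarrow> f x"
    and bound: "\<forall>\<^sub>F i in sequentially. AE x in M. norm (s i x) \<le> w x"
  shows "(\<lambda>i. integral\<^sup>L M (s i)) \<longlonglongrightarrow> integral\<^sup>L M f" and "integrable M f"
proof -
  obtain k where k: "\<And>i. i \<ge> k \<Longrightarrow> AE x in M. norm (s i x) \<le> w x"
    using bound unfolding eventually_sequentially by blast
  have l: "AE x in M. (\<lambda>i. s (i + k) x) \<longlonglongrightarrow> f x"
    using lim by eventually_elim (rule LIMSEQ_ignore_initial_segment)
  have b: "AE x in M. norm (s (i + k) x) \<le> w x" for i by (rule k) simp
  have "(\<lambda>i. integral\<^sup>L M (s (i + k))) \<longlonglongrightarrow> integral\<^sup>L M f"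
    by (rule integral_dominated_convergence[OF assms(1) _ assms(3) l b]) (rule assms(2))
  then show "(\<lambda>i. integral\<^sup>L M (s i)) \<longlonglongrightarrow> integral\<^sup>L M f" by (rule LIMSEQ_offset)
  show "integrable M f"
    by (rule integrable_dominated_convergence[OF assms(1) _ assms(3) l b]) (rule assms(2))
qed

lemma lborel_integral_scale:
  fixes f :: "real \<times> real \<Rightarrow> complex"
  assumes c: "c > 0" and f: "f \<in> borel_measurable borel"
  shows "(CLINT u|lborel. f u) = of_real (c\<^sup>2) * (CLINT w|lborel. f (c *\<^sub>R w))"
proof -
  have "(lborel :: (real \<times> real) measure) = density (distr lborel borel (\<lambda>x. c *\<^sub>R x)) (\<lambda>_. ennreal (c\<^sup>2))"
    using c by (subst lborel_affine[of c 0]) (auto simp: power2_eq_square)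
  then have "(CLINT u|lborel. f u) = (CLINT u|density (distr lborel borel (\<lambda>x. c *\<^sub>R x)) (\<lambda>_. ennreal (c\<^sup>2)). f u)"
    by (rule arg_cong)
  also have "\<dots> = (CLINT u|distr lborel borel (\<lambda>x. c *\<^sub>R x). c\<^sup>2 *\<^sub>R f u)"
    using f by (subst integral_density) auto
  also have "\<dots> = (CLINT w|lborel. c\<^sup>2 *\<^sub>R f (c *\<^sub>R w))"
    using f by (subst integral_distr) auto
  finally show ?thesis by (simp add: scaleR_conv_of_real)
qed

locale saddle_sequence = delayed_walk M xi \<delta> X
  for M :: "'a measure" and xi :: "'a \<Rightarrow> real \<times> real" and \<delta> :: real and X :: "nat \<Rightarrow> 'a \<Rightarrow> real \<times> real" +
  fixes N :: "nat \<Rightarrow> nat" and P S :: "nat \<Rightarrow> real \<times> real" and p :: "real \<times> real"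
    and r :: "nat \<Rightarrow> real" and \<rho> :: real
  assumes N_lim: "filterlim N at_top sequentially" and N_pos: "\<And>k. N k > 0"
    and P_lim: "P \<longlonglongrightarrow> p" and p_interior: "p \<in> interior dom" "p \<in> interior first.dom"
    and P_interior: "\<And>k. P k \<in> interior dom" "\<And>k. P k \<in> interior first.dom"
    and mgf_P: "\<And>k. mgf (P k) = 1"
    and r_lim: "r \<longlonglongrightarrow> \<rho>" and rho_pos: "\<rho> > 0"
    and S_lattice: "\<And>k. S k \<in> \<int> \<times> \<int>" and S_eq: "\<And>k. S k = (real (N k) * r k) *\<^sub>R mean (P k)"
begin

lemma P_dom: "P k \<in> dom" "P k \<in> first.dom"
  using P_interior interior_subset by blast+

definition rt :: "nat \<Rightarrow> real" where "rt k = sqrt (real (N k))"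

lemma rt_pos: "rt k > 0"
  using N_pos by (simp add: rt_def)

lemma rt_square: "(rt k)\<^sup>2 = real (N k)"
  by (simp add: rt_def)

lemma rt_lim: "filterlim rt at_top sequentially"
  unfolding rt_def[abs_def]
  using N_lim by (intro filterlim_compose[OF sqrt_at_top] filterlim_compose[OF filterlim_real_sequentially])

lemma over_rt_lim: "(\<lambda>k. c / rt k) \<longlonglongrightarrow> 0"
  by (intro tendsto_divide_0[OF tendsto_const] filterlim_at_top_imp_at_infinity rt_lim)

lemma mgf_p: "mgf p = 1"
proof -
  have "(\<lambda>k. mgf (P k)) \<longlonglongrightarrow> mgf p"
    using isCont_tendsto_compose[OF mom_isCont[OF p_interior(1)] P_lim] by simp
  from LIMSEQ_unique[OF this[unfolded mgf_P] tendsto_const] show ?thesis .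
qed

lemma mean_lim: "(\<lambda>k. mean (P k)) \<longlonglongrightarrow> mean p"
  using mean_has_derivative[OF p_interior(1)] has_derivative_continuous P_lim isCont_tendsto_compose by blast

definition cov :: "real \<times> real \<Rightarrow> real" where
  "cov = quad (cv fst fst p) (cv fst snd p) (cv snd snd p)"

lemma cov_nonneg: "cov w \<ge> 0"
  using tilted_variance_pos[OF p_interior(1), of "fst w" "snd w"]
  by (cases "w = 0") (auto simp: cov_def quad_def prod_eq_iff mult_ac less_imp_le)

definition centred :: "nat \<Rightarrow> real \<times> real \<Rightarrow> complex" where
  "centred k w = Phi (P k) (w /\<^sub>R rt k) * iexp (- (2 * pi * ((w /\<^sub>R rt k) \<bullet> mean (P k))))"

lemma centred_second_order: "(\<lambda>k. real (N k) *\<^sub>R (centred k w - 1)) \<longlonglongrightarrow> of_real (- (2 * pi\<^sup>2 * cov w))"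
proof -
  define x where "x k \<omega> = 2 * pi * (w \<bullet> (xi \<omega> - mean (P k)))" for k \<omega>
  define f where "f k \<omega> = complex_of_real (exp (P k \<bullet> xi \<omega>)) * (real (N k) *\<^sub>R (iexp (x k \<omega> / rt k) - 1 - \<i> * of_real (x k \<omega> / rt k)))" for k \<omega>
  define f' where "f' \<omega> = complex_of_real (exp (p \<bullet> xi \<omega>)) * of_real (- ((2 * pi * (w \<bullet> (xi \<omega> - mean p)))\<^sup>2 / 2))" for \<omega>
  have xm [measurable]: "x k \<in> borel_measurable M" for k unfolding x_def by measurable
  have eq: "real (N k) *\<^sub>R (centred k w - 1) = (CLINT \<omega>|M. f k \<omega>)" for k
  proof -
    have I1: "integrable M (\<lambda>\<omega>. exp (P k \<bullet> xi \<omega>))" "integrable M (\<lambda>\<omega>. fst (xi \<omega>) * exp (P k \<bullet> xi \<omega>))"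
        "integrable M (\<lambda>\<omega>. snd (xi \<omega>) * exp (P k \<bullet> xi \<omega>))"
      using mom_integrable[OF P_interior(1), of "\<lambda>_. 1" k] mom_integrable[OF P_interior(1), of fst k]
        mom_integrable[OF P_interior(1), of snd k] by auto
    have Ii: "integrable M (\<lambda>\<omega>. complex_of_real (exp (P k \<bullet> xi \<omega>)) * iexp (x k \<omega> / rt k))"
      by (rule Bochner_Integration.integrable_bound[OF I1(1)]) (auto simp: norm_mult)
    define b1 b2 b0 where "b1 = 2 * pi * fst w / rt k" and "b2 = 2 * pi * snd w / rt k" and "b0 = 2 * pi * (w \<bullet> mean (P k)) / rt k"
    have lin: "exp (P k \<bullet> xi \<omega>) * (x k \<omega> / rt k) = b1 * (fst (xi \<omega>) * exp (P k \<bullet> xi \<omega>)) + b2 * (snd (xi \<omega>) * exp (P k \<bullet> xi \<omega>)) - b0 * exp (P k \<bullet> xi \<omega>)" for \<omega>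
      by (simp add: x_def b1_def b2_def b0_def inner_diff_right inner_real_pair[of w "xi \<omega>"] add_divide_distrib diff_divide_distrib algebra_simps)
    note J = integrable_mult_right[OF I1(2), of b1] integrable_mult_right[OF I1(3), of b2] integrable_mult_right[OF I1(1), of b0]
    have Ix: "integrable M (\<lambda>\<omega>. exp (P k \<bullet> xi \<omega>) * (x k \<omega> / rt k))"
      unfolding lin by (intro Bochner_Integration.integrable_diff Bochner_Integration.integrable_add J)
    have "(\<integral>\<omega>. exp (P k \<bullet> xi \<omega>) * (x k \<omega> / rt k) \<partial>M) = b1 * mom fst (P k) + b2 * mom snd (P k) - b0 * mgf (P k)"
      unfolding lin mom_def
      by (simp only: Bochner_Integration.integral_diff[OF Bochner_Integration.integrable_add[OF J(1,2)] J(3)]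
          Bochner_Integration.integral_add[OF J(1,2)] integral_mult_right_zero mult_1)
    also have "\<dots> = 0"
      by (simp add: mgf_P b1_def b2_def b0_def mean_def inner_real_pair add_divide_distrib algebra_simps)
    finally have zero: "(\<integral>\<omega>. exp (P k \<bullet> xi \<omega>) * (x k \<omega> / rt k) \<partial>M) = 0" .
    have "centred k w = (CLINT \<omega>|M. complex_of_real (exp (P k \<bullet> xi \<omega>)) * iexp (x k \<omega> / rt k))"
      unfolding centred_def Phi_def integral_mult_left_zero[symmetric]
    proof (intro Bochner_Integration.integral_cong refl)
      fix \<omega>
      have "iexp (2 * pi * ((w /\<^sub>R rt k) \<bullet> xi \<omega>)) * iexp (- (2 * pi * ((w /\<^sub>R rt k) \<bullet> mean (P k)))) = iexp (x k \<omega> / rt k)"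
        unfolding exp_add[symmetric] by (simp add: x_def inner_diff_right divide_inverse algebra_simps)
      then show "complex_of_real (exp (P k \<bullet> xi \<omega>)) * iexp (2 * pi * ((w /\<^sub>R rt k) \<bullet> xi \<omega>)) * iexp (- (2 * pi * ((w /\<^sub>R rt k) \<bullet> mean (P k))))
        = complex_of_real (exp (P k \<bullet> xi \<omega>)) * iexp (x k \<omega> / rt k)" by (simp only: mult.assoc)
    qed
    moreover have "(CLINT \<omega>|M. complex_of_real (exp (P k \<bullet> xi \<omega>))) = 1"
    proof -
      have "(CLINT \<omega>|M. complex_of_real (exp (P k \<bullet> xi \<omega>))) = of_real (mgf (P k))"
        by (simp add: mom_def flip: integral_complex_of_real)
      then show ?thesis by (simp only: mgf_P of_real_1)
    qed
    moreover have "(CLINT \<omega>|M. complex_of_real (exp (P k \<bullet> xi \<omega>) * (x k \<omega> / rt k)) * \<i>) = 0"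
      using zero by (simp only: integral_mult_left_zero integral_complex_of_real of_real_0 mult_zero_left)
    moreover have "(CLINT \<omega>|M. f k \<omega>) = real (N k) *\<^sub>R ((CLINT \<omega>|M. complex_of_real (exp (P k \<bullet> xi \<omega>)) * iexp (x k \<omega> / rt k)) - (CLINT \<omega>|M. complex_of_real (exp (P k \<bullet> xi \<omega>)))
        - (CLINT \<omega>|M. complex_of_real (exp (P k \<bullet> xi \<omega>) * (x k \<omega> / rt k)) * \<i>))"
    proof -
      have c1: "integrable M (\<lambda>\<omega>. complex_of_real (exp (P k \<bullet> xi \<omega>)))" using I1(1) by simp
      have c2: "integrable M (\<lambda>\<omega>. complex_of_real (exp (P k \<bullet> xi \<omega>) * (x k \<omega> / rt k)) * \<i>)"
        using Ix by (intro integrable_mult_left) (simp only: complex_of_real_integrable_eq)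
      have "f k \<omega> = real (N k) *\<^sub>R (complex_of_real (exp (P k \<bullet> xi \<omega>)) * iexp (x k \<omega> / rt k) - complex_of_real (exp (P k \<bullet> xi \<omega>))
        - complex_of_real (exp (P k \<bullet> xi \<omega>) * (x k \<omega> / rt k)) * \<i>)" for \<omega>
        by (simp add: f_def algebra_simps)
      then show ?thesis
        by (simp only: integral_scaleR_right Bochner_Integration.integral_diff[OF Bochner_Integration.integrable_diff[OF Ii c1] c2]
            Bochner_Integration.integral_diff[OF Ii c1])
    qed
    ultimately show ?thesis by simp
  qed
  obtain e where e: "e > 0" "integrable M (\<lambda>\<omega>. exp (p \<bullet> xi \<omega> + e * norm (xi \<omega>)))"
    "\<forall>\<^sub>F k in sequentially. \<forall>y. exp (P k \<bullet> y) \<le> exp (p \<bullet> y + e * norm y)"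
    "\<And>g. subexp g \<Longrightarrow> integrable M (\<lambda>\<omega>. g (xi \<omega>) * exp (p \<bullet> xi \<omega> + e * norm (xi \<omega>)))"
    by (rule tilted_dominated[OF p_interior(1) P_lim]) (rule that)
  define B where "B = norm (mean p) + 1"
  have evB: "\<forall>\<^sub>F k in sequentially. norm (mean (P k)) \<le> B"
    using order_tendstoD(2)[OF tendsto_norm[OF mean_lim], of B] by (auto simp: B_def elim: eventually_mono)
  have "(\<lambda>k. CLINT \<omega>|M. f k \<omega>) \<longlonglongrightarrow> (CLINT \<omega>|M. f' \<omega>)"
  proof (rule integral_dominated_convergence_eventually)
    show "f' \<in> borel_measurable M" unfolding f'_def by measurable
    show "f k \<in> borel_measurable M" for k unfolding f_def by measurable
    have "subexp (\<lambda>y. (2 * pi * norm w * (norm y + B))\<^sup>2 / 2)"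
      using subexp_mult[OF subexp_power[OF subexp_mult[OF subexp_const subexp_add[OF subexp_norm subexp_const]]] subexp_const, of "2 * pi * norm w" B 2 "1/2"] by simp
    then show "integrable M (\<lambda>\<omega>. (2 * pi * norm w * (norm (xi \<omega>) + B))\<^sup>2 / 2 * exp (p \<bullet> xi \<omega> + e * norm (xi \<omega>)))"
      by (rule e(4))
    show "\<forall>\<^sub>F k in sequentially. AE \<omega> in M. norm (f k \<omega>) \<le> (2 * pi * norm w * (norm (xi \<omega>) + B))\<^sup>2 / 2 * exp (p \<bullet> xi \<omega> + e * norm (xi \<omega>))"
      using e(3) evB
    proof eventually_elim
      case (elim k)
      show ?case
      proof (rule AE_I2)
        fix \<omega>
        have "\<bar>w \<bullet> (xi \<omega> - mean (P k))\<bar> \<le> norm w * norm (xi \<omega> - mean (P k))" by (rule Cauchy_Schwarz_ineq2)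
        also have "\<dots> \<le> norm w * (norm (xi \<omega>) + B)"
          using norm_triangle_ineq4[of "xi \<omega>" "mean (P k)"] elim(2) by (intro mult_left_mono) auto
        finally have "2 * pi * \<bar>w \<bullet> (xi \<omega> - mean (P k))\<bar> \<le> 2 * pi * (norm w * (norm (xi \<omega>) + B))" by (intro mult_left_mono) auto
        then have x: "\<bar>x k \<omega>\<bar> \<le> 2 * pi * norm w * (norm (xi \<omega>) + B)" by (simp add: x_def abs_mult mult.assoc)
        have "norm (iexp (x k \<omega> / rt k) - (\<Sum>j\<le>1. (\<i> * (x k \<omega> / rt k)) ^ j / fact j)) \<le> \<bar>x k \<omega> / rt k\<bar> ^ (Suc 1) / fact (Suc 1)"
          by (rule iexp_approx1)
        then have "norm (iexp (x k \<omega> / rt k) - 1 - \<i> * of_real (x k \<omega> / rt k)) \<le> (x k \<omega>)\<^sup>2 / real (N k) / 2"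
          by (simp add: diff_diff_eq power_divide rt_square numeral_2_eq_2[symmetric] del: of_real_divide)
        then have "real (N k) * norm (iexp (x k \<omega> / rt k) - 1 - \<i> * of_real (x k \<omega> / rt k)) \<le> real (N k) * ((x k \<omega>)\<^sup>2 / real (N k) / 2)"
          by (intro mult_left_mono) auto
        also have "\<dots> = (x k \<omega>)\<^sup>2 / 2" using N_pos[of k] by simp
        also have "\<dots> \<le> (2 * pi * norm w * (norm (xi \<omega>) + B))\<^sup>2 / 2"
          using power_mono[OF x, of 2] by simp
        finally have "real (N k) * norm (iexp (x k \<omega> / rt k) - 1 - \<i> * of_real (x k \<omega> / rt k)) \<le> (2 * pi * norm w * (norm (xi \<omega>) + B))\<^sup>2 / 2" .
        then have "exp (P k \<bullet> xi \<omega>) * (real (N k) * norm (iexp (x k \<omega> / rt k) - 1 - \<i> * of_real (x k \<omega> / rt k)))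
          \<le> exp (p \<bullet> xi \<omega> + e * norm (xi \<omega>)) * ((2 * pi * norm w * (norm (xi \<omega>) + B))\<^sup>2 / 2)"
          by (intro mult_mono elim(1)[rule_format]) auto
        then show "norm (f k \<omega>) \<le> (2 * pi * norm w * (norm (xi \<omega>) + B))\<^sup>2 / 2 * exp (p \<bullet> xi \<omega> + e * norm (xi \<omega>))"
          by (simp only: f_def norm_mult norm_scaleR norm_of_real abs_exp_cancel abs_of_nat mult.commute)
      qed
    qed
    show "AE \<omega> in M. (\<lambda>k. f k \<omega>) \<longlonglongrightarrow> f' \<omega>"
    proof (rule AE_I2)
      fix \<omega>
      define z where "z = 2 * pi * (w \<bullet> (xi \<omega> - mean p))"
      have x: "(\<lambda>k. x k \<omega>) \<longlonglongrightarrow> z" unfolding x_def z_def by (intro tendsto_intros mean_lim)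
      have "(\<lambda>k. real (N k) *\<^sub>R (iexp (x k \<omega> / rt k) - 1 - \<i> * of_real (x k \<omega> / rt k)) + of_real ((x k \<omega>)\<^sup>2 / 2)) \<longlonglongrightarrow> 0"
      proof (rule Lim_null_comparison)
        show "\<forall>\<^sub>F k in sequentially. norm (real (N k) *\<^sub>R (iexp (x k \<omega> / rt k) - 1 - \<i> * of_real (x k \<omega> / rt k)) + of_real ((x k \<omega>)\<^sup>2 / 2)) \<le> \<bar>x k \<omega>\<bar> ^ 3 * (1 / rt k)"
        proof (rule always_eventually, rule allI)
          fix k
          define t where "t = x k \<omega> / rt k"
          have N2: "real (N k) * t\<^sup>2 = (x k \<omega>)\<^sup>2" using N_pos[of k] by (simp add: t_def power_divide rt_square)
          have "norm (iexp t - (\<Sum>j\<le>2. (\<i> * t) ^ j / fact j)) \<le> \<bar>t\<bar> ^ (Suc 2) / fact (Suc 2)" by (rule iexp_approx1)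
          then have "norm (iexp t - 1 - \<i> * of_real t + of_real (t\<^sup>2 / 2)) \<le> \<bar>t\<bar> ^ 3 / 6"
            by (simp add: numeral_2_eq_2 numeral_3_eq_3 fact_numeral power2_eq_square algebra_simps)
          also have "\<dots> \<le> \<bar>t\<bar> ^ 3" by simp
          finally have "real (N k) * norm (iexp t - 1 - \<i> * of_real t + of_real (t\<^sup>2 / 2)) \<le> real (N k) * \<bar>t\<bar> ^ 3"
            by (rule mult_left_mono) simp
          also have "real (N k) * \<bar>t\<bar> ^ 3 = \<bar>x k \<omega>\<bar> ^ 3 * (1 / rt k)"
            using rt_pos[of k] by (simp add: t_def power_divide rt_square[symmetric] power2_eq_square power3_eq_cube abs_mult)
          also have "real (N k) * norm (iexp t - 1 - \<i> * of_real t + of_real (t\<^sup>2 / 2))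
              = norm (real (N k) *\<^sub>R (iexp t - 1 - \<i> * of_real t + of_real (t\<^sup>2 / 2)))" by simp
          also have "real (N k) *\<^sub>R (iexp t - 1 - \<i> * of_real t + of_real (t\<^sup>2 / 2)) = real (N k) *\<^sub>R (iexp t - 1 - \<i> * of_real t) + of_real (real (N k) * t\<^sup>2 / 2)"
            by (simp add: scaleR_conv_of_real algebra_simps)
          finally show "norm (real (N k) *\<^sub>R (iexp (x k \<omega> / rt k) - 1 - \<i> * of_real (x k \<omega> / rt k)) + of_real ((x k \<omega>)\<^sup>2 / 2)) \<le> \<bar>x k \<omega>\<bar> ^ 3 * (1 / rt k)"
            unfolding N2 unfolding t_def .
        qed
        have "(\<lambda>k. \<bar>x k \<omega>\<bar> ^ 3 * (1 / rt k)) \<longlonglongrightarrow> \<bar>z\<bar> ^ 3 * 0"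
          by (intro tendsto_mult tendsto_power tendsto_rabs x over_rt_lim)
        then show "(\<lambda>k. \<bar>x k \<omega>\<bar> ^ 3 * (1 / rt k)) \<longlonglongrightarrow> 0" by simp
      qed
      then have "(\<lambda>k. (real (N k) *\<^sub>R (iexp (x k \<omega> / rt k) - 1 - \<i> * of_real (x k \<omega> / rt k)) + of_real ((x k \<omega>)\<^sup>2 / 2)) - of_real ((x k \<omega>)\<^sup>2 / 2)) \<longlonglongrightarrow> 0 - of_real (z\<^sup>2 / 2)"
        by (intro tendsto_diff tendsto_of_real tendsto_divide tendsto_power x tendsto_const) auto
      then have "(\<lambda>k. real (N k) *\<^sub>R (iexp (x k \<omega> / rt k) - 1 - \<i> * of_real (x k \<omega> / rt k))) \<longlonglongrightarrow> of_real (- (z\<^sup>2 / 2))"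
        by simp
      then show "(\<lambda>k. f k \<omega>) \<longlonglongrightarrow> f' \<omega>"
        unfolding f_def f'_def z_def by (intro tendsto_mult tendsto_of_real tendsto_exp tendsto_inner P_lim tendsto_const)
    qed
  qed
  moreover have "(CLINT \<omega>|M. f' \<omega>) = of_real (- (2 * pi\<^sup>2 * cov w))"
  proof -
    define b where "b = fst w * (mom fst p / mgf p) + snd w * (mom snd p / mgf p)"
    note var = tilted_variance[OF p_interior(1) b_def]
    have "f' \<omega> = complex_of_real (- (2 * pi\<^sup>2) * ((fst w * fst (xi \<omega>) + snd w * snd (xi \<omega>) - b)\<^sup>2 * exp (p \<bullet> xi \<omega>)))" for \<omega>
    proof -
      define q where "q = fst w * fst (xi \<omega>) + snd w * snd (xi \<omega>) - b"
      have "w \<bullet> (xi \<omega> - mean p) = q"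
        by (simp add: q_def b_def mean_def inner_real_pair algebra_simps)
      then show ?thesis
        unfolding f'_def of_real_mult[symmetric] q_def[symmetric] by (simp add: power_mult_distrib)
    qed
    then have "(CLINT \<omega>|M. f' \<omega>) = of_real (- (2 * pi\<^sup>2) * (mgf p * ((fst w)\<^sup>2 * cv fst fst p + 2 * fst w * snd w * cv fst snd p + (snd w)\<^sup>2 * cv snd snd p)))"
      by (simp only: integral_complex_of_real integral_mult_right_zero var(2))
    then show ?thesis by (simp add: mgf_p cov_def quad_def mult_ac)
  qed
  ultimately show ?thesis unfolding eq by simp
qed

end

context saddle_sequence
begin

definition limit_density :: "real \<Rightarrow> real" where
  "limit_density y = 1 / (2 * pi * \<rho> * sqrt (cvdet p)) * exp (- (orth_var p / (\<rho> * cvdet p) * y\<^sup>2 / 2))"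

lemma local_limit:
  assumes y: "(\<lambda>k. (real (idx k) - real (N k) * r k) / rt k) \<longlonglongrightarrow> y"
  shows "(\<lambda>k. real (N k) * (exp (P k \<bullet> S k) * local_prob (idx k) (S k))) \<longlonglongrightarrow> first.mgf p * limit_density y"
proof -
  define y' where "y' k = (real (idx k) - real (N k) * r k) / rt k" for k
  have y': "y' \<longlonglongrightarrow> y" using y by (simp add: y'_def[abs_def])
  have idx: "real (idx k) = real (N k) * r k + y' k * rt k" for k
    using rt_pos[of k] by (simp add: y'_def)
  have ratio: "(\<lambda>k. real (idx k) / real (N k)) \<longlonglongrightarrow> \<rho>"
  proof -
    have "real (idx k) / real (N k) = r k + y' k * (1 / rt k)" for k
      unfolding idx using N_pos[of k] rt_pos[of k] by (simp add: field_simps rt_square[symmetric] power2_eq_square)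
    moreover have "(\<lambda>k. r k + y' k * (1 / rt k)) \<longlonglongrightarrow> \<rho> + y * 0"
      by (intro tendsto_add tendsto_mult r_lim y' over_rt_lim)
    ultimately show ?thesis by simp
  qed
  have idx_lim: "filterlim idx at_top sequentially"
  proof -
    have "filterlim (\<lambda>k. real (idx k) / real (N k) * real (N k)) at_top sequentially"
      by (intro filterlim_tendsto_pos_mult_at_top[OF ratio rho_pos] filterlim_compose[OF filterlim_real_sequentially N_lim])
    moreover have "real (idx k) / real (N k) * real (N k) = real (idx k)" for k using N_pos[of k] by simp
    ultimately show ?thesis by (simp add: filterlim_sequentially_iff_filterlim_real)
  qed
  define f where "f k u = indicator unit_box u *\<^sub>R (first.Phi (P k) u * Phi (P k) u ^ idx k * iexp (- (2 * pi * (u \<bullet> S k))))" for k u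
  define h where "h k w = f k ((1 / rt k) *\<^sub>R w)" for k w
  define G where "G w = complex_of_real (first.mgf p) * (of_real (exp (- (\<rho> * (2 * pi\<^sup>2 * cov w)))) * iexp (((2 * pi * y) *\<^sub>R mean p) \<bullet> w))" for w
  have f_int: "integrable lborel (f k)" for k
    unfolding f_def by (rule local_prob_fourier(1)[OF P_dom S_lattice])
  then have fm [measurable]: "f k \<in> borel_measurable borel" for k
    using borel_measurable_integrable[OF f_int[of k]] by simp
  have eq: "complex_of_real (real (N k) * (exp (P k \<bullet> S k) * local_prob (idx k) (S k))) = (CLINT w|lborel. h k w)" for k
  proof -
    have "complex_of_real (exp (P k \<bullet> S k) * local_prob (idx k) (S k)) = (CLINT u|lborel. f k u)"
      unfolding f_def by (rule local_prob_fourier(2)[OF P_dom S_lattice, symmetric])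
    also have "\<dots> = of_real ((1 / rt k)\<^sup>2) * (CLINT w|lborel. h k w)"
      unfolding h_def using rt_pos[of k] by (intro lborel_integral_scale) auto
    finally show ?thesis using N_pos[of k] unfolding of_real_mult[of "real (N k)"]
      by (simp add: power_divide rt_square)
  qed
  have Gb: "quad (\<rho> * 4 * pi\<^sup>2 * cv fst fst p) (\<rho> * 4 * pi\<^sup>2 * cv fst snd p) (\<rho> * 4 * pi\<^sup>2 * cv snd snd p) w / 2 = \<rho> * (2 * pi\<^sup>2 * cov w)" for w
    by (simp add: cov_def quad_def algebra_simps)
  have snd_pos: "cv snd snd p > 0" using tilted_variance_pos[OF p_interior(1), of 0 1] by simp
  have det: "cvdet p > 0" by (rule cvdet_pos[OF p_interior(1)])
  have D: "(\<rho> * 4 * pi\<^sup>2 * cv fst fst p) * (\<rho> * 4 * pi\<^sup>2 * cv snd snd p) - (\<rho> * 4 * pi\<^sup>2 * cv fst snd p)\<^sup>2 = (\<rho> * 4 * pi\<^sup>2)\<^sup>2 * cvdet p"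
    by (simp add: cvdet_def power2_eq_square algebra_simps)
  have Dpos: "(\<rho> * 4 * pi\<^sup>2 * cv fst fst p) * (\<rho> * 4 * pi\<^sup>2 * cv snd snd p) - (\<rho> * 4 * pi\<^sup>2 * cv fst snd p)\<^sup>2 > 0"
    unfolding D using det rho_pos by simp
  have Cpos: "\<rho> * 4 * pi\<^sup>2 * cv snd snd p > 0" using snd_pos rho_pos by simp
  note gc = gaussian_char2[OF Cpos Dpos, of "(2 * pi * y) *\<^sub>R mean p", unfolded Gb D]
  have G_int: "(CLINT w|lborel. G w) = of_real (first.mgf p * limit_density y)"
  proof -
    have 1: "quad (\<rho> * 4 * pi\<^sup>2 * cv snd snd p) (- (\<rho> * 4 * pi\<^sup>2 * cv fst snd p)) (\<rho> * 4 * pi\<^sup>2 * cv fst fst p) ((2 * pi * y) *\<^sub>R mean p)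
       = (\<rho> * 4 * pi\<^sup>2) * (2 * pi * y)\<^sup>2 * orth_var p"
      by (simp add: quad_def orth_var_def power2_eq_square algebra_simps)
    have 2: "(\<rho> * 4 * pi\<^sup>2) * (2 * pi * y)\<^sup>2 * orth_var p / (2 * ((\<rho> * 4 * pi\<^sup>2)\<^sup>2 * cvdet p)) = orth_var p / (\<rho> * cvdet p) * y\<^sup>2 / 2"
      using rho_pos det by (simp add: power2_eq_square field_simps)
    have 3: "2 * pi / sqrt ((\<rho> * 4 * pi\<^sup>2)\<^sup>2 * cvdet p) = 1 / (2 * pi * \<rho> * sqrt (cvdet p))"
      using rho_pos det by (simp add: real_sqrt_mult power2_eq_square field_simps)
    show ?thesis
      unfolding G_def integral_mult_right_zero gc(2) 1 2 3 limit_density_def by simp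
  qed
  have G_meas: "G \<in> borel_measurable lborel"
    unfolding G_def by (rule borel_measurable_times[OF borel_measurable_const borel_measurable_integrable[OF gc(1)]])
  obtain c where c: "c > 0"
    "\<And>q u. q \<in> dom \<Longrightarrow> norm q \<le> norm p + 1 \<Longrightarrow> u \<in> {-1/2..1/2} \<times> {-1/2..1/2} \<Longrightarrow> norm (Phi q u) \<le> mgf q - c * (norm u)\<^sup>2"
    using Phi_decay[of "norm p + 1"] by (metis add_nonneg_pos norm_ge_zero zero_less_one)
  have ev_norm: "\<forall>\<^sub>F k in sequentially. norm (P k) < norm p + 1"
    by (rule order_tendstoD(2)[OF tendsto_norm[OF P_lim]]) simp
  have ev_first: "\<forall>\<^sub>F k in sequentially. first.mgf (P k) < first.mgf p + 1"
    by (rule order_tendstoD(2)[OF isCont_tendsto_compose[OF first.mom_isCont[OF p_interior(2)] P_lim]]) auto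
  have ev_ratio: "\<forall>\<^sub>F k in sequentially. \<rho> / 2 < real (idx k) / real (N k)"
    by (rule order_tendstoD(1)[OF ratio]) (use rho_pos in simp)
  have first_pos: "first.mgf p \<ge> 0" using first.mgf_pos[of p] p_interior(2) interior_subset by (metis less_imp_le subsetD)
  define a where "a = c * \<rho> / 2"
  have a: "a > 0" using c(1) rho_pos by (simp add: a_def)
  have "(\<lambda>k. CLINT w|lborel. h k w) \<longlonglongrightarrow> (CLINT w|lborel. G w)"
  proof (rule integral_dominated_convergence_eventually(1)[OF G_meas])
    show "h k \<in> borel_measurable lborel" for k unfolding h_def by measurable
    show "integrable lborel (\<lambda>w::real \<times> real. (first.mgf p + 1) * exp (- (a * (norm w)\<^sup>2)))"
      using gaussian_norm_integral(1)[OF a] by (rule integrable_mult_right)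
    show "\<forall>\<^sub>F k in sequentially. AE w in lborel. norm (h k w) \<le> (first.mgf p + 1) * exp (- (a * (norm w)\<^sup>2))"
      using ev_norm ev_first ev_ratio
    proof eventually_elim
      case (elim k)
      show ?case
      proof (rule AE_I2)
        fix w :: "real \<times> real"
        define u where "u = (1 / rt k) *\<^sub>R w"
        have nu: "(norm u)\<^sup>2 = (norm w)\<^sup>2 / real (N k)"
          using rt_pos[of k] by (simp add: u_def power_divide rt_square)
        show "norm (h k w) \<le> (first.mgf p + 1) * exp (- (a * (norm w)\<^sup>2))"
        proof (cases "u \<in> unit_box")
          case True
          have "norm (Phi (P k) u) \<le> 1 - c * (norm u)\<^sup>2"
            using c(2)[OF P_dom(1), of k u] elim(1) True by (simp add: mgf_P unit_box_def)
          also have "\<dots> \<le> exp (- (c * (norm u)\<^sup>2))"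
            using exp_ge_add_one_self[of "- (c * (norm u)\<^sup>2)"] by simp
          finally have "norm (Phi (P k) u) ^ idx k \<le> exp (- (c * (norm u)\<^sup>2)) ^ idx k" by (rule power_mono) simp
          also have "\<dots> = exp (- (c * (norm w)\<^sup>2 * (real (idx k) / real (N k))))"
            by (simp add: exp_of_nat_mult[symmetric] nu mult_ac)
          also have "\<dots> \<le> exp (- (a * (norm w)\<^sup>2))"
          proof -
            have "c * (norm w)\<^sup>2 * (\<rho> / 2) \<le> c * (norm w)\<^sup>2 * (real (idx k) / real (N k))"
              using elim(3) c(1) by (intro mult_left_mono) auto
            then show ?thesis by (simp add: a_def mult_ac)
          qed
          finally have "norm (first.Phi (P k) u) * norm (Phi (P k) u) ^ idx k \<le> (first.mgf p + 1) * exp (- (a * (norm w)\<^sup>2))"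
            using first.norm_Phi_le[of "P k" u] elim(2) first_pos by (intro mult_mono) auto
          then show ?thesis using True by (simp add: h_def f_def u_def[symmetric] norm_mult norm_power)
        next
          case False
          then show ?thesis using first_pos by (simp add: h_def f_def u_def[symmetric])
        qed
      qed
    qed
    show "AE w in lborel. (\<lambda>k. h k w) \<longlonglongrightarrow> G w"
    proof (rule AE_I2)
      fix w :: "real \<times> real"
      have u0: "(\<lambda>k. (1 / rt k) *\<^sub>R w) \<longlonglongrightarrow> 0"
        using tendsto_scaleR[OF over_rt_lim[of 1] tendsto_const[of w]] by simp
      have "\<forall>\<^sub>F k in sequentially. (1 / rt k) *\<^sub>R w \<in> ball 0 (1 / 2)"
        using u0 by (rule topological_tendstoD) auto
      then have box: "\<forall>\<^sub>F k in sequentially. (1 / rt k) *\<^sub>R w \<in> unit_box"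
      proof eventually_elim
        case (elim k)
        define u where "u = (1 / rt k) *\<^sub>R w"
        have "norm u < 1 / 2" using elim by (simp add: u_def)
        then have "\<bar>fst u\<bar> \<le> 1 / 2" "\<bar>snd u\<bar> \<le> 1 / 2"
          using norm_fst_le[of "fst u" "snd u"] norm_snd_le[of "snd u" "fst u"] by auto
        then show ?case unfolding u_def[symmetric] by (auto simp: unit_box_def mem_Times_iff abs_le_iff)
      qed
      have hk: "first.Phi (P k) ((1 / rt k) *\<^sub>R w) * (centred k w ^ idx k * iexp (2 * pi * (y' k * (w \<bullet> mean (P k))))) = h k w"
        if "(1 / rt k) *\<^sub>R w \<in> unit_box" for k
      proof -
        define u where "u = (1 / rt k) *\<^sub>R w"
        have uw: "w /\<^sub>R rt k = u" by (simp add: u_def inverse_eq_divide)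
        have "w \<bullet> mean (P k) = rt k * (u \<bullet> mean (P k))" using rt_pos[of k] by (simp add: u_def)
        then have "real (idx k) * (- (2 * pi * (u \<bullet> mean (P k)))) + 2 * pi * (y' k * (w \<bullet> mean (P k))) = - (2 * pi * (u \<bullet> S k))"
          by (simp add: idx S_eq algebra_simps)
        then have "iexp (- (2 * pi * (u \<bullet> mean (P k)))) ^ idx k * iexp (2 * pi * (y' k * (w \<bullet> mean (P k)))) = iexp (- (2 * pi * (u \<bullet> S k)))"
          unfolding exp_of_nat_mult[symmetric] exp_add[symmetric]
          by (metis (no_types, opaque_lifting) distrib_left mult.left_commute of_real_add of_real_mult of_real_of_nat_eq)
        then have "centred k w ^ idx k * iexp (2 * pi * (y' k * (w \<bullet> mean (P k)))) = Phi (P k) u ^ idx k * iexp (- (2 * pi * (u \<bullet> S k)))"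
          unfolding centred_def uw power_mult_distrib mult.assoc by simp
        then show ?thesis using that unfolding h_def f_def u_def[symmetric] by simp
      qed
      have ev: "\<forall>\<^sub>F k in sequentially. first.Phi (P k) ((1 / rt k) *\<^sub>R w) * (centred k w ^ idx k * iexp (2 * pi * (y' k * (w \<bullet> mean (P k))))) = h k w"
        using box by eventually_elim (rule hk)
      have "(\<lambda>k. (real (idx k) / real (N k)) *\<^sub>R (real (N k) *\<^sub>R (centred k w - 1))) \<longlonglongrightarrow> \<rho> *\<^sub>R of_real (- (2 * pi\<^sup>2 * cov w))"
        by (intro tendsto_scaleR ratio centred_second_order)
      moreover have "(real (idx k) / real (N k)) *\<^sub>R (real (N k) *\<^sub>R (centred k w - 1)) = real (idx k) *\<^sub>R (centred k w - 1)" for k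
        using N_pos[of k] by simp
      ultimately have lim: "(\<lambda>k. real (idx k) *\<^sub>R (centred k w - 1)) \<longlonglongrightarrow> of_real (- (\<rho> * (2 * pi\<^sup>2 * cov w)))"
        by (simp add: scaleR_conv_of_real)
      have "norm (centred k w) \<le> 1" for k
        using norm_Phi_le[of "P k" "w /\<^sub>R rt k"] by (simp add: centred_def norm_mult mgf_P)
      then have pw: "(\<lambda>k. centred k w ^ idx k) \<longlonglongrightarrow> of_real (exp (- (\<rho> * (2 * pi\<^sup>2 * cov w))))"
        using cov_nonneg[of w] rho_pos by (intro power_tendsto_exp[OF idx_lim _ lim]) auto
      have "(\<lambda>k. first.Phi (P k) ((1 / rt k) *\<^sub>R w) * (centred k w ^ idx k * iexp (2 * pi * (y' k * (w \<bullet> mean (P k))))))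
          \<longlonglongrightarrow> of_real (first.mgf p) * (of_real (exp (- (\<rho> * (2 * pi\<^sup>2 * cov w)))) * iexp (2 * pi * (y * (w \<bullet> mean p))))"
        by (intro tendsto_mult first.Phi_tendsto[OF p_interior(2) P_lim u0] pw tendsto_exp tendsto_of_real tendsto_const y' tendsto_inner mean_lim)
      also have "of_real (first.mgf p) * (of_real (exp (- (\<rho> * (2 * pi\<^sup>2 * cov w)))) * iexp (2 * pi * (y * (w \<bullet> mean p)))) = G w"
        by (simp add: G_def inner_commute mult_ac)
      finally show "(\<lambda>k. h k w) \<longlonglongrightarrow> G w"
        by (rule Lim_transform_eventually[OF _ ev])
    qed
  qed
  then have "(\<lambda>k. complex_of_real (real (N k) * (exp (P k \<bullet> S k) * local_prob (idx k) (S k)))) \<longlonglongrightarrow> of_real (first.mgf p * limit_density y)"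
    unfolding eq G_int .
  then show ?thesis by (simp only: tendsto_of_real_iff)
qed

end

section \<open>Summation over the number of steps\<close>

lemma exp_neg_abs_integrable:
  fixes c :: real
  assumes c: "c > 0"
  shows "integrable lborel (\<lambda>y. exp (- (c * \<bar>y\<bar>)))"
proof -
  interpret prob_space "density lborel (exponential_density c)"
    using c by (rule prob_space_exponential_density)
  have "integrable (density lborel (exponential_density c)) (\<lambda>_. 1::real)" by simp
  then have e: "integrable lborel (exponential_density c)"
    using integrable_density[of "\<lambda>_. 1 :: real" lborel "exponential_density c"] c by (simp add: exponential_density_nonneg)
  have "integrable lborel (\<lambda>y. exponential_density c (0 + (- 1) * y))"
    using e by (rule lborel_integrable_real_affine) simp
  with e have "integrable lborel (\<lambda>y. exponential_density c y + exponential_density c (0 + (- 1) * y))"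
    by (rule Bochner_Integration.integrable_add)
  then have i: "integrable lborel (\<lambda>y. (1 / c) * (exponential_density c y + exponential_density c (0 + (- 1) * y)))"
    by (rule integrable_mult_right)
  show ?thesis
    by (rule Bochner_Integration.integrable_bound[OF i])
      (use c in \<open>auto simp: exponential_density_def abs_if mult.commute\<close>)
qed

lemma suminf_eq_nn_integral_floor:
  "(\<Sum>j. ennreal (b j)) = (\<integral>\<^sup>+(x::real). ennreal (b (nat \<lfloor>x\<rfloor>)) * indicator {0..} x \<partial>lborel)"
proof -
  define A where "A j = {real j..<real j + 1}" for j
  have A: "x \<in> A j \<longleftrightarrow> 0 \<le> x \<and> nat \<lfloor>x\<rfloor> = j" for x j
    unfolding A_def by (auto simp: floor_less_iff le_floor_iff nat_eq_iff) linarith+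
  have disj: "disjoint_family A"
    unfolding disjoint_family_on_def by (auto simp: A)
  have "ennreal (b (nat \<lfloor>x\<rfloor>)) * indicator {0..} x = (\<Sum>j. ennreal (b j) * indicator (A j) x)" for x :: real
  proof (cases "x \<ge> 0")
    case True
    then show ?thesis using suminf_cmult_indicator[OF disj, of x "nat \<lfloor>x\<rfloor>" "\<lambda>j. ennreal (b j)"] A by simp
  next
    case False
    then have "x \<notin> A j" for j using A by auto
    then show ?thesis using False by simp
  qed
  then have "(\<integral>\<^sup>+(x::real). ennreal (b (nat \<lfloor>x\<rfloor>)) * indicator {0..} x \<partial>lborel) = (\<Sum>j. \<integral>\<^sup>+x. ennreal (b j) * indicator (A j) x \<partial>lborel)"
    by (simp add: nn_integral_suminf A_def)
  also have "\<dots> = (\<Sum>j. ennreal (b j))"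
    by (simp add: nn_integral_cmult_indicator A_def)
  finally show ?thesis by simp
qed

context saddle_sequence
begin

lemma (in delayed_walk) local_prob_nonneg: "local_prob j s \<ge> 0"
  by (simp add: local_prob_def)

text \<open>Tilting the step further by \<open>O(1 / sqrt N)\<close> against the sign of \<open>j - N r\<close> costs a bounded factor and
  gains exponential decay on the scale \<open>sqrt N\<close>.\<close>

lemma local_prob_dominated:
  obtains B c where "c > 0" "B \<ge> 0"
    "\<forall>\<^sub>F k in sequentially. \<forall>j. real (N k) * (exp (P k \<bullet> S k) * local_prob j (S k))
        \<le> B * exp (- (c * \<bar>(real j - real (N k) * r k) / rt k\<bar>))"
proof -
  obtain e1 C where e1: "e1 > 0" "C \<ge> 0"
    "\<And>q h. norm (q - p) \<le> e1 \<Longrightarrow> norm h \<le> e1 \<Longrightarrow>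
     \<bar>mgf (q + h) - mgf q - (fst h * mom (\<lambda>y. 1 * fst y) q + snd h * mom (\<lambda>y. 1 * snd y) q)\<bar> \<le> C * (norm h)\<^sup>2"
    "\<And>q. norm (q - p) \<le> e1 \<Longrightarrow> q \<in> interior dom"
    by (rule mom_second_order[OF p_interior(1) subexp_const[of 1]]) (rule that)
  have "\<forall>\<^sub>F q in nhds p. mgf q < 2 \<and> first.mgf q < first.mgf p + 1 \<and> q \<in> interior first.dom"
    using order_tendstoD(2)[OF mom_isCont[OF p_interior(1) subexp_const[of 1], unfolded isCont_def tendsto_at_iff_tendsto_nhds], of 2]
      order_tendstoD(2)[OF first.mom_isCont[OF p_interior(2) subexp_const[of 1], unfolded isCont_def tendsto_at_iff_tendsto_nhds], of "first.mgf p + 1"]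
      eventually_nhds_in_open[OF open_interior p_interior(2)]
    by (auto simp: mgf_p intro: eventually_conj)
  then obtain e2 where e2: "e2 > 0" "\<And>q. dist q p < e2 \<Longrightarrow> mgf q < 2 \<and> first.mgf q < first.mgf p + 1 \<and> q \<in> interior first.dom"
    unfolding eventually_nhds_metric by blast
  define K1 where "K1 = first.mgf p + 1"
  have K1: "K1 > 0" using first.mgf_pos[of p] p_interior(2) interior_subset by (force simp: K1_def)
  define e where "e = min (min (e1 / 2) (e2 / 4)) (1 / 2)"
  have e: "e > 0" "2 * e \<le> e1" "2 * e < e2" "2 * e \<le> 1" using e1(1) e2(1) by (auto simp: e_def)
  obtain K where K: "K > 0"
    "\<And>q s j. q \<in> dom \<Longrightarrow> q \<in> first.dom \<Longrightarrow> norm q \<le> norm p + 1 \<Longrightarrow> mgf q \<le> 2 \<Longrightarrow> s \<in> \<int> \<times> \<int> \<Longrightarrow>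
      exp (q \<bullet> s) * local_prob j s \<le> K * first.mgf q * mgf q ^ j / real (Suc j)"
    by (rule local_prob_upper[of "norm p + 1"]) (simp add: add_nonneg_pos, rule that)
  define \<tau> where "\<tau> = min e (1 / (2 * (C + 1)))"
  have \<tau>: "\<tau> > 0" "\<tau> \<le> e" "C * \<tau> \<le> 1 / 2"
  proof -
    show "\<tau> > 0" "\<tau> \<le> e" using e e1(2) by (auto simp: \<tau>_def)
    have "C * \<tau> \<le> C * (1 / (2 * (C + 1)))" using e1(2) by (intro mult_left_mono) (auto simp: \<tau>_def)
    also have "\<dots> \<le> 1 / 2" using e1(2) by (simp add: field_simps)
    finally show "C * \<tau> \<le> 1 / 2" .
  qed
  define B where "B = K * K1 * exp (\<tau> * \<rho>) * (4 / \<rho> + 512 / (\<rho>\<^sup>2 * \<tau>\<^sup>2))"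
  have "B \<ge> 0" using K(1) K1 rho_pos by (auto simp: B_def)
  have evP: "\<forall>\<^sub>F k in sequentially. dist (P k) p < e" using P_lim e(1) by (rule tendstoD)
  have evr: "\<forall>\<^sub>F k in sequentially. \<rho> / 2 < r k \<and> r k < 2 * \<rho>"
    using rho_pos by (intro eventually_conj order_tendstoD[OF r_lim]) auto
  have "\<forall>\<^sub>F k in sequentially. \<forall>j. real (N k) * (exp (P k \<bullet> S k) * local_prob j (S k))
        \<le> B * exp (- (\<tau> / 4 * \<bar>(real j - real (N k) * r k) / rt k\<bar>))"
    using evP evr
  proof eventually_elim
    case (elim k)
    show ?case
    proof
      fix j
      define y where "y = (real j - real (N k) * r k) / rt k"
      have j: "real j - real (N k) * r k = y * rt k" using rt_pos[of k] by (simp add: y_def)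
      define \<sigma> where "\<sigma> = (if y \<ge> 0 then - 1 else 1 :: real)"
      define h where "h = (\<sigma> * \<tau> / rt k, 0 :: real)"
      have rt1: "rt k \<ge> 1" using N_pos[of k] by (simp add: rt_def Suc_leI)
      have nh: "norm h = \<tau> / rt k" using \<tau>(1) rt_pos[of k] by (simp add: h_def norm_Pair \<sigma>_def abs_mult)
      have "\<tau> / rt k \<le> \<tau> / 1" using \<tau>(1) rt1 by (intro divide_left_mono) auto
      then have nhe: "norm h \<le> e" using nh \<tau>(2) by simp
      define q where "q = P k + h"
      have "norm (q - p) \<le> norm (P k - p) + norm h"
        using norm_triangle_ineq[of "P k - p" h] by (simp add: q_def algebra_simps)
      then have qp: "norm (q - p) \<le> 2 * e" using elim(1) nhe by (simp add: dist_norm)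
      have q: "q \<in> dom" "q \<in> first.dom" "mgf q \<le> 2" "first.mgf q \<le> K1"
        using e1(4)[of q] e2(2)[of q] qp e interior_subset by (auto simp: dist_norm K1_def)
      have nq: "norm q \<le> norm p + 1" using norm_triangle_ineq[of p "q - p"] qp e(4) by simp
      define a where "a = mom fst (P k)"
      have a1: "a \<ge> 1" using mom_fst_ge_mgf[OF P_interior(1), of k] by (simp add: a_def mgf_P)
      have am: "fst (mean (P k)) = a" by (simp add: mean_def mgf_P a_def)
      have "norm (P k - p) \<le> e1" "norm h \<le> e1" using elim(1) nhe e by (auto simp: dist_norm)
      from e1(3)[OF this] have "mgf q \<le> 1 + fst h * a + C * (norm h)\<^sup>2"
        by (simp add: q_def mgf_P a_def h_def abs_le_iff)
      also have "\<dots> \<le> exp (fst h * a + C * (norm h)\<^sup>2)" using exp_ge_add_one_self[of "fst h * a + C * (norm h)\<^sup>2"] by linarith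
      finally have mq: "mgf q ^ j \<le> exp (real j * (fst h * a + C * (norm h)\<^sup>2))"
        using mgf_pos[OF q(1)] unfolding exp_of_nat_mult by (intro power_mono) auto
      have hS: "h \<bullet> S k = real (N k) * r k * (fst h * a)"
        by (simp add: S_eq inner_real_pair h_def am)
      have expo: "real j * (fst h * a + C * (norm h)\<^sup>2) - h \<bullet> S k \<le> \<tau> * \<rho> - \<tau> / 2 * \<bar>y\<bar>"
      proof -
        have "fst h * a * (y * rt k) = - (\<tau> * a * \<bar>y\<bar>)"
          using rt_pos[of k] by (simp add: h_def \<sigma>_def abs_if)
        also have "\<dots> \<le> - (\<tau> * \<bar>y\<bar>)" using a1 \<tau>(1) by (simp add: mult_left_mono mult_right_mono)
        finally have 1: "fst h * a * (y * rt k) \<le> - (\<tau> * \<bar>y\<bar>)" .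
        have "real j / real (N k) = r k + y / rt k"
          using j N_pos[of k] rt_pos[of k] by (simp add: field_simps rt_square[symmetric] power2_eq_square)
        also have "y / rt k \<le> \<bar>y\<bar>"
        proof -
          have "y / rt k \<le> \<bar>y\<bar> / rt k" using rt_pos[of k] by (intro divide_right_mono) auto
          also have "\<dots> \<le> \<bar>y\<bar> / 1" using rt1 by (intro divide_left_mono) auto
          finally show ?thesis by simp
        qed
        finally have "real j / real (N k) \<le> 2 * \<rho> + \<bar>y\<bar>" using elim(2) by linarith
        then have "(C * \<tau>) * \<tau> * (real j / real (N k)) \<le> (1 / 2) * \<tau> * (2 * \<rho> + \<bar>y\<bar>)"
          using \<tau> e1(2) rho_pos by (intro mult_mono) auto
        moreover have "real j * (C * (norm h)\<^sup>2) = (C * \<tau>) * \<tau> * (real j / real (N k))"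
          unfolding nh power_divide rt_square by (simp add: power2_eq_square)
        ultimately have 2: "real j * (C * (norm h)\<^sup>2) \<le> \<tau> * \<rho> + \<tau> / 2 * \<bar>y\<bar>" by (simp add: algebra_simps)
        have "real j * (fst h * a + C * (norm h)\<^sup>2) - h \<bullet> S k = fst h * a * (y * rt k) + real j * (C * (norm h)\<^sup>2)"
          unfolding hS j[symmetric] by (simp add: algebra_simps)
        then show ?thesis using 1 2 by simp
      qed
      have ratio: "real (N k) / real (Suc j) \<le> 4 / \<rho> + 16 / \<rho>\<^sup>2 * y\<^sup>2"
      proof (cases "real j \<ge> real (N k) * r k / 2")
        case True
        have "real (N k) * \<rho> \<le> real (N k) * (2 * r k)" using elim(2) by (intro mult_left_mono) auto
        then have "real (N k) * \<rho> \<le> 4 * real (Suc j)" using True by simp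
        then have "real (N k) / real (Suc j) \<le> 4 / \<rho>" using rho_pos by (simp add: field_simps)
        then show ?thesis using add_increasing2[of "16 / \<rho>\<^sup>2 * y\<^sup>2" "real (N k) / real (Suc j)" "4 / \<rho>"] by simp
      next
        case False
        have "real (N k) * (\<rho> / 4) \<le> real (N k) * (r k / 2)" using elim(2) by (intro mult_left_mono) auto
        also have "\<dots> \<le> \<bar>y\<bar> * rt k"
        proof -
          have "- y * rt k \<le> \<bar>y\<bar> * rt k" using rt_pos[of k] by (intro mult_right_mono) auto
          then show ?thesis using False j by linarith
        qed
        finally have "rt k * (\<rho> / 4) \<le> \<bar>y\<bar>"
          using rt_pos[of k] by (simp add: rt_square[symmetric] power2_eq_square)
        then have "(rt k * (\<rho> / 4))\<^sup>2 \<le> \<bar>y\<bar>\<^sup>2" using rt_pos[of k] rho_pos by (intro power_mono) auto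
        then have "real (N k) \<le> 16 / \<rho>\<^sup>2 * y\<^sup>2"
          using rho_pos by (simp add: power_mult_distrib power_divide rt_square field_simps)
        moreover have "real (N k) / real (Suc j) \<le> real (N k) / 1" by (intro divide_left_mono) auto
        moreover have "4 / \<rho> > 0" using rho_pos by simp
        ultimately show ?thesis by linarith
      qed
      have y2: "4 / \<rho> + 16 / \<rho>\<^sup>2 * y\<^sup>2 \<le> (4 / \<rho> + 512 / (\<rho>\<^sup>2 * \<tau>\<^sup>2)) * exp (\<tau> / 4 * \<bar>y\<bar>)"
      proof -
        have "1 + \<tau> / 4 * \<bar>y\<bar> + (\<tau> / 4 * \<bar>y\<bar>)\<^sup>2 / 2 \<le> exp (\<tau> / 4 * \<bar>y\<bar>)"
          using \<tau>(1) by (intro exp_lower_Taylor_quadratic) auto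
        moreover have "0 \<le> \<tau> / 4 * \<bar>y\<bar>" "0 \<le> (\<tau> / 4 * \<bar>y\<bar>)\<^sup>2" using \<tau>(1) by auto
        ultimately have ex: "1 \<le> exp (\<tau> / 4 * \<bar>y\<bar>)" "(\<tau> / 4 * \<bar>y\<bar>)\<^sup>2 / 2 \<le> exp (\<tau> / 4 * \<bar>y\<bar>)"
          by linarith+
        have "16 / \<rho>\<^sup>2 * y\<^sup>2 = 512 / (\<rho>\<^sup>2 * \<tau>\<^sup>2) * ((\<tau> / 4 * \<bar>y\<bar>)\<^sup>2 / 2)"
          using \<tau>(1) by (simp add: power_mult_distrib power_divide)
        also have "\<dots> \<le> 512 / (\<rho>\<^sup>2 * \<tau>\<^sup>2) * exp (\<tau> / 4 * \<bar>y\<bar>)" using ex(2) by (rule mult_left_mono) simp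
        finally have "16 / \<rho>\<^sup>2 * y\<^sup>2 \<le> 512 / (\<rho>\<^sup>2 * \<tau>\<^sup>2) * exp (\<tau> / 4 * \<bar>y\<bar>)" .
        moreover have "4 / \<rho> * 1 \<le> 4 / \<rho> * exp (\<tau> / 4 * \<bar>y\<bar>)" using ex(1) rho_pos by (intro mult_left_mono) auto
        ultimately show ?thesis by (simp add: distrib_right)
      qed
      have "exp (P k \<bullet> S k) * local_prob j (S k) = exp (- (h \<bullet> S k)) * (exp (q \<bullet> S k) * local_prob j (S k))"
        by (simp add: q_def inner_add_left exp_add exp_minus)
      also have "\<dots> \<le> exp (- (h \<bullet> S k)) * (K * first.mgf q * mgf q ^ j / real (Suc j))"
        using K(2)[OF q(1,2) nq q(3) S_lattice] by (intro mult_left_mono) auto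
      also have "\<dots> \<le> exp (- (h \<bullet> S k)) * (K * K1 * exp (real j * (fst h * a + C * (norm h)\<^sup>2)) / real (Suc j))"
        using K(1) q(4) mq mgf_pos[OF q(1)] K1
        by (intro mult_left_mono divide_right_mono mult_mono) auto
      also have "\<dots> = K * K1 * exp (real j * (fst h * a + C * (norm h)\<^sup>2) - h \<bullet> S k) / real (Suc j)"
        by (simp add: exp_diff exp_minus divide_inverse mult_ac)
      also have "\<dots> \<le> K * K1 * exp (\<tau> * \<rho> - \<tau> / 2 * \<bar>y\<bar>) / real (Suc j)"
        using expo K(1) K1 by (intro divide_right_mono mult_left_mono) auto
      finally have "real (N k) * (exp (P k \<bullet> S k) * local_prob j (S k)) \<le> real (N k) * (K * K1 * exp (\<tau> * \<rho> - \<tau> / 2 * \<bar>y\<bar>) / real (Suc j))"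
        by (rule mult_left_mono) simp
      also have "\<dots> = K * K1 * exp (\<tau> * \<rho> - \<tau> / 2 * \<bar>y\<bar>) * (real (N k) / real (Suc j))" by simp
      also have "\<dots> \<le> K * K1 * exp (\<tau> * \<rho> - \<tau> / 2 * \<bar>y\<bar>) * ((4 / \<rho> + 512 / (\<rho>\<^sup>2 * \<tau>\<^sup>2)) * exp (\<tau> / 4 * \<bar>y\<bar>))"
        using order_trans[OF ratio y2] K(1) K1 by (intro mult_left_mono) auto
      also have "\<dots> = K * K1 * (4 / \<rho> + 512 / (\<rho>\<^sup>2 * \<tau>\<^sup>2)) * (exp (\<tau> * \<rho> - \<tau> / 2 * \<bar>y\<bar>) * exp (\<tau> / 4 * \<bar>y\<bar>))" by (simp only: mult_ac)
      also have "exp (\<tau> * \<rho> - \<tau> / 2 * \<bar>y\<bar>) * exp (\<tau> / 4 * \<bar>y\<bar>) = exp (\<tau> * \<rho>) * exp (- (\<tau> / 4 * \<bar>y\<bar>))"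
        unfolding mult_exp_exp by simp
      finally show "real (N k) * (exp (P k \<bullet> S k) * local_prob j (S k)) \<le> B * exp (- (\<tau> / 4 * \<bar>(real j - real (N k) * r k) / rt k\<bar>))"
        unfolding B_def y_def[symmetric] by (simp only: mult_ac)
    qed
  qed
  then show ?thesis using that[of "\<tau> / 4" B] \<tau>(1) \<open>B \<ge> 0\<close> by auto
qed

lemma limit_density_integral: "(\<integral>y. limit_density y \<partial>lborel) = 1 / sqrt (2 * pi * \<rho> * orth_var p)"
proof -
  have det: "cvdet p > 0" by (rule cvdet_pos[OF p_interior(1)])
  have orth: "orth_var p > 0" using orth_var_pos[OF p_interior(1)] mean_fst_ge_1[OF p_interior(1)] by simp
  define a where "a = orth_var p / (\<rho> * cvdet p)"
  have a: "a > 0" using det orth rho_pos by (simp add: a_def)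
  have "(\<integral>y. limit_density y \<partial>lborel) = 1 / (2 * pi * \<rho> * sqrt (cvdet p)) * sqrt (2 * pi / a)"
    unfolding limit_density_def a_def[symmetric] integral_mult_right_zero gaussian_integral(2)[OF a] ..
  also have "\<dots> = sqrt ((1 / (2 * pi * \<rho> * sqrt (cvdet p)))\<^sup>2 * (2 * pi / a))"
  proof -
    have "0 \<le> 1 / (2 * pi * \<rho> * sqrt (cvdet p))" using rho_pos det by simp
    then show ?thesis by (simp only: real_sqrt_mult[of "(1 / (2 * pi * \<rho> * sqrt (cvdet p)))\<^sup>2"] real_sqrt_abs abs_of_nonneg)
  qed
  also have "(1 / (2 * pi * \<rho> * sqrt (cvdet p)))\<^sup>2 * (2 * pi / a) = 1 / (2 * pi * \<rho> * orth_var p)"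
    using rho_pos det orth by (simp add: a_def power_divide power_mult_distrib) (simp add: power2_eq_square)
  finally show ?thesis by (simp add: real_sqrt_divide)
qed

lemma renewal_limit:
  "(\<lambda>k. rt k * exp (P k \<bullet> S k) * enn2real (\<Sum>j. ennreal (local_prob j (S k))))
     \<longlonglongrightarrow> first.mgf p / sqrt (2 * pi * \<rho> * orth_var p)"
proof -
  define ix where "ix k y = nat \<lfloor>real (N k) * r k + rt k * y\<rfloor>" for k y
  define F where "F k y = indicator {0..} (real (N k) * r k + rt k * y) * (real (N k) * (exp (P k \<bullet> S k) * local_prob (ix k y) (S k)))" for k y
  have F_nonneg: "F k y \<ge> 0" for k y by (simp add: F_def local_prob_nonneg)
  have Fm [measurable]: "F k \<in> borel_measurable borel" for k
  proof -
    have [measurable]: "(\<lambda>x. local_prob (nat \<lfloor>x\<rfloor>) (S k)) \<in> borel_measurable (borel :: real measure)"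
      by (rule measurable_compose[of "\<lambda>x. nat \<lfloor>x\<rfloor>" _ "count_space UNIV"]) measurable
    show ?thesis unfolding F_def ix_def by measurable
  qed
  have sum_eq: "rt k * exp (P k \<bullet> S k) * enn2real (\<Sum>j. ennreal (local_prob j (S k))) = (\<integral>y. F k y \<partial>lborel)" for k
  proof -
    have [measurable]: "(\<lambda>x. local_prob (nat \<lfloor>x\<rfloor>) (S k)) \<in> borel_measurable (borel :: real measure)"
      by (rule measurable_compose[of "\<lambda>x. nat \<lfloor>x\<rfloor>" _ "count_space UNIV"]) measurable
    have "(\<Sum>j. ennreal (local_prob j (S k))) = (\<integral>\<^sup>+(x::real). ennreal (local_prob (nat \<lfloor>x\<rfloor>) (S k)) * indicator {0..} x \<partial>lborel)"
      by (rule suminf_eq_nn_integral_floor)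
    also have "\<dots> = ennreal \<bar>rt k\<bar> * (\<integral>\<^sup>+y. ennreal (local_prob (nat \<lfloor>real (N k) * r k + rt k * y\<rfloor>) (S k)) * indicator {0..} (real (N k) * r k + rt k * y) \<partial>lborel)"
      using rt_pos[of k] by (subst nn_integral_real_affine[where c = "rt k" and t = "real (N k) * r k"]) auto
    finally have s: "(\<Sum>j. ennreal (local_prob j (S k))) = ennreal (rt k) * (\<integral>\<^sup>+y. ennreal (local_prob (ix k y) (S k)) * indicator {0..} (real (N k) * r k + rt k * y) \<partial>lborel)"
      using rt_pos[of k] by (simp add: ix_def)
    have "ennreal (rt k * exp (P k \<bullet> S k)) * (\<Sum>j. ennreal (local_prob j (S k))) =
       (\<integral>\<^sup>+y. ennreal (rt k * exp (P k \<bullet> S k) * rt k) * (ennreal (local_prob (ix k y) (S k)) * indicator {0..} (real (N k) * r k + rt k * y)) \<partial>lborel)"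
      unfolding s using rt_pos[of k]
      by (subst nn_integral_cmult) (auto simp: ix_def ennreal_mult mult.assoc)
    also have "\<dots> = (\<integral>\<^sup>+y. ennreal (F k y) \<partial>lborel)"
    proof (intro nn_integral_cong)
      fix y
      have "rt k * exp (P k \<bullet> S k) * rt k = real (N k) * exp (P k \<bullet> S k)"
        by (simp add: rt_square[symmetric] power2_eq_square)
      then show "ennreal (rt k * exp (P k \<bullet> S k) * rt k) * (ennreal (local_prob (ix k y) (S k)) * indicator {0..} (real (N k) * r k + rt k * y)) = ennreal (F k y)"
        unfolding \<open>rt k * exp (P k \<bullet> S k) * rt k = real (N k) * exp (P k \<bullet> S k)\<close>
        by (auto simp: F_def indicator_def ennreal_mult[symmetric] local_prob_nonneg mult.assoc)
    qed
    finally have "enn2real (ennreal (rt k * exp (P k \<bullet> S k)) * (\<Sum>j. ennreal (local_prob j (S k)))) = enn2real (\<integral>\<^sup>+y. ennreal (F k y) \<partial>lborel)"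
      by simp
    also have "\<dots> = (\<integral>y. F k y \<partial>lborel)"
      by (rule integral_eq_nn_integral[symmetric]) (auto simp: F_nonneg)
    finally show ?thesis using rt_pos[of k] by (simp add: enn2real_mult)
  qed
  obtain B c where bound: "c > 0" "B \<ge> 0"
    "\<forall>\<^sub>F k in sequentially. \<forall>j. real (N k) * (exp (P k \<bullet> S k) * local_prob j (S k))
        \<le> B * exp (- (c * \<bar>(real j - real (N k) * r k) / rt k\<bar>))"
    by (rule local_prob_dominated) (rule that)
  have ix_near: "\<bar>(real (ix k y) - real (N k) * r k) / rt k - y\<bar> \<le> 1 / rt k" if "real (N k) * r k + rt k * y \<ge> 0" for k y
  proof -
    define x where "x = real (N k) * r k + rt k * y"
    have "\<bar>real (ix k y) - x\<bar> \<le> 1" using that unfolding ix_def x_def[symmetric] by linarith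
    moreover have "(real (ix k y) - real (N k) * r k) / rt k - y = (real (ix k y) - x) / rt k"
      using rt_pos[of k] by (simp add: x_def field_simps)
    ultimately show ?thesis using rt_pos[of k] by (simp add: abs_divide divide_right_mono)
  qed
  have "(\<lambda>k. \<integral>y. F k y \<partial>lborel) \<longlonglongrightarrow> (\<integral>y. first.mgf p * limit_density y \<partial>lborel)"
  proof (rule integral_dominated_convergence_eventually(1))
    show "(\<lambda>y. first.mgf p * limit_density y) \<in> borel_measurable lborel" unfolding limit_density_def by measurable
    show "F k \<in> borel_measurable lborel" for k by simp
    show "integrable lborel (\<lambda>y. B * exp c * exp (- (c * \<bar>y\<bar>)))"
      using exp_neg_abs_integrable[OF bound(1)] by (rule integrable_mult_right)
    show "\<forall>\<^sub>F k in sequentially. AE y in lborel. norm (F k y) \<le> B * exp c * exp (- (c * \<bar>y\<bar>))"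
      using bound(3)
    proof eventually_elim
      case (elim k)
      show ?case
      proof (rule AE_I2)
        fix y
        show "norm (F k y) \<le> B * exp c * exp (- (c * \<bar>y\<bar>))"
        proof (cases "real (N k) * r k + rt k * y \<ge> 0")
          case True
          have "rt k \<ge> 1" using N_pos[of k] by (simp add: rt_def Suc_leI)
          then have "1 / rt k \<le> 1" by simp
          moreover define z where "z = (real (ix k y) - real (N k) * r k) / rt k"
          moreover have "\<bar>z - y\<bar> \<le> 1 / rt k" unfolding z_def by (rule ix_near[OF True])
          ultimately have "\<bar>z - y\<bar> \<le> 1" by (meson order_trans)
          then have "\<bar>y\<bar> - 1 \<le> \<bar>z\<bar>"
            using abs_triangle_ineq2[of y z] abs_minus_commute[of y z] by simp
          then have "\<bar>y\<bar> - 1 \<le> \<bar>(real (ix k y) - real (N k) * r k) / rt k\<bar>" unfolding z_def .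
          then have "c * (\<bar>y\<bar> - 1) \<le> c * \<bar>(real (ix k y) - real (N k) * r k) / rt k\<bar>" using bound(1) by (intro mult_left_mono) auto
          then have "exp (- (c * \<bar>(real (ix k y) - real (N k) * r k) / rt k\<bar>)) \<le> exp c * exp (- (c * \<bar>y\<bar>))"
            unfolding mult_exp_exp by (simp add: algebra_simps)
          then have "B * exp (- (c * \<bar>(real (ix k y) - real (N k) * r k) / rt k\<bar>)) \<le> B * (exp c * exp (- (c * \<bar>y\<bar>)))"
            using bound(2) by (rule mult_left_mono)
          moreover have "norm (F k y) = real (N k) * (exp (P k \<bullet> S k) * local_prob (ix k y) (S k))"
            using True F_nonneg[of k y] by (simp add: F_def)
          ultimately show ?thesis using elim[rule_format, of "ix k y"] by (simp add: mult.assoc)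
        next
          case False
          then show ?thesis using bound(2) by (simp add: F_def)
        qed
      qed
    qed
    show "AE y in lborel. (\<lambda>k. F k y) \<longlonglongrightarrow> first.mgf p * limit_density y"
    proof (rule AE_I2)
      fix y
      have "filterlim (\<lambda>k. r k * rt k) at_top sequentially"
        by (rule filterlim_tendsto_pos_mult_at_top[OF r_lim rho_pos rt_lim])
      then have "\<forall>\<^sub>F k in sequentially. r k * rt k \<ge> - y" unfolding filterlim_at_top by blast
      then have ev: "\<forall>\<^sub>F k in sequentially. real (N k) * r k + rt k * y \<ge> 0"
      proof eventually_elim
        case (elim k)
        have "0 \<le> rt k * (r k * rt k + y)" using elim rt_pos[of k] by (intro mult_nonneg_nonneg) auto
        then show ?case by (simp add: rt_square[symmetric] power2_eq_square algebra_simps)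
      qed
      have "(\<lambda>k. (real (ix k y) - real (N k) * r k) / rt k - y) \<longlonglongrightarrow> 0"
        by (rule Lim_null_comparison[OF _ over_rt_lim[of 1]]) (use ev in \<open>auto elim!: eventually_mono simp: ix_near\<close>)
      then have "(\<lambda>k. (real (ix k y) - real (N k) * r k) / rt k) \<longlonglongrightarrow> y" by (simp add: LIM_zero_iff)
      from local_limit[OF this]
      show "(\<lambda>k. F k y) \<longlonglongrightarrow> first.mgf p * limit_density y"
        by (rule Lim_transform_eventually) (use ev in \<open>auto elim!: eventually_mono simp: F_def\<close>)
    qed
  qed
  then show ?thesis unfolding sum_eq by (simp add: limit_density_integral)
qed

end

context lattice_step
begin

lemma orth_var_tendsto:
  assumes p: "p \<in> interior dom" and P: "P \<longlonglongrightarrow> p"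
  shows "(\<lambda>k. orth_var (P k)) \<longlonglongrightarrow> orth_var p"
proof -
  have m: "(\<lambda>k. mom g (P k)) \<longlonglongrightarrow> mom g p" if "subexp g" for g
    by (rule isCont_tendsto_compose[OF mom_isCont[OF p that] P])
  have "mgf p \<noteq> 0" using p interior_subset mgf_pos by (metis less_irrefl subsetD)
  then show ?thesis
    unfolding orth_var_def cv_def mean_def fst_conv snd_conv by (intro tendsto_intros m) auto
qed

end

context delayed_walk
begin

lemma walk_fst_ge: "AE \<omega> in M. fst (walk X (Suc j) \<omega>) \<ge> real j"
proof -
  have pred: "Measurable.pred borel (\<lambda>y::real \<times> real. fst y \<ge> 1)"
    by (simp add: pred_def borel_closed closed_Collect_le continuous_intros)
  have "AE \<omega> in M. fst (X k \<omega>) \<ge> 1" if "k \<in> {2..Suc j}" for k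
    using AE_X_iff[OF _ pred, of k] AE_fst_ge_1 that by auto
  then have "AE \<omega> in M. \<forall>k\<in>{2..Suc j}. fst (X k \<omega>) \<ge> 1"
    by (intro AE_finite_allI) auto
  then show ?thesis using first_fst_nonneg
  proof eventually_elim
    case (elim \<omega>)
    have "{1..Suc j} = insert 1 {2..Suc j}" by auto
    then have "fst (walk X (Suc j) \<omega>) = fst (X 1 \<omega>) + (\<Sum>k\<in>{2..Suc j}. fst (X k \<omega>))"
      by (simp add: walk_def fst_sum)
    moreover have "(\<Sum>k\<in>{2..Suc j}. 1) \<le> (\<Sum>k\<in>{2..Suc j}. fst (X k \<omega>))"
      using elim(1) by (intro sum_mono) auto
    ultimately show ?case using elim(2) by simp
  qed
qed

lemma renewal_measure_singleton:
  assumes "s \<noteq> 0"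
  shows "renewal_measure M X {s} = (\<Sum>j. ennreal (local_prob j s))"
proof -
  define f where "f k = emeasure M {\<omega> \<in> space M. walk X k \<omega> \<in> {s}}" for k
  have "f 0 = 0" using assms by (simp add: f_def walk_def zero_prod_def)
  moreover have "f (Suc j) = ennreal (local_prob j s)" for j
    by (simp add: f_def local_prob_def emeasure_eq_measure)
  moreover have "(\<Sum>k. f k) = (\<Sum>k. f (k + 1)) + sum f {..<1}"
    by (rule suminf_offset) simp
  ultimately show ?thesis unfolding renewal_measure_def f_def[symmetric] by simp
qed

lemma renewal_sum_finite: "(\<Sum>j. ennreal (local_prob j s)) < \<infinity>"
proof -
  have "local_prob j s = 0" if "j \<notin> {..nat \<lceil>fst s\<rceil>}" for j
  proof -
    have less: "fst s < real j" using that by simp linarith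
    have "AE \<omega> in M. \<not> (walk X (Suc j) \<omega> = s)"
      using walk_fst_ge[of j] by eventually_elim (use less in auto)
    then have "prob {\<omega> \<in> space M. walk X (Suc j) \<omega> = s} = prob {}"
      using random_vector.Y_measurable[OF walk_random_vector, of "Suc j"]
      by (intro finite_measure_eq_AE) auto
    then show ?thesis by (simp add: local_prob_def)
  qed
  then have "(\<Sum>j. ennreal (local_prob j s)) = (\<Sum>j\<in>{..nat \<lceil>fst s\<rceil>}. ennreal (local_prob j s))"
    by (intro suminf_finite) auto
  also have "\<dots> < \<infinity>" by (subst sum_ennreal) (auto simp: local_prob_def)
  finally show ?thesis .
qed

definition main_term :: "nat \<Rightarrow> real \<times> real \<Rightarrow> real" where
  "main_term n v = 1 / sqrt (real n) * enn2real (psi M (X 1) (saddle M xi v)) * C_H M xi v *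
    exp (- (real n * real_of_ereal (second_deviation M xi v)))"

lemma main_term_eq:
  assumes v: "v \<in> deviation_cone M xi" and s: "saddle M xi v \<in> first.dom" and n: "n > 0"
  defines "q \<equiv> saddle M xi v" and "r \<equiv> fst v / fst (mean (saddle M xi v))"
  shows "main_term n v = first.mgf q * (1 / sqrt (2 * pi * r * orth_var q)) / (sqrt (real n) * exp (q \<bullet> (real n *\<^sub>R v)))"
    and "main_term n v > 0"
proof -
  note sp = saddle_props[OF v]
  have q: "q \<in> interior dom" using sp(1) by (simp add: q_def)
  have r: "r > 0" "v = r *\<^sub>R mean q" unfolding r_def q_def by (rule sp)+
  have f: "fst (mean q) > 0" using mean_fst_ge_1[OF q] by simp
  have C: "C_H M xi v = 1 / sqrt (2 * pi * r * orth_var q)"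
    by (rule C_H_eq[OF q q_def[THEN meta_eq_to_obj_eq, symmetric] r(2) r(1) f])
  have psi: "enn2real (psi M (X 1) q) = first.mgf q" using first.enn2real_psi s by (simp add: q_def)
  have "main_term n v = 1 / sqrt (real n) * first.mgf q * (1 / sqrt (2 * pi * r * orth_var q)) * exp (- (real n * (q \<bullet> v)))"
    unfolding main_term_def second_deviation_eq[OF v] q_def[symmetric] psi C by simp
  then show eq: "main_term n v = first.mgf q * (1 / sqrt (2 * pi * r * orth_var q)) / (sqrt (real n) * exp (q \<bullet> (real n *\<^sub>R v)))"
    by (simp add: exp_minus inverse_eq_divide)
  have "orth_var q > 0" by (rule orth_var_pos[OF q f])
  moreover have "first.mgf q > 0" using first.mgf_pos s by (simp add: q_def)
  ultimately show "main_term n v > 0" unfolding eq using n r(1) by simp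
qed

definition remainder :: "nat \<Rightarrow> real \<times> real \<Rightarrow> real" where
  "remainder n v = enn2real (renewal_measure M X {real n *\<^sub>R v}) / main_term n v - 1"

lemma remainder_tendsto_0:
  assumes N: "filterlim N at_top sequentially" "\<And>k. N k > 0"
    and v: "v \<longlonglongrightarrow> v0" "\<And>k. v k \<in> deviation_cone M xi" "v0 \<in> deviation_cone M xi"
    and lattice: "\<And>k. real (N k) *\<^sub>R v k \<in> \<int> \<times> \<int>"
    and first_int: "\<And>k. saddle M xi (v k) \<in> interior first.dom" "saddle M xi v0 \<in> interior first.dom"
  shows "(\<lambda>k. remainder (N k) (v k)) \<longlonglongrightarrow> 0"
proof -
  define P where "P k = saddle M xi (v k)" for k
  define p where "p = saddle M xi v0"
  define r where "r k = fst (v k) / fst (mean (P k))" for k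
  define \<rho> where "\<rho> = fst v0 / fst (mean p)"
  define S where "S k = real (N k) *\<^sub>R v k" for k
  note sp = saddle_props[OF v(2)] and sp0 = saddle_props[OF v(3)]
  have P_lim: "P \<longlonglongrightarrow> p"
    unfolding P_def p_def by (rule continuous_on_tendsto_compose[OF saddle_continuous v(1) v(3)]) (use v(2) in simp)
  have p_int: "p \<in> interior dom" using sp0(1) by (simp add: p_def)
  have mean_lim: "(\<lambda>k. mean (P k)) \<longlonglongrightarrow> mean p"
    using mean_has_derivative[OF p_int] has_derivative_continuous P_lim isCont_tendsto_compose by blast
  have f1: "fst (mean p) \<ge> 1" by (rule mean_fst_ge_1[OF p_int])
  have r_lim: "r \<longlonglongrightarrow> \<rho>"
    unfolding r_def \<rho>_def using f1 by (intro tendsto_divide tendsto_fst v(1) mean_lim) auto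
  have S_eq: "S k = (real (N k) * r k) *\<^sub>R mean (P k)" for k
  proof -
    have "v k = r k *\<^sub>R mean (P k)" unfolding r_def P_def by (rule sp(4))
    then show ?thesis unfolding S_def by (metis scaleR_scaleR)
  qed
  interpret saddle_sequence M xi \<delta> X N P S p r \<rho>
  proof
    show "P k \<in> interior dom" "mgf (P k) = 1" for k unfolding P_def by (rule sp)+
    show "P k \<in> interior first.dom" for k unfolding P_def by (rule first_int)
    show "p \<in> interior first.dom" unfolding p_def by (rule first_int)
    show "\<rho> > 0" unfolding \<rho>_def p_def by (rule sp0)
    show "S k \<in> \<int> \<times> \<int>" for k unfolding S_def by (rule lattice)
  qed (use N P_lim p_int r_lim S_eq in auto)
  define R where "R k = first.mgf (P k) * (1 / sqrt (2 * pi * r k * orth_var (P k)))" for k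
  define L where "L = first.mgf p * (1 / sqrt (2 * pi * \<rho> * orth_var p))"
  have orth: "orth_var p > 0" using orth_var_pos[OF p_int] f1 by simp
  have first_pos: "first.mgf p > 0" using first.mgf_pos p_interior(2) interior_subset by blast
  have L: "L > 0" unfolding L_def using first_pos orth rho_pos by simp
  have "R \<longlonglongrightarrow> L"
    unfolding R_def L_def using orth rho_pos
    by (intro tendsto_mult tendsto_divide tendsto_const tendsto_real_sqrt r_lim orth_var_tendsto[OF p_int P_lim]
        isCont_tendsto_compose[OF first.mom_isCont[OF p_interior(2)] P_lim]) auto
  moreover have "(\<lambda>k. rt k * exp (P k \<bullet> S k) * enn2real (\<Sum>j. ennreal (local_prob j (S k)))) \<longlonglongrightarrow> L"
    using renewal_limit by (simp add: L_def)
  ultimately have "(\<lambda>k. rt k * exp (P k \<bullet> S k) * enn2real (\<Sum>j. ennreal (local_prob j (S k))) / R k - 1) \<longlonglongrightarrow> L / L - 1"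
    using L by (intro tendsto_diff tendsto_divide tendsto_const) auto
  moreover have "rt k * exp (P k \<bullet> S k) * enn2real (\<Sum>j. ennreal (local_prob j (S k))) / R k - 1 = remainder (N k) (v k)" for k
  proof -
    have "fst (v k) > 0" using v(2)[of k] by (auto simp: deviation_cone_def)
    then have "S k \<noteq> 0" using N(2)[of k] by (auto simp: S_def prod_eq_iff)
    then have ren: "renewal_measure M X {S k} = (\<Sum>j. ennreal (local_prob j (S k)))" by (rule renewal_measure_singleton)
    have "main_term (N k) (v k) = R k / (rt k * exp (P k \<bullet> S k))"
      using main_term_eq(1)[OF v(2) _ N(2), of k k] P_dom(2)[of k] by (simp add: R_def P_def r_def S_def rt_def)
    then show ?thesis
      unfolding remainder_def S_def[symmetric] ren by (simp add: mult.commute)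
  qed
  ultimately show ?thesis using L by simp
qed

lemma remainder_uniform:
  assumes K: "compact K" "K \<subseteq> deviation_cone M xi" and sK: "saddle M xi ` K \<subseteq> interior first.dom" and \<eta>: "\<eta> > 0"
  shows "\<exists>n0. \<forall>n\<ge>n0. \<forall>v\<in>K. n > 0 \<longrightarrow> real n *\<^sub>R v \<in> \<int> \<times> \<int> \<longrightarrow> \<bar>remainder n v\<bar> \<le> \<eta>"
proof (rule ccontr)
  assume no: "\<not> ?thesis"
  define Q where "Q k z \<longleftrightarrow> fst z \<ge> k \<and> snd z \<in> K \<and> fst z > 0 \<and> real (fst z) *\<^sub>R snd z \<in> \<int> \<times> \<int> \<and>
    \<bar>remainder (fst z) (snd z)\<bar> > \<eta>" for k z
  have "\<exists>z. Q k z" for k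
  proof (rule ccontr)
    assume nex: "\<nexists>z. Q k z"
    have "\<bar>remainder n v\<bar> \<le> \<eta>" if "n \<ge> k" "v \<in> K" "n > 0" "real n *\<^sub>R v \<in> \<int> \<times> \<int>" for n v
    proof (rule ccontr)
      assume "\<not> \<bar>remainder n v\<bar> \<le> \<eta>"
      then have "Q k (n, v)" using that unfolding Q_def by simp
      then show False using nex by blast
    qed
    then have "\<exists>n0. \<forall>n\<ge>n0. \<forall>v\<in>K. n > 0 \<longrightarrow> real n *\<^sub>R v \<in> \<int> \<times> \<int> \<longrightarrow> \<bar>remainder n v\<bar> \<le> \<eta>"
      by (intro exI[of _ k] allI impI ballI)
    with no show False by (rule notE)
  qed
  then obtain z where z: "\<And>k. Q k (z k)" by metis
  define n v where "n k = fst (z k)" and "v k = snd (z k)" for k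
  have nv: "n k \<ge> k" "v k \<in> K" "n k > 0" "real (n k) *\<^sub>R v k \<in> \<int> \<times> \<int>" "\<bar>remainder (n k) (v k)\<bar> > \<eta>" for k
    using z[of k] unfolding Q_def n_def v_def by blast+
  obtain v0 \<sigma> where v0: "v0 \<in> K" "strict_mono \<sigma>" "(v \<circ> \<sigma>) \<longlonglongrightarrow> v0"
    using K(1) nv(2) unfolding compact_def by metis
  have "filterlim n at_top sequentially"
    using nv(1) by (intro filterlim_at_top_mono[OF filterlim_ident]) auto
  then have lim: "filterlim (\<lambda>k. n (\<sigma> k)) at_top sequentially"
    by (rule filterlim_compose[OF _ filterlim_subseq[OF v0(2)]])
  have "(\<lambda>k. remainder (n (\<sigma> k)) (v (\<sigma> k))) \<longlonglongrightarrow> 0"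
  proof (rule remainder_tendsto_0[OF lim])
    show "(\<lambda>k. v (\<sigma> k)) \<longlonglongrightarrow> v0" using v0(3) by (simp add: comp_def)
    show "n (\<sigma> k) > 0" "real (n (\<sigma> k)) *\<^sub>R v (\<sigma> k) \<in> \<int> \<times> \<int>" for k by (rule nv)+
    show "v (\<sigma> k) \<in> deviation_cone M xi" for k using K(2) nv(2) by blast
    show "v0 \<in> deviation_cone M xi" using K(2) v0(1) by blast
    show "saddle M xi (v (\<sigma> k)) \<in> interior first.dom" for k using sK nv(2) by blast
    show "saddle M xi v0 \<in> interior first.dom" using sK v0(1) by blast
  qed
  from tendstoD[OF this \<eta>] have "\<forall>\<^sub>F k in sequentially. \<bar>remainder (n (\<sigma> k)) (v (\<sigma> k))\<bar> < \<eta>"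
    by (simp add: dist_real_def)
  then obtain k where "\<bar>remainder (n (\<sigma> k)) (v (\<sigma> k))\<bar> < \<eta>" using eventually_happens'[OF sequentially_bot] by blast
  then show False using nv(5)[of "\<sigma> k"] by simp
qed

end

theorem theorem2p2:
  fixes M :: "'a measure"
    and xi :: "'a \<Rightarrow> real \<times> real"
    and X :: "nat \<Rightarrow> 'a \<Rightarrow> real \<times> real"
    and \<delta> :: real
    and K :: "(real \<times> real) set"
  assumes "prob_space M"
    and "xi \<in> borel_measurable M"
    and "AE \<omega> in M. fst (xi \<omega>) > 0"
    and "AE \<omega> in M. fst (X 1 \<omega>) \<ge> 0"
    and "prob_space.indep_vars M (\<lambda>_. borel) X {1..}"
    and "\<And>k. k \<ge> 2 \<Longrightarrow> distr M borel (X k) = distr M borel xi"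
    and "\<delta> > 0"
    and "integrable M (\<lambda>\<omega>. exp (\<delta> * norm (X 1 \<omega>)))"
    and "integrable M (\<lambda>\<omega>. exp (\<delta> * norm (xi \<omega>)))"
    and "AE \<omega> in M. X 1 \<omega> \<in> \<int> \<times> \<int>"
    and "\<And>u. u \<in> \<int> \<times> \<int> \<Longrightarrow> char_fun M xi ((2 * pi) *\<^sub>R u) = 1"
    and "\<And>u. u \<notin> \<int> \<times> \<int> \<Longrightarrow> norm (char_fun M xi ((2 * pi) *\<^sub>R u)) < 1"
    and "compact K"
    and "K \<subseteq> deviation_cone M xi"
    and "saddle M xi ` K \<subseteq> interior (psi_dom M (X 1))"
  shows "\<exists>\<epsilon> :: nat \<Rightarrow> int \<times> int \<Rightarrow> real.
    (\<forall>n t x. n > 0 \<and> (real_of_int t / real n, real_of_int x / real n) \<in> K \<longrightarrow>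
      (let v = (real_of_int t / real n, real_of_int x / real n);
           h = renewal_measure M X ({real_of_int t} \<times> {real_of_int x})
       in h < \<infinity> \<and>
          enn2real h =
            1 / sqrt (real n) * enn2real (psi M (X 1) (saddle M xi v)) * C_H M xi v *
            exp (- (real n * real_of_ereal (second_deviation M xi v))) * (1 + \<epsilon> n (t, x)))) \<and>
    (\<lambda>n. SUP (t, x)\<in>{(t, x). (real_of_int t / real n, real_of_int x / real n) \<in> K}.
            ennreal \<bar>\<epsilon> n (t, x)\<bar>) \<longlonglongrightarrow> 0"
proof -
  interpret prob_space M by fact
  interpret delayed_walk M xi \<delta> X
    using assms by unfold_locales auto
  define V where "V n = (\<lambda>(t, x). (real_of_int t / real n, real_of_int x / real n))" for n
  define \<epsilon> where "\<epsilon> n z = remainder n (V n z)" for n z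
  have scale: "real n *\<^sub>R V n (t, x) = (real_of_int t, real_of_int x)" if "n > 0" for n t x
    using that by (simp add: V_def)
  have eq: "renewal_measure M X ({real_of_int t} \<times> {real_of_int x}) < \<infinity>"
      "enn2real (renewal_measure M X ({real_of_int t} \<times> {real_of_int x})) = main_term n (V n (t, x)) * (1 + \<epsilon> n (t, x))"
    if n: "n > 0" and K: "V n (t, x) \<in> K" for n t x
  proof -
    have set_eq: "{real_of_int t} \<times> {real_of_int x} = {real n *\<^sub>R V n (t, x)}" using scale[OF n] by auto
    have cone: "V n (t, x) \<in> deviation_cone M xi" using K assms(14) by blast
    then have "fst (V n (t, x)) > 0" by (auto simp: deviation_cone_def)
    then have "real n *\<^sub>R V n (t, x) \<noteq> 0" using n by (auto simp: prod_eq_iff)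
    then show "renewal_measure M X ({real_of_int t} \<times> {real_of_int x}) < \<infinity>"
      unfolding set_eq using renewal_sum_finite by (simp add: renewal_measure_singleton)
    have "saddle M xi (V n (t, x)) \<in> first.dom" using K assms(15) interior_subset by blast
    then have "main_term n (V n (t, x)) > 0" using main_term_eq(2)[OF cone _ n] by blast
    then show "enn2real (renewal_measure M X ({real_of_int t} \<times> {real_of_int x})) = main_term n (V n (t, x)) * (1 + \<epsilon> n (t, x))"
      unfolding set_eq \<epsilon>_def remainder_def by simp
  qed
  have "(\<lambda>n. SUP (t, x)\<in>{(t, x). (real_of_int t / real n, real_of_int x / real n) \<in> K}. ennreal \<bar>\<epsilon> n (t, x)\<bar>) \<longlonglongrightarrow> 0"
  proof (rule order_tendstoI)
    fix a :: ennreal assume "0 < a"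
    then obtain b where b: "0 < b" "b < a" using dense by blast
    then obtain \<eta> where \<eta>: "b = ennreal \<eta>" "\<eta> > 0"
      by (cases b) auto
    obtain n0 where n0: "\<forall>n\<ge>n0. \<forall>v\<in>K. n > 0 \<longrightarrow> real n *\<^sub>R v \<in> \<int> \<times> \<int> \<longrightarrow> \<bar>remainder n v\<bar> \<le> \<eta>"
      using remainder_uniform[OF assms(13-15) \<eta>(2)] ..
    show "\<forall>\<^sub>F n in sequentially. (SUP (t, x)\<in>{(t, x). (real_of_int t / real n, real_of_int x / real n) \<in> K}. ennreal \<bar>\<epsilon> n (t, x)\<bar>) < a"
      using eventually_ge_at_top[of "max n0 1"]
    proof eventually_elim
      case (elim n)
      have "(SUP (t, x)\<in>{(t, x). (real_of_int t / real n, real_of_int x / real n) \<in> K}. ennreal \<bar>\<epsilon> n (t, x)\<bar>) \<le> ennreal \<eta>"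
      proof (rule SUP_least)
        fix z assume z: "z \<in> {(t, x). (real_of_int t / real n, real_of_int x / real n) \<in> K}"
        obtain t x where tx: "z = (t, x)" by (cases z)
        have "V n (t, x) \<in> K" using z tx by (simp add: V_def)
        then have "\<bar>\<epsilon> n (t, x)\<bar> \<le> \<eta>"
          unfolding \<epsilon>_def using elim scale[of n t x] by (intro n0[rule_format]) auto
        then show "(case z of (t, x) \<Rightarrow> ennreal \<bar>\<epsilon> n (t, x)\<bar>) \<le> ennreal \<eta>"
          using \<eta>(2) by (simp add: tx ennreal_leI)
      qed
      then show ?case using b(2) unfolding \<eta>(1) by (rule order_le_less_trans)
    qed
  qed simp
  moreover have "\<forall>n t x. n > 0 \<and> (real_of_int t / real n, real_of_int x / real n) \<in> K \<longrightarrow>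
      (let v = (real_of_int t / real n, real_of_int x / real n);
           h = renewal_measure M X ({real_of_int t} \<times> {real_of_int x})
       in h < \<infinity> \<and>
          enn2real h =
            1 / sqrt (real n) * enn2real (psi M (X 1) (saddle M xi v)) * C_H M xi v *
            exp (- (real n * real_of_ereal (second_deviation M xi v))) * (1 + \<epsilon> n (t, x)))"
    unfolding Let_def using eq[unfolded main_term_def V_def prod.case] by blast
  ultimately show ?thesis by blast
qed

end
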